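(* Let $\mathcal{D}$ be a $\lambda$-pretopos. Then $\mathcal{D}$ has filtered colimits of size $<\lambda$, and these are pullback-stable. Moreover any $\lambda$-geometric functor between $\lambda$-pretoposes preserves filtered colimits of size $<\lambda$.
   Context: $\lambda$ is an infinite regular cardinal. A $\lambda$-geometric category is a coherent category with pullback-stable unions of fewer than $\lambda$ subobjects; a $\lambda$-geometric functor preserves finite limits, effective epimorphisms and unions of fewer than $\lambda$ subobjects. A $\lambda$-pretopos is a $\lambda$-geometric category which is Barr-exact (internal equivalence relations are effective, i.e. have quotients of which they are the kernel pairs) and has disjoint, pullback-stable coproducts of size $<\lambda$. A filtered colimit of size $<\lambda$ is a colimit of a diagram indexed by a filtered category with fewer than $\lambda$ morphisms. *)

theory Defs
  imports Main
begin

unbundle cardinal_syntax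

section \<open>Categories and functors\<close>

record ('o, 'm) cat =
  Obj :: "'o set"
  Mor :: "'m set"
  Dom :: "'m \<Rightarrow> 'o"
  Cod :: "'m \<Rightarrow> 'o"
  Id :: "'o \<Rightarrow> 'm"
  Comp :: "'m \<Rightarrow> 'm \<Rightarrow> 'm" (infixl "\<cdot>\<index>" 70)

definition hom :: "('o, 'm) cat \<Rightarrow> 'o \<Rightarrow> 'o \<Rightarrow> 'm set" where
  "hom C a b = {f \<in> Mor C. Dom C f = a \<and> Cod C f = b}"

locale category =
  fixes C :: "('o, 'm) cat" (structure)
  assumes Dom_in_Obj: "f \<in> Mor C \<Longrightarrow> Dom C f \<in> Obj C"
    and Cod_in_Obj: "f \<in> Mor C \<Longrightarrow> Cod C f \<in> Obj C"
    and Id_in_hom: "a \<in> Obj C \<Longrightarrow> Id C a \<in> hom C a a"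
    and Comp_in_hom: "f \<in> hom C a b \<Longrightarrow> g \<in> hom C b c \<Longrightarrow> g \<cdot> f \<in> hom C a c"
    and Comp_assoc: "f \<in> hom C a b \<Longrightarrow> g \<in> hom C b c \<Longrightarrow> h \<in> hom C c d \<Longrightarrow>
          (h \<cdot> g) \<cdot> f = h \<cdot> (g \<cdot> f)"
    and Comp_Id_left: "f \<in> hom C a b \<Longrightarrow> Id C b \<cdot> f = f"
    and Comp_Id_right: "f \<in> hom C a b \<Longrightarrow> f \<cdot> Id C a = f"

record ('o, 'm, 'p, 'n) ftor =
  OMap :: "'o \<Rightarrow> 'p"
  MMap :: "'m \<Rightarrow> 'n"

locale cat_functor = A: category A + B: category B
  for A :: "('o, 'm) cat" and B :: "('p, 'n) cat" +
  fixes F :: "('o, 'm, 'p, 'n) ftor"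
  assumes OMap_in_Obj: "a \<in> Obj A \<Longrightarrow> OMap F a \<in> Obj B"
    and MMap_in_hom: "f \<in> hom A a b \<Longrightarrow> MMap F f \<in> hom B (OMap F a) (OMap F b)"
    and MMap_Id: "a \<in> Obj A \<Longrightarrow> MMap F (Id A a) = Id B (OMap F a)"
    and MMap_Comp: "f \<in> hom A a b \<Longrightarrow> g \<in> hom A b c \<Longrightarrow>
          MMap F (g \<cdot>\<^bsub>A\<^esub> f) = MMap F g \<cdot>\<^bsub>B\<^esub> MMap F f"

definition ftor_comp ::
  "('p, 'n, 'q, 'r) ftor \<Rightarrow> ('o, 'm, 'p, 'n) ftor \<Rightarrow> ('o, 'm, 'q, 'r) ftor" where
  "ftor_comp F G = \<lparr>OMap = OMap F \<circ> OMap G, MMap = MMap F \<circ> MMap G\<rparr>"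


section \<open>Limits and colimits\<close>

definition is_cone ::
  "('o, 'm) cat \<Rightarrow> ('i, 'j) cat \<Rightarrow> ('i, 'j, 'o, 'm) ftor \<Rightarrow> 'o \<Rightarrow> ('i \<Rightarrow> 'm) \<Rightarrow> bool" where
  "is_cone C J G x \<pi> \<longleftrightarrow> x \<in> Obj C \<and>
     (\<forall>i \<in> Obj J. \<pi> i \<in> hom C x (OMap G i)) \<and>
     (\<forall>u \<in> Mor J. MMap G u \<cdot>\<^bsub>C\<^esub> \<pi> (Dom J u) = \<pi> (Cod J u))"

definition is_limit ::
  "('o, 'm) cat \<Rightarrow> ('i, 'j) cat \<Rightarrow> ('i, 'j, 'o, 'm) ftor \<Rightarrow> 'o \<Rightarrow> ('i \<Rightarrow> 'm) \<Rightarrow> bool" where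
  "is_limit C J G x \<pi> \<longleftrightarrow> is_cone C J G x \<pi> \<and>
     (\<forall>y \<sigma>. is_cone C J G y \<sigma> \<longrightarrow>
        (\<exists>!h. h \<in> hom C y x \<and> (\<forall>i \<in> Obj J. \<pi> i \<cdot>\<^bsub>C\<^esub> h = \<sigma> i)))"

definition is_cocone ::
  "('o, 'm) cat \<Rightarrow> ('i, 'j) cat \<Rightarrow> ('i, 'j, 'o, 'm) ftor \<Rightarrow> 'o \<Rightarrow> ('i \<Rightarrow> 'm) \<Rightarrow> bool" where
  "is_cocone C J G x \<iota> \<longleftrightarrow> x \<in> Obj C \<and>
     (\<forall>i \<in> Obj J. \<iota> i \<in> hom C (OMap G i) x) \<and>
     (\<forall>u \<in> Mor J. \<iota> (Cod J u) \<cdot>\<^bsub>C\<^esub> MMap G u = \<iota> (Dom J u))"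

definition is_colimit ::
  "('o, 'm) cat \<Rightarrow> ('i, 'j) cat \<Rightarrow> ('i, 'j, 'o, 'm) ftor \<Rightarrow> 'o \<Rightarrow> ('i \<Rightarrow> 'm) \<Rightarrow> bool" where
  "is_colimit C J G x \<iota> \<longleftrightarrow> is_cocone C J G x \<iota> \<and>
     (\<forall>y \<sigma>. is_cocone C J G y \<sigma> \<longrightarrow>
        (\<exists>!h. h \<in> hom C x y \<and> (\<forall>i \<in> Obj J. h \<cdot>\<^bsub>C\<^esub> \<iota> i = \<sigma> i)))"

text \<open>
  Every category with finitely many morphisms is isomorphic to one whose objects and morphisms
  are natural numbers, so it suffices to take these as shapes of finite limits.
\<close>

definition has_finite_limits :: "('o, 'm) cat \<Rightarrow> bool" where
  "has_finite_limits C \<longleftrightarrow>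
     (\<forall>(J :: (nat, nat) cat) G. cat_functor J C G \<and> finite (Mor J) \<longrightarrow>
        (\<exists>x \<pi>. is_limit C J G x \<pi>))"

definition preserves_finite_limits ::
  "('o, 'm) cat \<Rightarrow> ('p, 'n) cat \<Rightarrow> ('o, 'm, 'p, 'n) ftor \<Rightarrow> bool" where
  "preserves_finite_limits A B F \<longleftrightarrow>
     (\<forall>(J :: (nat, nat) cat) G x \<pi>.
        cat_functor J A G \<and> finite (Mor J) \<and> is_limit A J G x \<pi> \<longrightarrow>
        is_limit B J (ftor_comp F G) (OMap F x) (\<lambda>i. MMap F (\<pi> i)))"

definition initial_object :: "('o, 'm) cat \<Rightarrow> 'o \<Rightarrow> bool" where
  "initial_object C a \<longleftrightarrow> a \<in> Obj C \<and> (\<forall>b \<in> Obj C. \<exists>!f. f \<in> hom C a b)"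

text \<open>
  \<open>is_pullback C f g p q\<close>: the square with \<open>f \<cdot> p = g \<cdot> q\<close> is a pullback, so \<open>p\<close> is the
  pullback of \<open>g\<close> along \<open>f\<close>.
\<close>

definition is_pullback :: "('o, 'm) cat \<Rightarrow> 'm \<Rightarrow> 'm \<Rightarrow> 'm \<Rightarrow> 'm \<Rightarrow> bool" where
  "is_pullback C f g p q \<longleftrightarrow>
     f \<in> Mor C \<and> g \<in> Mor C \<and> Cod C f = Cod C g \<and>
     p \<in> hom C (Dom C p) (Dom C f) \<and> q \<in> hom C (Dom C p) (Dom C g) \<and>
     f \<cdot>\<^bsub>C\<^esub> p = g \<cdot>\<^bsub>C\<^esub> q \<and>
     (\<forall>t. \<forall>a \<in> hom C t (Dom C f). \<forall>b \<in> hom C t (Dom C g). f \<cdot>\<^bsub>C\<^esub> a = g \<cdot>\<^bsub>C\<^esub> b \<longrightarrow>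
        (\<exists>!h. h \<in> hom C t (Dom C p) \<and> p \<cdot>\<^bsub>C\<^esub> h = a \<and> q \<cdot>\<^bsub>C\<^esub> h = b))"

definition is_coequalizer :: "('o, 'm) cat \<Rightarrow> 'm \<Rightarrow> 'm \<Rightarrow> 'm \<Rightarrow> bool" where
  "is_coequalizer C p q e \<longleftrightarrow>
     p \<in> Mor C \<and> q \<in> hom C (Dom C p) (Cod C p) \<and> e \<in> hom C (Cod C p) (Cod C e) \<and>
     e \<cdot>\<^bsub>C\<^esub> p = e \<cdot>\<^bsub>C\<^esub> q \<and>
     (\<forall>y. \<forall>f \<in> hom C (Cod C p) y. f \<cdot>\<^bsub>C\<^esub> p = f \<cdot>\<^bsub>C\<^esub> q \<longrightarrow>
        (\<exists>!h. h \<in> hom C (Cod C e) y \<and> h \<cdot>\<^bsub>C\<^esub> e = f))"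

definition is_coproduct :: "('o, 'm) cat \<Rightarrow> 'l set \<Rightarrow> ('l \<Rightarrow> 'o) \<Rightarrow> 'o \<Rightarrow> ('l \<Rightarrow> 'm) \<Rightarrow> bool" where
  "is_coproduct C I A x \<iota> \<longleftrightarrow> x \<in> Obj C \<and> (\<forall>i \<in> I. \<iota> i \<in> hom C (A i) x) \<and>
     (\<forall>y \<in> Obj C. \<forall>\<sigma>. (\<forall>i \<in> I. \<sigma> i \<in> hom C (A i) y) \<longrightarrow>
        (\<exists>!h. h \<in> hom C x y \<and> (\<forall>i \<in> I. h \<cdot>\<^bsub>C\<^esub> \<iota> i = \<sigma> i)))"


section \<open>Regular and coherent categories\<close>

definition mono_mor :: "('o, 'm) cat \<Rightarrow> 'm \<Rightarrow> bool" where
  "mono_mor C m \<longleftrightarrow> m \<in> Mor C \<and>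
     (\<forall>t. \<forall>f \<in> hom C t (Dom C m). \<forall>g \<in> hom C t (Dom C m). m \<cdot>\<^bsub>C\<^esub> f = m \<cdot>\<^bsub>C\<^esub> g \<longrightarrow> f = g)"

definition effective_epi :: "('o, 'm) cat \<Rightarrow> 'm \<Rightarrow> bool" where
  "effective_epi C e \<longleftrightarrow> (\<exists>p q. is_pullback C e e p q \<and> is_coequalizer C p q e)"

definition regular_category :: "('o, 'm) cat \<Rightarrow> bool" where
  "regular_category C \<longleftrightarrow> category C \<and> has_finite_limits C \<and>
     (\<forall>f \<in> Mor C. \<exists>e m. effective_epi C e \<and> mono_mor C m \<and> Cod C e = Dom C m \<and> m \<cdot>\<^bsub>C\<^esub> e = f) \<and>
     (\<forall>f e p q. effective_epi C e \<and> is_pullback C f e p q \<longrightarrow> effective_epi C p)"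

text \<open>
  Subobjects of \<open>x\<close> are handled through the monomorphisms into \<open>x\<close> representing them; mutually
  comparable monomorphisms represent the same subobject.
\<close>

definition subobjects :: "('o, 'm) cat \<Rightarrow> 'o \<Rightarrow> 'm set" where
  "subobjects C x = {m. mono_mor C m \<and> Cod C m = x}"

definition sub_le :: "('o, 'm) cat \<Rightarrow> 'm \<Rightarrow> 'm \<Rightarrow> bool" where
  "sub_le C m n \<longleftrightarrow> (\<exists>h \<in> hom C (Dom C m) (Dom C n). n \<cdot>\<^bsub>C\<^esub> h = m)"

definition is_union :: "('o, 'm) cat \<Rightarrow> 'o \<Rightarrow> 'm set \<Rightarrow> 'm \<Rightarrow> bool" where
  "is_union C x S u \<longleftrightarrow> u \<in> subobjects C x \<and> (\<forall>s \<in> S. sub_le C s u) \<and>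
     (\<forall>v \<in> subobjects C x. (\<forall>s \<in> S. sub_le C s v) \<longrightarrow> sub_le C u v)"

text \<open>\<open>m'\<close> represents the inverse image of the subobject \<open>m\<close> under \<open>f\<close>.\<close>

definition inverse_image :: "('o, 'm) cat \<Rightarrow> 'm \<Rightarrow> 'm \<Rightarrow> 'm \<Rightarrow> bool" where
  "inverse_image C f m m' \<longleftrightarrow> (\<exists>q. is_pullback C f m m' q)"

definition has_pullback_stable_union :: "('o, 'm) cat \<Rightarrow> 'o \<Rightarrow> 'm set \<Rightarrow> bool" where
  "has_pullback_stable_union C x S \<longleftrightarrow> (\<exists>u. is_union C x S u) \<and>
     (\<forall>u f u' t. is_union C x S u \<and> f \<in> Mor C \<and> Cod C f = x \<and> inverse_image C f u u' \<and>
        (\<forall>s \<in> S. inverse_image C f s (t s)) \<longrightarrow> is_union C (Dom C f) (t ` S) u')"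

definition coherent_category :: "('o, 'm) cat \<Rightarrow> bool" where
  "coherent_category C \<longleftrightarrow> regular_category C \<and>
     (\<forall>x \<in> Obj C. \<forall>S \<subseteq> subobjects C x. finite S \<longrightarrow> has_pullback_stable_union C x S)"


section \<open>Geometric categories and pretoposes relative to a cardinal\<close>

definition geometric_category :: "'l rel \<Rightarrow> ('o, 'm) cat \<Rightarrow> bool" where
  "geometric_category \<kappa> C \<longleftrightarrow> coherent_category C \<and>
     (\<forall>x \<in> Obj C. \<forall>S \<subseteq> subobjects C x. |S| <o \<kappa> \<longrightarrow> has_pullback_stable_union C x S)"

definition geometric_functor ::
  "'l rel \<Rightarrow> ('o, 'm) cat \<Rightarrow> ('p, 'n) cat \<Rightarrow> ('o, 'm, 'p, 'n) ftor \<Rightarrow> bool" where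
  "geometric_functor \<kappa> A B F \<longleftrightarrow> cat_functor A B F \<and> preserves_finite_limits A B F \<and>
     (\<forall>e. effective_epi A e \<longrightarrow> effective_epi B (MMap F e)) \<and>
     (\<forall>x \<in> Obj A. \<forall>S \<subseteq> subobjects A x. \<forall>u. |S| <o \<kappa> \<and> is_union A x S u \<longrightarrow>
        is_union B (OMap F x) (MMap F ` S) (MMap F u))"

definition internal_equivalence_relation :: "('o, 'm) cat \<Rightarrow> 'o \<Rightarrow> 'm \<Rightarrow> 'm \<Rightarrow> bool" where
  "internal_equivalence_relation C x r s \<longleftrightarrow>
     r \<in> hom C (Dom C r) x \<and> s \<in> hom C (Dom C r) x \<and>
     \<comment> \<open>jointly monic\<close>
     (\<forall>t. \<forall>f \<in> hom C t (Dom C r). \<forall>g \<in> hom C t (Dom C r).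
        r \<cdot>\<^bsub>C\<^esub> f = r \<cdot>\<^bsub>C\<^esub> g \<and> s \<cdot>\<^bsub>C\<^esub> f = s \<cdot>\<^bsub>C\<^esub> g \<longrightarrow> f = g) \<and>
     \<comment> \<open>reflexive\<close>
     (\<exists>d \<in> hom C x (Dom C r). r \<cdot>\<^bsub>C\<^esub> d = Id C x \<and> s \<cdot>\<^bsub>C\<^esub> d = Id C x) \<and>
     \<comment> \<open>symmetric\<close>
     (\<exists>\<sigma> \<in> hom C (Dom C r) (Dom C r). r \<cdot>\<^bsub>C\<^esub> \<sigma> = s \<and> s \<cdot>\<^bsub>C\<^esub> \<sigma> = r) \<and>
     \<comment> \<open>transitive\<close>
     (\<exists>p q. is_pullback C s r p q \<and>
        (\<exists>\<tau> \<in> hom C (Dom C p) (Dom C r). r \<cdot>\<^bsub>C\<^esub> \<tau> = r \<cdot>\<^bsub>C\<^esub> p \<and> s \<cdot>\<^bsub>C\<^esub> \<tau> = s \<cdot>\<^bsub>C\<^esub> q))"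

definition barr_exact :: "('o, 'm) cat \<Rightarrow> bool" where
  "barr_exact C \<longleftrightarrow> regular_category C \<and>
     (\<forall>x \<in> Obj C. \<forall>r s. internal_equivalence_relation C x r s \<longrightarrow>
        (\<exists>e. is_coequalizer C r s e \<and> is_pullback C e e r s))"

definition disjoint_coproduct :: "('o, 'm) cat \<Rightarrow> 'l set \<Rightarrow> ('l \<Rightarrow> 'm) \<Rightarrow> bool" where
  "disjoint_coproduct C I \<iota> \<longleftrightarrow> (\<forall>i \<in> I. mono_mor C (\<iota> i)) \<and>
     (\<forall>i \<in> I. \<forall>j \<in> I. i \<noteq> j \<longrightarrow>
        (\<forall>p q. is_pullback C (\<iota> i) (\<iota> j) p q \<longrightarrow> initial_object C (Dom C p)))"

definition pullback_stable_coproduct :: "('o, 'm) cat \<Rightarrow> 'l set \<Rightarrow> 'o \<Rightarrow> ('l \<Rightarrow> 'm) \<Rightarrow> bool" where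
  "pullback_stable_coproduct C I x \<iota> \<longleftrightarrow>
     (\<forall>f p q. f \<in> Mor C \<and> Cod C f = x \<and> (\<forall>i \<in> I. is_pullback C f (\<iota> i) (p i) (q i)) \<longrightarrow>
        is_coproduct C I (\<lambda>i. Dom C (p i)) (Dom C f) p)"

text \<open>
  A set of fewer than \<open>\<kappa>\<close> elements is in bijection with a subset of the field of \<open>\<kappa>\<close>, so it
  suffices to consider coproducts indexed by sets of the type underlying \<open>\<kappa>\<close>.
\<close>

definition pretopos :: "'l rel \<Rightarrow> ('o, 'm) cat \<Rightarrow> bool" where
  "pretopos \<kappa> C \<longleftrightarrow> geometric_category \<kappa> C \<and> barr_exact C \<and>
     (\<forall>(I :: 'l set) A. |I| <o \<kappa> \<and> (\<forall>i \<in> I. A i \<in> Obj C) \<longrightarrow>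
        (\<exists>x \<iota>. is_coproduct C I A x \<iota>) \<and>
        (\<forall>x \<iota>. is_coproduct C I A x \<iota> \<longrightarrow>
           disjoint_coproduct C I \<iota> \<and> pullback_stable_coproduct C I x \<iota>))"


section \<open>Filtered colimits\<close>

definition filtered_category :: "('i, 'j) cat \<Rightarrow> bool" where
  "filtered_category J \<longleftrightarrow> category J \<and> Obj J \<noteq> {} \<and>
     (\<forall>a \<in> Obj J. \<forall>b \<in> Obj J. \<exists>c f g. f \<in> hom J a c \<and> g \<in> hom J b c) \<and>
     (\<forall>a b. \<forall>f \<in> hom J a b. \<forall>g \<in> hom J a b. \<exists>c. \<exists>h \<in> hom J b c. h \<cdot>\<^bsub>J\<^esub> f = h \<cdot>\<^bsub>J\<^esub> g)"

text \<open>
  A colimit cocone \<open>\<iota>\<close> on \<open>G\<close> with vertex \<open>x\<close> is pullback-stable if, for every \<open>f : y \<rightarrow> x\<close>, the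
  pullbacks of the \<open>\<iota> i\<close> along \<open>f\<close> form a colimit cocone with vertex \<open>y\<close>.  Here \<open>G'\<close> is the diagram
  of the pulled back objects; its transition morphisms are the ones induced by the universal
  property, being determined by the two compatibility equations.
\<close>

definition pullback_stable_colimit ::
  "('o, 'm) cat \<Rightarrow> ('i, 'j) cat \<Rightarrow> ('i, 'j, 'o, 'm) ftor \<Rightarrow> 'o \<Rightarrow> ('i \<Rightarrow> 'm) \<Rightarrow> bool" where
  "pullback_stable_colimit C J G x \<iota> \<longleftrightarrow>
     (\<forall>f G' p q. f \<in> Mor C \<and> Cod C f = x \<and> cat_functor J C G' \<and>
        (\<forall>i \<in> Obj J. Dom C (p i) = OMap G' i \<and> is_pullback C f (\<iota> i) (p i) (q i)) \<and>
        (\<forall>u \<in> Mor J. p (Cod J u) \<cdot>\<^bsub>C\<^esub> MMap G' u = p (Dom J u) \<and>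
                      q (Cod J u) \<cdot>\<^bsub>C\<^esub> MMap G' u = MMap G u \<cdot>\<^bsub>C\<^esub> q (Dom J u)) \<longrightarrow>
        is_colimit C J G' (Dom C f) p)"

end

theory Submission
  imports Defs
begin

text \<open>
  Filtered colimits of sets are recognized by two conditions on a cocone \<open>\<iota>\<close> with vertex \<open>x\<close>: every
  element of \<open>x\<close> comes from some stage, and two elements of stages with the same image in \<open>x\<close>
  already become equal at some later stage.  The proof transports this description to the internal
  logic.  An element of \<open>x\<close> is a morphism \<open>a : t \<rightarrow> x\<close>, and "there is" means "there is after restriction
  along a covering family of \<open>t\<close>", where a family covers \<open>t\<close> if every subobject of \<open>t\<close> through which all
  members factor is all of \<open>t\<close>.  A cocone satisfying the two conditions in this sense is called
  locally exact (\<open>locally_exact_cocone\<close>).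

  The point of the notion is that it uses finite limits, images and unions of fewer than \<open>\<kappa>\<close>
  subobjects only, so that its stability is easy, whereas the universal property is hard to move
  around.

  \<^item> Covering families with fewer than \<open>\<kappa>\<close> members are stable under pullback (\<open>covers_stable\<close>), because
    images and small unions are.  To prove that a morphism factors through a subobject, or that two
    morphisms agree, one may therefore restrict along a covering family (\<open>sub_le_local\<close>, \<open>eq_local\<close>).

  \<^item> A locally exact cocone is a colimit (\<open>locally_exact_cocone_colimit\<close>).  A second cocone \<open>\<sigma>\<close> with
    vertex \<open>y\<close> determines the union \<open>R\<close> of the images of \<open>(\<iota> i, \<sigma> i)\<close> in \<open>x \<times> y\<close>.  The second condition makes
    \<open>R \<rightarrow> x\<close> a monomorphism and the first makes it an isomorphism, so that \<open>R\<close> is the graph of the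
    required morphism \<open>x \<rightarrow> y\<close>.

  \<^item> Every small filtered diagram in a pretopos has a locally exact cocone
    (\<open>locally_exact_cocone_exists\<close>).  On the coproduct of the diagram take the union of the images of
    all fibre products of \<open>G i \<rightarrow> G k\<close> and \<open>G j \<rightarrow> G k\<close>.  It is reflexive and symmetric for trivial
    reasons, and transitive because the diagram is filtered and coproducts are disjoint.  The
    quotient by this equivalence relation is the vertex of the cocone.

  Since colimits are unique up to isomorphism, every colimit cocone of a small filtered diagram is
  then locally exact (\<open>colimit_locally_exact\<close>).  Local exactness is inherited by pulled back cocones
  (\<open>locally_exact_cocone_pullback\<close>) by chasing elements, and it is preserved by geometric functors
  (\<open>geometric_functor_locally_exact\<close>) because it can be tested on small covering families.  Applying
  the second point again gives both remaining assertions.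
\<close>

section \<open>Generalized elements and covering families\<close>

definition arrows_into :: "('o, 'm) cat \<Rightarrow> 'o \<Rightarrow> 'm set" where
  "arrows_into C t = {c \<in> Mor C. Cod C c = t}"

text \<open>
  The members of \<open>S\<close> are jointly extremal: in a geometric category and for small \<open>S\<close> this says that
  the union of their images is \<open>t\<close>.  Speaking of arbitrary sets of morphisms, in particular of sieves,
  avoids having to choose representatives.
\<close>

definition covers :: "('o, 'm) cat \<Rightarrow> 'o \<Rightarrow> 'm set \<Rightarrow> bool" where
  "covers C t S \<longleftrightarrow> t \<in> Obj C \<and> S \<subseteq> arrows_into C t \<and>
     (\<forall>n \<in> subobjects C t. (\<forall>c \<in> S. sub_le C c n) \<longrightarrow> sub_le C (Id C t) n)"

context category
begin

lemma Comp_typing [simp]: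
  assumes "f \<in> Mor C" "g \<in> Mor C" "Cod C f = Dom C g"
  shows "g \<cdot> f \<in> Mor C" "Dom C (g \<cdot> f) = Dom C f" "Cod C (g \<cdot> f) = Cod C g"
  using Comp_in_hom[of f "Dom C f" "Cod C f" g "Cod C g"] assms by (auto simp: hom_def)

lemma Comp_assoc_Mor [simp]:
  assumes "f \<in> Mor C" "g \<in> Mor C" "h \<in> Mor C" "Cod C f = Dom C g" "Cod C g = Dom C h"
  shows "(h \<cdot> g) \<cdot> f = h \<cdot> (g \<cdot> f)"
  using Comp_assoc[of f "Dom C f" "Cod C f" g "Cod C g" h "Cod C h"] assms by (auto simp: hom_def)

lemma Id_typing [simp]:
  assumes "a \<in> Obj C"
  shows "Id C a \<in> Mor C" "Dom C (Id C a) = a" "Cod C (Id C a) = a"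
  using Id_in_hom[OF assms] by (auto simp: hom_def)

lemma Comp_Id_Mor [simp]:
  "f \<in> Mor C \<Longrightarrow> Id C (Cod C f) \<cdot> f = f" "f \<in> Mor C \<Longrightarrow> f \<cdot> Id C (Dom C f) = f"
  using Comp_Id_left[of f "Dom C f" "Cod C f"] Comp_Id_right[of f "Dom C f" "Cod C f"]
  by (auto simp: hom_def)

lemma Dom_Cod_Obj [simp]: "f \<in> Mor C \<Longrightarrow> Dom C f \<in> Obj C" "f \<in> Mor C \<Longrightarrow> Cod C f \<in> Obj C"
  by (rule Dom_in_Obj Cod_in_Obj; assumption)+

lemma hom_Obj: "f \<in> hom C a b \<Longrightarrow> a \<in> Obj C" "f \<in> hom C a b \<Longrightarrow> b \<in> Obj C"
  by (auto simp: hom_def)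

lemma Comp_extend:
  assumes "g \<cdot> f = g' \<cdot> f'" "f \<in> hom C a b" "g \<in> hom C b c" "f' \<in> hom C a b'" "g' \<in> hom C b' c"
    "h \<in> hom C t a"
  shows "g \<cdot> (f \<cdot> h) = g' \<cdot> (f' \<cdot> h)"
  using Comp_assoc[OF assms(6,2,3)] Comp_assoc[OF assms(6,4,5)] assms(1) by simp

lemma Comp_reassoc:
  assumes "g \<cdot> f = e" "f \<in> hom C a b" "g \<in> hom C b c" "h \<in> hom C t a"
  shows "g \<cdot> (f \<cdot> h) = e \<cdot> h"
  using Comp_assoc[OF assms(4,2,3)] assms(1) by simp

text \<open>
  The relation \<^const>\<open>sub_le\<close> is used below also when its first argument is not a monomorphism; it then
  says that one morphism factors through the other.
\<close>

lemma sub_leI: "h \<in> hom C a (Dom C n) \<Longrightarrow> n \<cdot> h = m \<Longrightarrow> n \<in> Mor C \<Longrightarrow> sub_le C m n"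
  unfolding sub_le_def by (auto simp: hom_def)

lemma sub_leE:
  assumes "sub_le C m n" "m \<in> hom C a b"
  obtains h where "h \<in> hom C a (Dom C n)" "n \<cdot> h = m"
  using assms unfolding sub_le_def by (auto simp: hom_def)

lemma sub_le_Comp:
  assumes "sub_le C m n" "m \<in> hom C a b" "n \<in> Mor C" "Cod C n = b" "h \<in> hom C t a"
  shows "sub_le C (m \<cdot> h) n"
proof -
  obtain k where k: "k \<in> hom C a (Dom C n)" "n \<cdot> k = m" using assms(1,2) by (rule sub_leE)
  show ?thesis by (rule sub_leI[of "k \<cdot> h" t]) (use k assms in \<open>auto simp: hom_def\<close>)
qed

lemma sub_le_trans:
  assumes "sub_le C l m" "sub_le C m n" "l \<in> Mor C" "m \<in> Mor C" "n \<in> Mor C" "Cod C n = Cod C m"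
  shows "sub_le C l n"
proof -
  obtain h where h: "h \<in> hom C (Dom C l) (Dom C m)" "m \<cdot> h = l"
    using assms unfolding sub_le_def by auto
  have "sub_le C (m \<cdot> h) n"
    by (rule sub_le_Comp[OF assms(2), of "Dom C m" "Cod C m"]) (use h assms in \<open>auto simp: hom_def\<close>)
  then show ?thesis using h by simp
qed

lemma mono_cancel:
  assumes "mono_mor C m" "f \<in> hom C t (Dom C m)" "g \<in> hom C t (Dom C m)" "m \<cdot> f = m \<cdot> g"
  shows "f = g"
  using assms by (auto simp: mono_mor_def)

lemma pullback_typing:
  assumes "is_pullback C f g p q"
  shows "f \<in> Mor C" "g \<in> Mor C" "Cod C f = Cod C g" "p \<in> hom C (Dom C p) (Dom C f)"
    "q \<in> hom C (Dom C p) (Dom C g)" "f \<cdot> p = g \<cdot> q"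
  using assms by (auto simp: is_pullback_def)

lemma pullback_lift:
  assumes "is_pullback C f g p q" "a \<in> hom C t (Dom C f)" "b \<in> hom C t (Dom C g)" "f \<cdot> a = g \<cdot> b"
  obtains h where "h \<in> hom C t (Dom C p)" "p \<cdot> h = a" "q \<cdot> h = b"
  using assms unfolding is_pullback_def by blast

lemma pullback_unique:
  assumes pb: "is_pullback C f g p q" and h: "h \<in> hom C t (Dom C p)" "k \<in> hom C t (Dom C p)"
    and eq: "p \<cdot> h = p \<cdot> k" "q \<cdot> h = q \<cdot> k"
  shows "h = k"
proof -
  note ty = pullback_typing[OF pb]
  have 1: "p \<cdot> h \<in> hom C t (Dom C f)" "q \<cdot> h \<in> hom C t (Dom C g)"
    using h ty by (auto simp: hom_def)
  have 2: "f \<cdot> (p \<cdot> h) = g \<cdot> (q \<cdot> h)"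
    by (rule Comp_extend[OF ty(6,4) _ ty(5)]) (use ty h in \<open>auto simp: hom_def\<close>)
  show ?thesis using pb 1 2 h eq unfolding is_pullback_def by metis
qed

lemma pullback_mono:
  assumes pb: "is_pullback C f m m' q" and m: "mono_mor C m"
  shows "m' \<in> subobjects C (Dom C f)"
proof -
  note ty = pullback_typing[OF pb]
  have "h = k" if h: "h \<in> hom C t (Dom C m')" "k \<in> hom C t (Dom C m')" "m' \<cdot> h = m' \<cdot> k" for t h k
  proof (rule pullback_unique[OF pb h])
    show "q \<cdot> h = q \<cdot> k"
    proof (rule mono_cancel[OF m])
      have "f \<cdot> (m' \<cdot> h) = m \<cdot> (q \<cdot> h)" "f \<cdot> (m' \<cdot> k) = m \<cdot> (q \<cdot> k)"
        by (rule Comp_extend[OF ty(6,4) _ ty(5), of "Cod C f"]; use ty h in \<open>simp add: hom_def\<close>)+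
      then show "m \<cdot> (q \<cdot> h) = m \<cdot> (q \<cdot> k)" using h by simp
    qed (use ty h in \<open>auto simp: hom_def\<close>)
  qed
  then show ?thesis using ty by (auto simp: subobjects_def mono_mor_def hom_def)
qed

lemma coequalizer_typing:
  assumes "is_coequalizer C p q e"
  shows "p \<in> Mor C" "q \<in> hom C (Dom C p) (Cod C p)" "e \<in> hom C (Cod C p) (Cod C e)"
    "e \<cdot> p = e \<cdot> q"
  using assms by (auto simp: is_coequalizer_def)

lemma coequalizer_factor:
  assumes "is_coequalizer C p q e" "f \<in> hom C (Cod C p) y" "f \<cdot> p = f \<cdot> q"
  obtains h where "h \<in> hom C (Cod C e) y" "h \<cdot> e = f"
  using assms unfolding is_coequalizer_def by blast

lemma coequalizer_epi:
  assumes co: "is_coequalizer C p q e" and h: "h \<in> hom C (Cod C e) y" "k \<in> hom C (Cod C e) y"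
    and eq: "h \<cdot> e = k \<cdot> e"
  shows "h = k"
proof -
  note ty = coequalizer_typing[OF co]
  have p: "p \<in> hom C (Dom C p) (Cod C p)" using ty by (simp add: hom_def)
  have "h \<cdot> e \<in> hom C (Cod C p) y" by (rule Comp_in_hom[OF ty(3) h(1)])
  moreover have "(h \<cdot> e) \<cdot> p = (h \<cdot> e) \<cdot> q"
    unfolding Comp_assoc[OF p ty(3) h(1)] Comp_assoc[OF ty(2,3) h(1)] ty(4) ..
  ultimately have "\<exists>!l. l \<in> hom C (Cod C e) y \<and> l \<cdot> e = h \<cdot> e"
    using co unfolding is_coequalizer_def by blast
  then show ?thesis using h eq by auto
qed

text \<open>
  If \<open>e\<close> factors through a monomorphism \<open>n\<close>, the other factor equalizes the kernel pair of \<open>e\<close> as well,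
  hence descends along \<open>e\<close> to a section of \<open>n\<close>.
\<close>

lemma effective_epi_covers:
  assumes "effective_epi C e"
  shows "covers C (Cod C e) {e}"
proof -
  obtain p q where pb: "is_pullback C e e p q" and co: "is_coequalizer C p q e"
    using assms by (auto simp: effective_epi_def)
  note ty = pullback_typing[OF pb]
  have cop: "Cod C p = Dom C e" using ty by (simp add: hom_def)
  have "sub_le C (Id C (Cod C e)) n" if n: "n \<in> subobjects C (Cod C e)" "sub_le C e n" for n
  proof -
    have nM: "n \<in> hom C (Dom C n) (Cod C e)" "mono_mor C n"
      using n by (auto simp: subobjects_def mono_mor_def hom_def)
    obtain k where k: "k \<in> hom C (Dom C e) (Dom C n)" "n \<cdot> k = e"
      using n unfolding sub_le_def by auto
    have "k \<cdot> p = k \<cdot> q"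
    proof (rule mono_cancel[OF nM(2)])
      have "n \<cdot> (k \<cdot> p) = e \<cdot> p" "n \<cdot> (k \<cdot> q) = e \<cdot> q"
        by (rule Comp_reassoc[OF k(2,1) nM(1)], fact)+
      then show "n \<cdot> (k \<cdot> p) = n \<cdot> (k \<cdot> q)" using ty by simp
    qed (rule Comp_in_hom[OF _ k(1)], fact)+
    then obtain h where h: "h \<in> hom C (Cod C e) (Dom C n)" "h \<cdot> e = k"
      using coequalizer_factor[OF co, of k "Dom C n"] k cop by auto
    have "n \<cdot> h = Id C (Cod C e)"
    proof (rule coequalizer_epi[OF co])
      show "n \<cdot> h \<in> hom C (Cod C e) (Cod C e)" by (rule Comp_in_hom[OF h(1) nM(1)])
      show "Id C (Cod C e) \<in> hom C (Cod C e) (Cod C e)" using ty by (auto simp: Id_in_hom)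
      have "(n \<cdot> h) \<cdot> e = n \<cdot> (h \<cdot> e)"
        by (rule Comp_assoc[OF _ h(1) nM(1)]) (use ty in \<open>simp add: hom_def\<close>)
      then show "(n \<cdot> h) \<cdot> e = Id C (Cod C e) \<cdot> e" using k h ty by simp
    qed
    then show ?thesis using h nM by (auto intro: sub_leI simp: hom_def)
  qed
  then show ?thesis using ty by (auto simp: covers_def arrows_into_def)
qed

end

section \<open>Pullbacks and terminal objects from finite limits\<close>

text \<open>
  The shape \<open>0 \<rightarrow> 2 \<leftarrow> 1\<close>: the numbers 0, 1 and 2 stand for the objects and their identities, 3 and 4 for
  the two other morphisms.
\<close>

definition cospan_shape :: "(nat, nat) cat" where
  "cospan_shape = \<lparr>Obj = {0, 1, 2}, Mor = {0, 1, 2, 3, 4},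
     Dom = (\<lambda>n. if n = 3 then 0 else if n = 4 then 1 else n),
     Cod = (\<lambda>n. if n \<le> 1 then n else 2), Id = (\<lambda>n. n),
     Comp = (\<lambda>g f. if f \<le> 2 then g else f)\<rparr>"

definition cospan_diagram :: "('o, 'm) cat \<Rightarrow> 'm \<Rightarrow> 'm \<Rightarrow> (nat, nat, 'o, 'm) ftor" where
  "cospan_diagram C f g =
     (let ob = (\<lambda>n. if n = 0 then Dom C f else if n = 1 then Dom C g else Cod C f)
      in \<lparr>OMap = ob, MMap = (\<lambda>n. if n = 3 then f else if n = 4 then g else Id C (ob n))\<rparr>)"

lemma cospan_shape_category: "category cospan_shape"
  by unfold_locales (auto simp: cospan_shape_def hom_def split: if_splits)

lemma cospan_diagram_functor:
  fixes C :: "('o, 'm) cat" (structure)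
  assumes "category C" "f \<in> Mor C" "g \<in> Mor C" "Cod C f = Cod C g"
  shows "cat_functor cospan_shape C (cospan_diagram C f g)"
proof -
  interpret category C by fact
  interpret S: category cospan_shape by (rule cospan_shape_category)
  show ?thesis
  proof unfold_locales
    fix u v a b c assume "u \<in> hom cospan_shape a b" "v \<in> hom cospan_shape b c"
    then show "MMap (cospan_diagram C f g) (v \<cdot>\<^bsub>cospan_shape\<^esub> u) =
      MMap (cospan_diagram C f g) v \<cdot> MMap (cospan_diagram C f g) u"
      using assms(2-4) Comp_Id_Mor[of f] Comp_Id_Mor[of g]
        Comp_Id_left[OF Id_in_hom, of "Dom C f"] Comp_Id_left[OF Id_in_hom, of "Cod C f"]
        Comp_Id_left[OF Id_in_hom, of "Dom C g"]
      by (auto simp: cospan_shape_def cospan_diagram_def hom_def Let_def split: if_splits)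
  qed (use assms(2-4) in \<open>auto simp: cospan_shape_def cospan_diagram_def hom_def Let_def
        split: if_splits\<close>)
qed

context
  fixes C :: "('o, 'm) cat" (structure) and H :: "(nat, nat, 'o, 'm) ftor"
  assumes H: "cat_functor cospan_shape C H"
begin

interpretation H: cat_functor cospan_shape C H by (rule H)

private lemma H_typing:
  "MMap H 3 \<in> Mor C" "Dom C (MMap H 3) = OMap H 0" "Cod C (MMap H 3) = OMap H 2"
  "MMap H 4 \<in> Mor C" "Dom C (MMap H 4) = OMap H 1" "Cod C (MMap H 4) = OMap H 2"
  using H.MMap_in_hom[of 3 0 2] H.MMap_in_hom[of 4 1 2]
  by (simp_all add: cospan_shape_def hom_def)

private lemma H_Id: "n \<le> 2 \<Longrightarrow> MMap H n = Id C (OMap H n)"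
  using H.MMap_Id[of n] by (simp add: cospan_shape_def) linarith

lemma cospan_cone_iff:
  "is_cone C cospan_shape H x \<sigma> \<longleftrightarrow>
     \<sigma> 0 \<in> hom C x (OMap H 0) \<and> \<sigma> 1 \<in> hom C x (OMap H 1) \<and>
     \<sigma> 2 = MMap H 3 \<cdot> \<sigma> 0 \<and> MMap H 3 \<cdot> \<sigma> 0 = MMap H 4 \<cdot> \<sigma> 1" (is "?L \<longleftrightarrow> ?R")
proof
  assume ?L
  then show ?R
    by (auto simp: is_cone_def cospan_shape_def)
next
  assume R: ?R
  have x: "x \<in> Obj C" using R by (auto intro: H.B.hom_Obj)
  have s2: "\<sigma> 2 \<in> hom C x (OMap H 2)"
    using R H_typing by (auto simp: hom_def)
  have "MMap H n \<cdot> \<sigma> n = \<sigma> n" if "n \<in> {0, 1, 2}" for n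
    using that R s2 H_Id[of n] H.B.Comp_Id_left[of "\<sigma> n" x "OMap H n"] by auto
  from this[of 0] this[of 1] this[of 2] show ?L
    using R x s2 by (auto simp: is_cone_def cospan_shape_def)
qed

lemma pullback_of_cospan_limit:
  assumes L: "is_limit C cospan_shape H x \<pi>"
  shows "is_pullback C (MMap H 3) (MMap H 4) (\<pi> 0) (\<pi> 1)"
proof -
  have c: "is_cone C cospan_shape H x \<pi>" using L by (simp add: is_limit_def)
  note \<pi> = c[unfolded cospan_cone_iff]
  have dom: "Dom C (\<pi> 0) = x" using \<pi> by (simp add: hom_def)
  have "\<exists>!h. h \<in> hom C t x \<and> \<pi> 0 \<cdot> h = a \<and> \<pi> 1 \<cdot> h = b"
    if ab: "a \<in> hom C t (OMap H 0)" "b \<in> hom C t (OMap H 1)" "MMap H 3 \<cdot> a = MMap H 4 \<cdot> b" for t a b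
  proof -
    let ?\<sigma> = "\<lambda>n::nat. if n = 0 then a else if n = 1 then b else MMap H 3 \<cdot> a"
    have "is_cone C cospan_shape H t ?\<sigma>" unfolding cospan_cone_iff using ab by simp
    then have ex: "\<exists>!h. h \<in> hom C t x \<and> (\<forall>i \<in> Obj cospan_shape. \<pi> i \<cdot> h = ?\<sigma> i)"
      using L by (simp add: is_limit_def)
    have "(\<forall>i \<in> Obj cospan_shape. \<pi> i \<cdot> h = ?\<sigma> i) \<longleftrightarrow> \<pi> 0 \<cdot> h = a \<and> \<pi> 1 \<cdot> h = b"
      if h: "h \<in> hom C t x" for h
    proof -
      have "\<pi> 2 \<cdot> h = MMap H 3 \<cdot> (\<pi> 0 \<cdot> h)"
        using H.B.Comp_assoc[OF h, of "\<pi> 0" "OMap H 0" "MMap H 3" "OMap H 2"] \<pi> H_typing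
        by (simp add: hom_def)
      then show ?thesis by (auto simp: cospan_shape_def)
    qed
    then show ?thesis using ex by (metis (no_types, lifting))
  qed
  then show ?thesis
    using \<pi> H_typing dom by (auto simp: is_pullback_def hom_def)
qed

lemma cospan_limit_of_pullback:
  assumes pb: "is_pullback C (MMap H 3) (MMap H 4) p q"
  shows "is_limit C cospan_shape H (Dom C p)
           (\<lambda>n. if n = 0 then p else if n = 1 then q else MMap H 3 \<cdot> p)" (is "is_limit _ _ _ _ ?\<pi>")
proof -
  note ty = H.B.pullback_typing[OF pb]
  have "is_cone C cospan_shape H (Dom C p) ?\<pi>"
    unfolding cospan_cone_iff using ty H_typing by simp
  moreover have "\<exists>!h. h \<in> hom C y (Dom C p) \<and> (\<forall>i \<in> Obj cospan_shape. ?\<pi> i \<cdot> h = \<sigma> i)"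
    if \<sigma>: "is_cone C cospan_shape H y \<sigma>" for y \<sigma>
  proof -
    note \<sigma>' = \<sigma>[unfolded cospan_cone_iff]
    have ex: "\<exists>!h. h \<in> hom C y (Dom C p) \<and> p \<cdot> h = \<sigma> 0 \<and> q \<cdot> h = \<sigma> 1"
      using pb \<sigma>' H_typing unfolding is_pullback_def by auto
    have "(\<forall>i \<in> Obj cospan_shape. ?\<pi> i \<cdot> h = \<sigma> i) \<longleftrightarrow> p \<cdot> h = \<sigma> 0 \<and> q \<cdot> h = \<sigma> 1"
      if h: "h \<in> hom C y (Dom C p)" for h
      using \<sigma>' H.B.Comp_assoc[OF h ty(4), of "MMap H 3" "OMap H 2"] H_typing
      by (auto simp: cospan_shape_def hom_def)
    then show ?thesis using ex by (metis (no_types, lifting))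
  qed
  ultimately show ?thesis by (simp add: is_limit_def)
qed

end

lemma ex_pullback:
  assumes "category C" "has_finite_limits C" "f \<in> Mor C" "g \<in> Mor C" "Cod C f = Cod C g"
  shows "\<exists>p q. is_pullback C f g p q"
proof -
  have H: "cat_functor cospan_shape C (cospan_diagram C f g)"
    by (rule cospan_diagram_functor) fact+
  moreover have "finite (Mor cospan_shape)" by (simp add: cospan_shape_def)
  ultimately obtain x \<pi> where "is_limit C cospan_shape (cospan_diagram C f g) x \<pi>"
    using assms(2) unfolding has_finite_limits_def by blast
  from pullback_of_cospan_limit[OF H this] show ?thesis
    by (auto simp: cospan_diagram_def Let_def)
qed

lemma ftor_comp_functor:
  assumes "cat_functor A B F" "cat_functor J A G"
  shows "cat_functor J B (ftor_comp F G)"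
proof -
  interpret F: cat_functor A B F by fact
  interpret G: cat_functor J A G by fact
  show ?thesis
    by unfold_locales
      (auto simp: ftor_comp_def F.OMap_in_Obj G.OMap_in_Obj G.MMap_Id F.MMap_Id
        intro: F.MMap_in_hom G.MMap_in_hom G.MMap_Comp
        simp: G.MMap_Comp F.MMap_Comp[OF G.MMap_in_hom G.MMap_in_hom])
qed

text \<open>
  Preservation of pullback squares follows from preservation of limits of shape \<^const>\<open>cospan_shape\<close>,
  since pullback squares and limit cones of that shape carry the same data.
\<close>

lemma preserves_pullback:
  assumes F: "cat_functor A B F" "preserves_finite_limits A B F" and pb: "is_pullback A f g p q"
  shows "is_pullback B (MMap F f) (MMap F g) (MMap F p) (MMap F q)"
proof -
  interpret F: cat_functor A B F by fact
  let ?H = "cospan_diagram A f g"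
  note ty = F.A.pullback_typing[OF pb]
  have H: "cat_functor cospan_shape A ?H"
    by (rule cospan_diagram_functor[OF F.A.category_axioms ty(1-3)])
  have 34: "MMap ?H 3 = f" "MMap ?H 4 = g" by (simp_all add: cospan_diagram_def Let_def)
  have "finite (Mor cospan_shape)" by (simp add: cospan_shape_def)
  then have "is_limit B cospan_shape (ftor_comp F ?H) (OMap F (Dom A p))
      (\<lambda>n. MMap F (if n = 0 then p else if n = 1 then q else f \<cdot>\<^bsub>A\<^esub> p))"
    using F(2) H cospan_limit_of_pullback[OF H, of p q] pb
    unfolding preserves_finite_limits_def 34 by blast
  from pullback_of_cospan_limit[OF ftor_comp_functor[OF F(1) H] this] show ?thesis
    by (simp add: ftor_comp_def 34)
qed

lemma ex_terminal:
  assumes "category C" "has_finite_limits C"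
  shows "\<exists>z \<in> Obj C. \<forall>t \<in> Obj C. \<exists>!f. f \<in> hom C t z"
proof -
  interpret category C by fact
  let ?J = "\<lparr>Obj = {}, Mor = {}, Dom = \<lambda>n. n, Cod = \<lambda>n. n, Id = \<lambda>n. n, Comp = \<lambda>m n. n\<rparr> :: (nat, nat) cat"
  let ?G = "\<lparr>OMap = \<lambda>_. undefined, MMap = \<lambda>_. undefined\<rparr> :: (nat, nat, 'a, 'b) ftor"
  have "cat_functor ?J C ?G" by unfold_locales (auto simp: hom_def)
  then obtain x \<pi> where "is_limit C ?J ?G x \<pi>"
    using assms(2) unfolding has_finite_limits_def by force
  then show ?thesis by (intro bexI[of _ x]) (auto simp: is_limit_def is_cone_def)
qed

section \<open>Local reasoning in regular categories\<close>

definition jointly_monic :: "('o, 'm) cat \<Rightarrow> 'm \<Rightarrow> 'm \<Rightarrow> bool" where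
  "jointly_monic C r s \<longleftrightarrow> (\<forall>t. \<forall>f \<in> hom C t (Dom C r). \<forall>g \<in> hom C t (Dom C r).
     r \<cdot>\<^bsub>C\<^esub> f = r \<cdot>\<^bsub>C\<^esub> g \<and> s \<cdot>\<^bsub>C\<^esub> f = s \<cdot>\<^bsub>C\<^esub> g \<longrightarrow> f = g)"

lemma jointly_monicD:
  assumes "jointly_monic C r s" "f \<in> hom C t (Dom C r)" "g \<in> hom C t (Dom C r)"
    "r \<cdot>\<^bsub>C\<^esub> f = r \<cdot>\<^bsub>C\<^esub> g" "s \<cdot>\<^bsub>C\<^esub> f = s \<cdot>\<^bsub>C\<^esub> g"
  shows "f = g"
  using assms by (simp add: jointly_monic_def)

lemma covers_into: "covers C t S \<Longrightarrow> c \<in> S \<Longrightarrow> c \<in> hom C (Dom C c) t"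
  by (auto simp: covers_def arrows_into_def hom_def)

lemma covers_mono: "covers C t S \<Longrightarrow> S \<subseteq> T \<Longrightarrow> T \<subseteq> arrows_into C t \<Longrightarrow> covers C t T"
  unfolding covers_def by blast

lemma subobjects_hom: "m \<in> subobjects C x \<Longrightarrow> m \<in> hom C (Dom C m) x"
  by (auto simp: subobjects_def mono_mor_def hom_def)

text \<open>
  Passing to a coarser family: it suffices that each member of a covering family factors through some
  member of the new one.
\<close>

lemma covers_refine:
  assumes "category C" "covers C t T" "S \<subseteq> arrows_into C t" "\<And>c. c \<in> T \<Longrightarrow> \<exists>f \<in> S. sub_le C c f"
  shows "covers C t S"
  unfolding covers_def
proof (intro conjI ballI impI)
  interpret category C by fact
  show "t \<in> Obj C" using assms(2) by (simp add: covers_def)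
  show "S \<subseteq> arrows_into C t" by fact
  fix n assume n: "n \<in> subobjects C t" and all: "\<forall>c \<in> S. sub_le C c n"
  have "sub_le C c n" if c: "c \<in> T" for c
  proof -
    obtain f where f: "f \<in> S" "sub_le C c f" using assms(4)[OF c] by blast
    have "c \<in> arrows_into C t" "f \<in> arrows_into C t"
      using c f(1) assms(2,3) by (auto simp: covers_def)
    then show ?thesis
      using sub_le_trans[OF f(2), of n] all f(1) subobjects_hom[OF n]
      by (auto simp: arrows_into_def hom_def)
  qed
  then show "sub_le C (Id C t) n" using assms(2) n by (simp add: covers_def)
qed

locale regular_cat = category C for C :: "('o, 'm) cat" (structure) +
  assumes regular: "regular_category C"
begin

lemma pullback_exists:
  assumes "f \<in> hom C a c" "g \<in> hom C b c"
  obtains p q where "is_pullback C f g p q"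
  using ex_pullback[OF category_axioms, of f g] assms regular
  by (auto simp: regular_category_def hom_def)

lemma image_exists:
  assumes "f \<in> Mor C"
  shows "\<exists>e m. effective_epi C e \<and> mono_mor C m \<and> Cod C e = Dom C m \<and> m \<cdot> e = f"
  using assms regular by (auto simp: regular_category_def)

text \<open>
  The product is the pullback over the terminal object.
\<close>

lemma product_exists:
  assumes "x \<in> Obj C" "y \<in> Obj C"
  obtains z p q where "p \<in> hom C z x" "q \<in> hom C z y" "jointly_monic C p q"
    "\<And>t a b. a \<in> hom C t x \<Longrightarrow> b \<in> hom C t y \<Longrightarrow> \<exists>h \<in> hom C t z. p \<cdot> h = a \<and> q \<cdot> h = b"
proof -
  obtain o1 where o1: "o1 \<in> Obj C" "\<And>t. t \<in> Obj C \<Longrightarrow> \<exists>!f. f \<in> hom C t o1"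
    using ex_terminal[OF category_axioms] regular by (auto simp: regular_category_def)
  obtain f g where fg: "f \<in> hom C x o1" "g \<in> hom C y o1" using o1 assms by blast
  obtain p q where pb: "is_pullback C f g p q" by (rule pullback_exists[OF fg])
  note ty = pullback_typing[OF pb]
  have dom: "Dom C f = x" "Dom C g = y" using fg by (auto simp: hom_def)
  show ?thesis
  proof
    show "p \<in> hom C (Dom C p) x" "q \<in> hom C (Dom C p) y" using ty dom by auto
    show "jointly_monic C p q"
      unfolding jointly_monic_def by (blast intro: pullback_unique[OF pb])
    fix t a b assume ab: "a \<in> hom C t x" "b \<in> hom C t y"
    have "f \<cdot> a \<in> hom C t o1" "g \<cdot> b \<in> hom C t o1" using ab fg by (auto intro: Comp_in_hom)
    then have "f \<cdot> a = g \<cdot> b" using o1(2)[OF hom_Obj(1)[OF ab(1)]] by auto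
    then show "\<exists>h \<in> hom C t (Dom C p). p \<cdot> h = a \<and> q \<cdot> h = b"
      using pullback_lift[OF pb, of a t b] ab dom by metis
  qed
qed

text \<open>
  Factoring through a subobject is a local property: the inverse image of \<open>m\<close> under \<open>h\<close> is a subobject
  of \<open>t\<close> through which every member of the covering family factors.
\<close>

lemma sub_le_local:
  assumes cov: "covers C t S" and h: "h \<in> hom C t y" and m: "m \<in> subobjects C y"
    and loc: "\<And>c r. c \<in> S \<Longrightarrow> c \<in> hom C r t \<Longrightarrow> sub_le C (h \<cdot> c) m"
  shows "sub_le C h m"
proof -
  have m': "m \<in> hom C (Dom C m) y" "mono_mor C m"
    using m by (auto simp: subobjects_def mono_mor_def hom_def)
  obtain n q where pb: "is_pullback C h m n q" by (rule pullback_exists[OF h m'(1)])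
  note ty = pullback_typing[OF pb]
  have dom: "Dom C h = t" using h by (simp add: hom_def)
  have n: "n \<in> subobjects C t" using pullback_mono[OF pb m'(2)] dom by simp
  have "sub_le C c n" if c: "c \<in> S" for c
  proof -
    have ch: "c \<in> hom C (Dom C c) t" by (rule covers_into[OF cov c])
    obtain k where k: "k \<in> hom C (Dom C c) (Dom C m)" "m \<cdot> k = h \<cdot> c"
      by (rule sub_leE[OF loc[OF c ch] Comp_in_hom[OF ch h]])
    obtain l where "l \<in> hom C (Dom C c) (Dom C n)" "n \<cdot> l = c"
      using pullback_lift[OF pb, of c "Dom C c" k] ch k dom by metis
    then show ?thesis using subobjects_hom[OF n] by (auto intro: sub_leI simp: hom_def)
  qed
  then have "sub_le C (Id C t) n" using cov n by (auto simp: covers_def)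
  then obtain l where l: "l \<in> hom C t (Dom C n)" "n \<cdot> l = Id C t"
    by (rule sub_leE[OF _ Id_in_hom[OF hom_Obj(1)[OF h]]])
  have "m \<cdot> (q \<cdot> l) = h \<cdot> (n \<cdot> l)"
    by (rule Comp_extend[OF ty(6)[symmetric] ty(5) m'(1) ty(4) _ l(1)]) (use h dom in simp)
  then have "m \<cdot> (q \<cdot> l) = h" using l h Comp_Id_right by simp
  moreover have "q \<cdot> l \<in> hom C (Dom C h) (Dom C m)"
    unfolding dom by (rule Comp_in_hom[OF l(1) ty(5)])
  ultimately show ?thesis unfolding sub_le_def by blast
qed

text \<open>
  Equality is factorization of the pair \<open>(f, g)\<close> through the diagonal, hence a special case of the
  previous lemma.
\<close>

lemma eq_local:
  assumes cov: "covers C t S" and f: "f \<in> hom C t y" and g: "g \<in> hom C t y"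
    and loc: "\<And>c r. c \<in> S \<Longrightarrow> c \<in> hom C r t \<Longrightarrow> f \<cdot> c = g \<cdot> c"
  shows "f = g"
proof -
  have y: "y \<in> Obj C" by (rule hom_Obj[OF f])
  note I = Id_in_hom[OF y]
  obtain z p q where pq: "p \<in> hom C z y" "q \<in> hom C z y" "jointly_monic C p q"
    "\<And>t a b. a \<in> hom C t y \<Longrightarrow> b \<in> hom C t y \<Longrightarrow> \<exists>h \<in> hom C t z. p \<cdot> h = a \<and> q \<cdot> h = b"
    using product_exists[OF y y] by metis
  have pz: "Dom C p = z" using pq by (simp add: hom_def)
  obtain d where d: "d \<in> hom C y z" "p \<cdot> d = Id C y" "q \<cdot> d = Id C y"
    using pq(4)[OF I I] by auto
  have pd: "p \<cdot> (d \<cdot> k) = k" "q \<cdot> (d \<cdot> k) = k" if "k \<in> hom C r y" for k r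
    using Comp_reassoc[OF d(2,1) pq(1) that] Comp_reassoc[OF d(3,1) pq(2) that]
      Comp_Id_left[OF that] by auto
  have dm: "d \<in> subobjects C z"
  proof -
    have "k = l" if "k \<in> hom C r y" "l \<in> hom C r y" "d \<cdot> k = d \<cdot> l" for k l r
      using pd(1)[OF that(1)] pd(1)[OF that(2)] that(3) by metis
    moreover have "d \<in> Mor C" "Dom C d = y" "Cod C d = z" using d(1) by (simp_all add: hom_def)
    ultimately show ?thesis by (simp add: subobjects_def mono_mor_def)
  qed
  obtain h where h: "h \<in> hom C t z" "p \<cdot> h = f" "q \<cdot> h = g" using pq(4)[OF f g] by auto
  have "sub_le C h d"
  proof (rule sub_le_local[OF cov h(1) dm])
    fix c r assume c: "c \<in> S" "c \<in> hom C r t"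
    have fc: "f \<cdot> c \<in> hom C r y" by (rule Comp_in_hom[OF c(2) f])
    have "d \<cdot> (f \<cdot> c) = h \<cdot> c"
    proof (rule jointly_monicD[OF pq(3), of _ r])
      show "p \<cdot> (d \<cdot> (f \<cdot> c)) = p \<cdot> (h \<cdot> c)" "q \<cdot> (d \<cdot> (f \<cdot> c)) = q \<cdot> (h \<cdot> c)"
        using pd[OF fc] Comp_reassoc[OF h(2,1) pq(1) c(2)] Comp_reassoc[OF h(3,1) pq(2) c(2)]
          loc[OF c] by auto
    qed (unfold pz, (rule Comp_in_hom[OF fc d(1)] Comp_in_hom[OF c(2) h(1)])+)
    then show "sub_le C (h \<cdot> c) d"
      using fc d(1) by (auto intro!: sub_leI[of "f \<cdot> c" r] simp: hom_def)
  qed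
  then obtain k where "k \<in> hom C t (Dom C d)" "d \<cdot> k = h" by (rule sub_leE[OF _ h(1)])
  moreover have "Dom C d = y" using d by (simp add: hom_def)
  ultimately show ?thesis using pd[of k t] h by simp
qed

lemma image_sub_le_iff:
  assumes e: "effective_epi C e" and m: "m \<in> hom C (Cod C e) x" and n: "n \<in> subobjects C x"
  shows "sub_le C (m \<cdot> e) n \<longleftrightarrow> sub_le C m n"
proof
  assume "sub_le C (m \<cdot> e) n"
  then show "sub_le C m n"
    by (intro sub_le_local[OF effective_epi_covers[OF e] m n]) auto
next
  have "e \<in> hom C (Dom C e) (Cod C e)"
    using effective_epi_covers[OF e] by (simp add: covers_def arrows_into_def hom_def)
  moreover assume "sub_le C m n"
  ultimately show "sub_le C (m \<cdot> e) n"
    using sub_le_Comp[OF _ m] subobjects_hom[OF n] by (simp add: hom_def)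
qed

lemma Id_subobject: "t \<in> Obj C \<Longrightarrow> Id C t \<in> subobjects C t"
  using Comp_Id_left by (auto simp: subobjects_def mono_mor_def)

lemma sub_le_Id: "f \<in> hom C a t \<Longrightarrow> sub_le C f (Id C t)"
  using Comp_Id_left hom_Obj[of f a t] by (auto intro!: sub_leI[of f a])

text \<open>
  This links covering families with the unions that geometric categories and functors speak of.
\<close>

lemma union_images_iff_covers:
  assumes t: "t \<in> Obj C" and S: "S \<subseteq> arrows_into C t"
    and im: "\<And>f. f \<in> S \<Longrightarrow> effective_epi C (e f) \<and> mono_mor C (m f) \<and> Cod C (e f) = Dom C (m f)
                \<and> m f \<cdot> e f = f"
  shows "is_union C t (m ` S) (Id C t) \<longleftrightarrow> covers C t S" "m ` S \<subseteq> subobjects C t"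
proof -
  have mh: "m f \<in> subobjects C t" "m f \<in> hom C (Cod C (e f)) t" if "f \<in> S" for f
  proof -
    have "e f \<in> Mor C" using im[OF that] by (auto simp: effective_epi_def is_pullback_def)
    then have "Cod C (m f) = Cod C f" using im[OF that] Comp_typing(3)[of "e f" "m f"]
      by (auto simp: mono_mor_def)
    moreover have "Cod C f = t" using that S by (auto simp: arrows_into_def)
    ultimately show "m f \<in> subobjects C t" "m f \<in> hom C (Cod C (e f)) t"
      using im[OF that] by (auto simp: subobjects_def hom_def mono_mor_def)
  qed
  then show "m ` S \<subseteq> subobjects C t" by auto
  have "sub_le C (m f) n \<longleftrightarrow> sub_le C f n" if "f \<in> S" "n \<in> subobjects C t" for f n
    using image_sub_le_iff[of "e f" "m f" t n] im[OF that(1)] mh[OF that(1)] that(2) by auto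
  moreover have "sub_le C (m f) (Id C t)" if "f \<in> S" for f
    by (rule sub_le_Id[OF mh(2)[OF that]])
  ultimately show "is_union C t (m ` S) (Id C t) \<longleftrightarrow> covers C t S"
    using t S Id_subobject[OF t] by (auto simp: is_union_def covers_def)
qed

end

section \<open>Small covering families in geometric categories\<close>

lemma card_finite_less:
  assumes "Cinfinite \<kappa>" "finite A"
  shows "|A| <o \<kappa>"
  using assms by (intro finite_ordLess_infinite[OF card_of_Well_order card_order_on_well_order_on])
    (auto simp: cinfinite_def Field_card_of)

lemma card_Times_self_less:
  assumes "Cinfinite \<kappa>" "|A| <o \<kappa>"
  shows "|A \<times> A| <o \<kappa>"
proof (cases "finite A")
  case True
  then show ?thesis by (intro card_finite_less[OF assms(1)]) simp
next
  case False
  then have "|A \<times> A| =o |A|" by (intro card_of_Times_same_infinite)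
  then show ?thesis by (rule ordIso_ordLess_trans[OF _ assms(2)])
qed

locale geometric_cat = category C for C :: "('o, 'm) cat" (structure) +
  fixes \<kappa> :: "'l rel"
  assumes Cinfinite_\<kappa>: "Cinfinite \<kappa>" and geometric: "geometric_category \<kappa> C"
begin

sublocale regular_cat
  by unfold_locales (use geometric in \<open>auto simp: geometric_category_def coherent_category_def\<close>)

lemma small_image: "|K| <o \<kappa> \<Longrightarrow> |f ` K| <o \<kappa>"
  by (rule ordLeq_ordLess_trans[OF card_of_image])

lemma small_union_stable:
  assumes "x \<in> Obj C" "S \<subseteq> subobjects C x" "|S| <o \<kappa>"
  shows "has_pullback_stable_union C x S"
  using geometric assms unfolding geometric_category_def by blast

text \<open>
  Write \<open>f = m f \<cdot> e f\<close> with \<open>m f\<close> the image of \<open>f\<close>.  The subobjects \<open>m f\<close> have union \<open>t\<close>, hence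
  their inverse images under \<open>g\<close> have union \<open>s\<close>; and each inverse image is itself the image of a
  morphism that \<open>g\<close> carries through \<open>f\<close>, obtained from a pullback of \<open>e f\<close>.  The conclusion names the
  whole sieve of morphisms that \<open>g\<close> carries into \<open>S\<close>, since this is what later arguments restrict along.
\<close>

lemma covers_stable:
  assumes cov: "covers C t S" and small: "|S| <o \<kappa>" and g: "g \<in> hom C s t"
  shows "covers C s {c \<in> arrows_into C s. \<exists>f \<in> S. sub_le C (g \<cdot> c) f}"
proof -
  have t: "t \<in> Obj C" and S: "S \<subseteq> arrows_into C t" using cov by (auto simp: covers_def)
  have gd: "Dom C g = s" using g by (simp add: hom_def)
  have "\<forall>f \<in> S. \<exists>e m. effective_epi C e \<and> mono_mor C m \<and> Cod C e = Dom C m \<and> m \<cdot> e = f"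
    using S image_exists unfolding arrows_into_def by blast
  then obtain e m where im: "\<And>f. f \<in> S \<Longrightarrow> effective_epi C (e f) \<and> mono_mor C (m f) \<and>
      Cod C (e f) = Dom C (m f) \<and> m f \<cdot> e f = f" by metis
  have U: "is_union C t (m ` S) (Id C t) \<longleftrightarrow> covers C t S" "m ` S \<subseteq> subobjects C t"
    by (rule union_images_iff_covers[where e = e, OF t S], erule im)+
  have union: "is_union C t (m ` S) (Id C t)" using U cov by simp
  have mh: "m f \<in> hom C (Dom C (m f)) t" if "f \<in> S" for f
    by (rule subobjects_hom) (use U(2) that in blast)
  have "\<forall>n \<in> m ` S. \<exists>n' q. is_pullback C g n n' q"
  proof
    fix n assume "n \<in> m ` S"
    then have "n \<in> subobjects C t" by (rule subsetD[OF U(2)])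
    then obtain n' q where "is_pullback C g n n' q" by (rule pullback_exists[OF g subobjects_hom])
    then show "\<exists>n' q. is_pullback C g n n' q" by blast
  qed
  then obtain \<tau> \<rho> where \<tau>: "\<And>n. n \<in> m ` S \<Longrightarrow> is_pullback C g n (\<tau> n) (\<rho> n)" by metis
  have "is_pullback C g (Id C t) (Id C s) g"
  proof -
    note s = hom_Obj(1)[OF g]
    have "\<exists>!h. h \<in> hom C r s \<and> Id C s \<cdot> h = a \<and> g \<cdot> h = b"
      if "a \<in> hom C r s" "b \<in> hom C r t" "g \<cdot> a = Id C t \<cdot> b" for r a b
      using that Comp_Id_left[OF that(1)] Comp_Id_left[OF that(2)] Comp_Id_left[of _ r s] by metis
    then show ?thesis
      using g s t Comp_Id_left[OF g] Comp_Id_right[OF g] Id_in_hom[OF s]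
      by (simp add: is_pullback_def gd) (simp add: hom_def)
  qed
  then have inv: "inverse_image C g (Id C t) (Id C s)" by (auto simp: inverse_image_def)
  have stable: "has_pullback_stable_union C t (m ` S)"
    by (rule small_union_stable[OF t U(2) small_image[OF small]])
  have union': "is_union C s (\<tau> ` m ` S) (Id C s)"
  proof -
    have "\<forall>n \<in> m ` S. inverse_image C g n (\<tau> n)" using \<tau> by (auto simp: inverse_image_def)
    moreover have "g \<in> Mor C" "Cod C g = t" using g by (simp_all add: hom_def)
    ultimately have "is_union C (Dom C g) (\<tau> ` m ` S) (Id C s)"
      using stable union inv unfolding has_pullback_stable_union_def by blast
    then show ?thesis using gd by simp
  qed
  show ?thesis unfolding covers_def
  proof (intro conjI ballI impI)
    show "s \<in> Obj C" by (rule hom_Obj[OF g])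
    fix n assume n: "n \<in> subobjects C s"
      and all: "\<forall>c \<in> {c \<in> arrows_into C s. \<exists>f \<in> S. sub_le C (g \<cdot> c) f}. sub_le C c n"
    have "sub_le C (\<tau> (m f)) n" if f: "f \<in> S" for f
    proof -
      note pb = \<tau>[OF imageI[OF f]]
      note ty = pullback_typing[OF pb]
      have eh: "e f \<in> hom C (Dom C (e f)) (Dom C (m f))"
        using im[OF f] by (auto simp: effective_epi_def is_pullback_def hom_def)
      obtain e' r where pb': "is_pullback C (\<rho> (m f)) (e f) e' r"
        by (rule pullback_exists[OF ty(5) eh])
      note ty' = pullback_typing[OF pb']
      have e': "effective_epi C e'" using regular pb' im[OF f] unfolding regular_category_def by blast
      have domr: "Dom C (\<rho> (m f)) = Dom C (\<tau> (m f))" using ty(5) by (simp add: hom_def)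
      have th: "\<tau> (m f) \<in> hom C (Cod C e') s"
        using ty(4) ty'(4) domr gd by (auto simp: hom_def)
      have e'h: "e' \<in> hom C (Dom C e') (Dom C (\<tau> (m f)))" using ty'(4) domr by simp
      have "g \<cdot> (\<tau> (m f) \<cdot> e') = m f \<cdot> (\<rho> (m f) \<cdot> e')"
        by (rule Comp_extend[OF ty(6) ty(4) _ ty(5) mh[OF f] e'h]) (use g gd in simp)
      also have "\<dots> = m f \<cdot> (e f \<cdot> r)" using ty'(6) by simp
      also have "\<dots> = f \<cdot> r"
        using Comp_reassoc[OF _ eh mh[OF f] ty'(5)] im[OF f] by simp
      finally have "sub_le C (g \<cdot> (\<tau> (m f) \<cdot> e')) f"
        using ty'(5) Comp_in_hom[OF eh mh[OF f]] im[OF f]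
        by (intro sub_leI[of r "Dom C e'"]) (auto simp: hom_def)
      moreover have "\<tau> (m f) \<cdot> e' \<in> arrows_into C s"
        using th e'h by (auto simp: arrows_into_def hom_def)
      ultimately have "sub_le C (\<tau> (m f) \<cdot> e') n" using all f by blast
      then show ?thesis using image_sub_le_iff[OF e' th n] by simp
    qed
    then show "sub_le C (Id C s) n" using union' n by (auto simp: is_union_def)
  qed auto
qed

text \<open>
  The union of the images of a small family, together with the fact that the family covers it.
\<close>

lemma covered_union_exists:
  assumes x: "x \<in> Obj C" and S: "S \<subseteq> arrows_into C x" and small: "|S| <o \<kappa>"
  obtains u where "u \<in> subobjects C x" "\<And>f. f \<in> S \<Longrightarrow> sub_le C f u"
    "covers C (Dom C u) {c \<in> arrows_into C (Dom C u). u \<cdot> c \<in> S}"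
proof -
  have "\<forall>f \<in> S. \<exists>e m. effective_epi C e \<and> mono_mor C m \<and> Cod C e = Dom C m \<and> m \<cdot> e = f"
    using S image_exists unfolding arrows_into_def by blast
  then obtain e m where im: "\<And>f. f \<in> S \<Longrightarrow> effective_epi C (e f) \<and> mono_mor C (m f) \<and>
      Cod C (e f) = Dom C (m f) \<and> m f \<cdot> e f = f" by metis
  have U: "is_union C x (m ` S) (Id C x) \<longleftrightarrow> covers C x S" "m ` S \<subseteq> subobjects C x"
    by (rule union_images_iff_covers[where e = e, OF x S], erule im)+
  have "has_pullback_stable_union C x (m ` S)"
    by (rule small_union_stable[OF x U(2) small_image[OF small]])
  then obtain u where u: "is_union C x (m ` S) u" by (auto simp: has_pullback_stable_union_def)
  then have us: "u \<in> subobjects C x" by (simp add: is_union_def)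
  note uh = subobjects_hom[OF us]
  have le_iff: "sub_le C f n \<longleftrightarrow> sub_le C (m f) n" if f: "f \<in> S" and n: "n \<in> subobjects C x" for f n
    using image_sub_le_iff[of "e f" "m f" x n] im[OF f] U(2) f n subobjects_hom[of "m f" C x] by auto
  have Su: "sub_le C f u" if "f \<in> S" for f
    using le_iff[OF that us] u that by (auto simp: is_union_def)
  show ?thesis
  proof
    show "u \<in> subobjects C x" "\<And>f. f \<in> S \<Longrightarrow> sub_le C f u" by fact+
    show "covers C (Dom C u) {c \<in> arrows_into C (Dom C u). u \<cdot> c \<in> S}" (is "covers C _ ?T")
      unfolding covers_def
    proof (intro conjI ballI impI)
      show "Dom C u \<in> Obj C" using hom_Obj[OF uh] by simp
      fix n assume n: "n \<in> subobjects C (Dom C u)" and all: "\<forall>c \<in> ?T. sub_le C c n"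
      note nh = subobjects_hom[OF n]
      have un: "u \<cdot> n \<in> hom C (Dom C n) x" by (rule Comp_in_hom[OF nh uh])
      have domun: "Dom C (u \<cdot> n) = Dom C n" using un by (simp add: hom_def)
      have uns: "u \<cdot> n \<in> subobjects C x"
      proof -
        have "k = l" if "k \<in> hom C t (Dom C n)" "l \<in> hom C t (Dom C n)"
          "(u \<cdot> n) \<cdot> k = (u \<cdot> n) \<cdot> l" for k l t
        proof (rule mono_cancel[OF _ that(1,2)])
          show "mono_mor C n" using n by (simp add: subobjects_def)
          show "n \<cdot> k = n \<cdot> l"
          proof (rule mono_cancel)
            show "mono_mor C u" using us by (simp add: subobjects_def)
            show "u \<cdot> (n \<cdot> k) = u \<cdot> (n \<cdot> l)"
              using Comp_assoc[OF that(1) nh uh] Comp_assoc[OF that(2) nh uh] that(3) by simp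
          qed (rule Comp_in_hom[OF _ nh], fact)+
        qed
        moreover have "u \<cdot> n \<in> Mor C" "Cod C (u \<cdot> n) = x" using un by (simp_all add: hom_def)
        ultimately show ?thesis using domun by (simp add: subobjects_def mono_mor_def)
      qed
      \<comment> \<open>If the family factors through a subobject \<open>n\<close> of the union \<open>u\<close>, then \<open>u \<cdot> n\<close> is an upper bound, so \<open>n\<close> is all of \<open>u\<close>.\<close>
      have "sub_le C f (u \<cdot> n)" if f: "f \<in> S" for f
      proof -
        have fh: "f \<in> hom C (Dom C f) x" using f S by (auto simp: arrows_into_def hom_def)
        obtain k where k: "k \<in> hom C (Dom C f) (Dom C u)" "u \<cdot> k = f"
          by (rule sub_leE[OF Su[OF f] fh])
        have "sub_le C k n" using all k f by (auto simp: arrows_into_def hom_def)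
        then obtain l where l: "l \<in> hom C (Dom C f) (Dom C n)" "n \<cdot> l = k"
          by (rule sub_leE[OF _ k(1)])
        have "(u \<cdot> n) \<cdot> l = f" using Comp_assoc[OF l(1) nh uh] l k by simp
        then show ?thesis using l un domun by (auto intro!: sub_leI simp: hom_def)
      qed
      then have "sub_le C u (u \<cdot> n)" using u uns le_iff[OF _ uns] by (auto simp: is_union_def)
      then obtain l where l: "l \<in> hom C (Dom C u) (Dom C n)" "(u \<cdot> n) \<cdot> l = u"
        using sub_leE[OF _ uh] domun by metis
      have "n \<cdot> l = Id C (Dom C u)"
      proof (rule mono_cancel)
        show "mono_mor C u" using us by (simp add: subobjects_def)
        show "n \<cdot> l \<in> hom C (Dom C u) (Dom C u)" by (rule Comp_in_hom[OF l(1) nh])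
        show "Id C (Dom C u) \<in> hom C (Dom C u) (Dom C u)" using hom_Obj[OF uh] by (simp add: Id_in_hom)
        show "u \<cdot> (n \<cdot> l) = u \<cdot> Id C (Dom C u)"
          using Comp_assoc[OF l(1) nh uh] l(2) Comp_Id_right[OF uh] by simp
      qed
      then show "sub_le C (Id C (Dom C u)) n"
        using l nh by (auto intro!: sub_leI simp: hom_def)
    qed auto
  qed
qed

end

section \<open>Locally exact cocones are colimits\<close>

text \<open>
  The first condition after \<^const>\<open>is_cocone\<close> says that each generalized element of the vertex locally
  comes from some \<open>G i\<close>; the second says that elements of \<open>G i\<close> and \<open>G j\<close> identified in the vertex are
  locally identified by morphisms of the diagram.  Quantifying over all \<open>t\<close> builds stability under
  base change into the definition.
\<close>

definition locally_exact_cocone ::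
  "('o, 'm) cat \<Rightarrow> ('i, 'j) cat \<Rightarrow> ('i, 'j, 'o, 'm) ftor \<Rightarrow> 'o \<Rightarrow> ('i \<Rightarrow> 'm) \<Rightarrow> bool" where
  "locally_exact_cocone C J G x \<iota> \<longleftrightarrow> is_cocone C J G x \<iota> \<and>
     (\<forall>t. \<forall>a \<in> hom C t x. covers C t {c \<in> arrows_into C t. \<exists>i \<in> Obj J. sub_le C (a \<cdot>\<^bsub>C\<^esub> c) (\<iota> i)}) \<and>
     (\<forall>i \<in> Obj J. \<forall>j \<in> Obj J. \<forall>t. \<forall>a \<in> hom C t (OMap G i). \<forall>b \<in> hom C t (OMap G j).
        \<iota> i \<cdot>\<^bsub>C\<^esub> a = \<iota> j \<cdot>\<^bsub>C\<^esub> b \<longrightarrow>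
        covers C t {c \<in> arrows_into C t. \<exists>k. \<exists>u \<in> hom J i k. \<exists>v \<in> hom J j k.
          MMap G u \<cdot>\<^bsub>C\<^esub> (a \<cdot>\<^bsub>C\<^esub> c) = MMap G v \<cdot>\<^bsub>C\<^esub> (b \<cdot>\<^bsub>C\<^esub> c)})"

lemma locally_exact_coconeD:
  assumes "locally_exact_cocone C J G x \<iota>"
  shows "is_cocone C J G x \<iota>"
    "a \<in> hom C t x \<Longrightarrow> covers C t {c \<in> arrows_into C t. \<exists>i \<in> Obj J. sub_le C (a \<cdot>\<^bsub>C\<^esub> c) (\<iota> i)}"
    "i \<in> Obj J \<Longrightarrow> j \<in> Obj J \<Longrightarrow> a \<in> hom C t (OMap G i) \<Longrightarrow> b \<in> hom C t (OMap G j) \<Longrightarrow>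
       \<iota> i \<cdot>\<^bsub>C\<^esub> a = \<iota> j \<cdot>\<^bsub>C\<^esub> b \<Longrightarrow>
       covers C t {c \<in> arrows_into C t. \<exists>k. \<exists>u \<in> hom J i k. \<exists>v \<in> hom J j k.
         MMap G u \<cdot>\<^bsub>C\<^esub> (a \<cdot>\<^bsub>C\<^esub> c) = MMap G v \<cdot>\<^bsub>C\<^esub> (b \<cdot>\<^bsub>C\<^esub> c)}"
  using assms unfolding locally_exact_cocone_def by blast+

lemma cocone_typing:
  assumes "is_cocone C J G x \<iota>"
  shows "x \<in> Obj C" "i \<in> Obj J \<Longrightarrow> \<iota> i \<in> hom C (OMap G i) x"
    "u \<in> hom J i k \<Longrightarrow> \<iota> k \<cdot>\<^bsub>C\<^esub> MMap G u = \<iota> i"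
  using assms by (auto simp: is_cocone_def hom_def)

lemma is_cocone_intro:
  assumes "category J" "x \<in> Obj C" "\<And>i. i \<in> Obj J \<Longrightarrow> \<iota> i \<in> hom C (OMap G i) x"
    "\<And>u i k. u \<in> hom J i k \<Longrightarrow> \<iota> k \<cdot>\<^bsub>C\<^esub> MMap G u = \<iota> i"
  shows "is_cocone C J G x \<iota>"
  using assms unfolding is_cocone_def hom_def by blast

lemma card_Obj_le_Mor:
  assumes "category J"
  shows "|Obj J| \<le>o |Mor J|"
proof -
  interpret J: category J by fact
  have "inj_on (Id J) (Obj J)" by (rule inj_on_inverseI[of _ "Dom J"]) simp
  then show ?thesis using card_of_ordLeq[of "Obj J" "Mor J"] by auto
qed

context geometric_cat
begin

text \<open>
  The relation generated by a small family of spans: the union \<open>R\<close> of their images in \<open>x \<times> y\<close>.  The last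
  three facts are the way in which it is used: each span lies in \<open>R\<close>, each element of \<open>R\<close> locally comes
  from one of the spans, and membership in \<open>R\<close> is a local property.
\<close>

lemma generated_relation:
  assumes x: "x \<in> Obj C" and y: "y \<in> Obj C" and small: "|K| <o \<kappa>"
    and a: "\<And>k. k \<in> K \<Longrightarrow> a k \<in> hom C (P k) x" and b: "\<And>k. k \<in> K \<Longrightarrow> b k \<in> hom C (P k) y"
  obtains R r s where "r \<in> hom C R x" "s \<in> hom C R y" "jointly_monic C r s"
    "\<And>k. k \<in> K \<Longrightarrow> \<exists>g \<in> hom C (P k) R. r \<cdot> g = a k \<and> s \<cdot> g = b k"
    "\<And>t h. h \<in> hom C t R \<Longrightarrow> covers C t {c \<in> arrows_into C t.
       \<exists>k \<in> K. \<exists>d \<in> hom C (Dom C c) (P k). r \<cdot> (h \<cdot> c) = a k \<cdot> d \<and> s \<cdot> (h \<cdot> c) = b k \<cdot> d}"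
    "\<And>t \<alpha> \<beta> S. \<alpha> \<in> hom C t x \<Longrightarrow> \<beta> \<in> hom C t y \<Longrightarrow> covers C t S \<Longrightarrow>
       \<forall>c \<in> S. \<exists>h \<in> hom C (Dom C c) R. r \<cdot> h = \<alpha> \<cdot> c \<and> s \<cdot> h = \<beta> \<cdot> c \<Longrightarrow>
       \<exists>h \<in> hom C t R. r \<cdot> h = \<alpha> \<and> s \<cdot> h = \<beta>"
proof -
  obtain z p q where pq: "p \<in> hom C z x" "q \<in> hom C z y" "jointly_monic C p q"
    "\<And>t a b. a \<in> hom C t x \<Longrightarrow> b \<in> hom C t y \<Longrightarrow> \<exists>h \<in> hom C t z. p \<cdot> h = a \<and> q \<cdot> h = b"
    using product_exists[OF x y] by metis
  have pz: "Dom C p = z" using pq by (simp add: hom_def)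
  have "\<forall>k \<in> K. \<exists>w. w \<in> hom C (P k) z \<and> p \<cdot> w = a k \<and> q \<cdot> w = b k"
    using pq(4) a b by (meson bexE)
  then obtain w where w: "\<And>k. k \<in> K \<Longrightarrow> w k \<in> hom C (P k) z" "\<And>k. k \<in> K \<Longrightarrow> p \<cdot> w k = a k"
    "\<And>k. k \<in> K \<Longrightarrow> q \<cdot> w k = b k" by metis
  have wz: "w ` K \<subseteq> arrows_into C z" using w(1) by (auto simp: arrows_into_def hom_def)
  obtain u where u: "u \<in> subobjects C z" "\<And>f. f \<in> w ` K \<Longrightarrow> sub_le C f u"
    "covers C (Dom C u) {c \<in> arrows_into C (Dom C u). u \<cdot> c \<in> w ` K}"
    using covered_union_exists[OF hom_Obj(1)[OF pq(1)] wz small_image[OF small]] by metis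
  note uh = subobjects_hom[OF u(1)]
  have um: "mono_mor C u" using u(1) by (simp add: subobjects_def)
  define R r s where "R = Dom C u" and "r = p \<cdot> u" and "s = q \<cdot> u"
  have uR: "u \<in> hom C R z" using uh by (simp add: R_def)
  have rs: "r \<in> hom C R x" "s \<in> hom C R y" unfolding r_def s_def
    using Comp_in_hom[OF uR pq(1)] Comp_in_hom[OF uR pq(2)] by auto
  have rR: "Dom C r = R" using rs by (simp add: hom_def)
  have rs_comp: "r \<cdot> h = p \<cdot> (u \<cdot> h)" "s \<cdot> h = q \<cdot> (u \<cdot> h)" if "h \<in> hom C t R" for h t
    unfolding r_def s_def using Comp_assoc[OF that uR pq(1)] Comp_assoc[OF that uR pq(2)] by auto
  have jm: "f = g" if fg: "f \<in> hom C t R" "g \<in> hom C t R" "r \<cdot> f = r \<cdot> g" "s \<cdot> f = s \<cdot> g" for f g t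
  proof (rule mono_cancel[OF um])
    show "f \<in> hom C t (Dom C u)" "g \<in> hom C t (Dom C u)" using fg by (simp_all add: R_def)
    show "u \<cdot> f = u \<cdot> g"
      by (rule jointly_monicD[OF pq(3), of _ t])
        (use Comp_in_hom[OF fg(1) uR] Comp_in_hom[OF fg(2) uR] rs_comp[OF fg(1)] rs_comp[OF fg(2)]
          fg(3,4) pz in auto)
  qed
  have "\<forall>k \<in> K. \<exists>g. g \<in> hom C (P k) R \<and> u \<cdot> g = w k"
  proof
    fix k assume k: "k \<in> K"
    show "\<exists>g. g \<in> hom C (P k) R \<and> u \<cdot> g = w k"
      using sub_leE[OF u(2)[OF imageI[OF k]] w(1)[OF k]] unfolding R_def by metis
  qed
  then obtain g where g: "\<And>k. k \<in> K \<Longrightarrow> g k \<in> hom C (P k) R" "\<And>k. k \<in> K \<Longrightarrow> u \<cdot> g k = w k"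
    by metis
  have rg: "r \<cdot> g k = a k" "s \<cdot> g k = b k" if "k \<in> K" for k
    using rs_comp[OF g(1)[OF that]] g(2)[OF that] w(2,3)[OF that] by auto
  \<comment> \<open>As \<open>u\<close> is monic, a morphism into \<open>R\<close> that lies over the \<open>k\<close>-th span is \<open>g k\<close>; so this family is small.\<close>
  have covR: "covers C R (g ` K)"
  proof (rule covers_mono)
    show "covers C R {c \<in> arrows_into C R. u \<cdot> c \<in> w ` K}" using u(3) by (simp add: R_def)
    show "g ` K \<subseteq> arrows_into C R" using g(1) by (auto simp: arrows_into_def hom_def)
    show "{c \<in> arrows_into C R. u \<cdot> c \<in> w ` K} \<subseteq> g ` K"
    proof
      fix c assume "c \<in> {c \<in> arrows_into C R. u \<cdot> c \<in> w ` K}"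
      then obtain k where c: "c \<in> hom C (Dom C c) R" and k: "k \<in> K" "u \<cdot> c = w k"
        by (auto simp: arrows_into_def hom_def)
      have "Dom C c = P k"
        using Comp_in_hom[OF c uR] w(1)[OF k(1)] k(2) by (simp add: hom_def)
      then have "c = g k"
        using mono_cancel[OF um, of c "P k" "g k"] c g(1,2)[OF k(1)] k(2) by (simp add: R_def)
      then show "c \<in> g ` K" using k by blast
    qed
  qed
  show ?thesis
  proof
    show "r \<in> hom C R x" "s \<in> hom C R y" by fact+
    show "jointly_monic C r s" unfolding jointly_monic_def rR using jm by blast
    show "\<exists>g \<in> hom C (P k) R. r \<cdot> g = a k \<and> s \<cdot> g = b k" if "k \<in> K" for k
      using g(1) rg that by blast
  next
    fix t h assume h: "h \<in> hom C t R"
    show "covers C t {c \<in> arrows_into C t.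
       \<exists>k \<in> K. \<exists>d \<in> hom C (Dom C c) (P k). r \<cdot> (h \<cdot> c) = a k \<cdot> d \<and> s \<cdot> (h \<cdot> c) = b k \<cdot> d}"
    proof (rule covers_mono[OF covers_stable[OF covR small_image[OF small] h]])
      show "{c \<in> arrows_into C t. \<exists>f \<in> g ` K. sub_le C (h \<cdot> c) f} \<subseteq> {c \<in> arrows_into C t.
        \<exists>k \<in> K. \<exists>d \<in> hom C (Dom C c) (P k). r \<cdot> (h \<cdot> c) = a k \<cdot> d \<and> s \<cdot> (h \<cdot> c) = b k \<cdot> d}"
      proof
        fix c assume "c \<in> {c \<in> arrows_into C t. \<exists>f \<in> g ` K. sub_le C (h \<cdot> c) f}"
        then obtain k where c: "c \<in> arrows_into C t" and k: "k \<in> K" and le: "sub_le C (h \<cdot> c) (g k)"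
          by blast
        have ch: "c \<in> hom C (Dom C c) t" using c by (simp add: arrows_into_def hom_def)
        have "Dom C (g k) = P k" using g(1)[OF k] by (simp add: hom_def)
        then obtain d where d: "d \<in> hom C (Dom C c) (P k)" "g k \<cdot> d = h \<cdot> c"
          using sub_leE[OF le Comp_in_hom[OF ch h]] by metis
        have "r \<cdot> (h \<cdot> c) = a k \<cdot> d" "s \<cdot> (h \<cdot> c) = b k \<cdot> d"
          using Comp_reassoc[OF rg(1)[OF k] g(1)[OF k] rs(1) d(1)]
            Comp_reassoc[OF rg(2)[OF k] g(1)[OF k] rs(2) d(1)] d(2) by auto
        then show "c \<in> {c \<in> arrows_into C t. \<exists>k \<in> K. \<exists>d \<in> hom C (Dom C c) (P k).
            r \<cdot> (h \<cdot> c) = a k \<cdot> d \<and> s \<cdot> (h \<cdot> c) = b k \<cdot> d}"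
          using c k d(1) by blast
      qed
    qed auto
  next
    fix t \<alpha> \<beta> S
    assume \<alpha>: "\<alpha> \<in> hom C t x" and \<beta>: "\<beta> \<in> hom C t y" and cov: "covers C t S"
      and loc: "\<forall>c \<in> S. \<exists>h \<in> hom C (Dom C c) R. r \<cdot> h = \<alpha> \<cdot> c \<and> s \<cdot> h = \<beta> \<cdot> c"
    obtain h where h: "h \<in> hom C t z" "p \<cdot> h = \<alpha>" "q \<cdot> h = \<beta>" using pq(4)[OF \<alpha> \<beta>] by auto
    have "sub_le C h u"
    proof (rule sub_le_local[OF cov h(1) u(1)])
      fix c r' assume c: "c \<in> S" "c \<in> hom C r' t"
      then have dc: "Dom C c = r'" by (simp add: hom_def)
      obtain l where l: "l \<in> hom C r' R" "r \<cdot> l = \<alpha> \<cdot> c" "s \<cdot> l = \<beta> \<cdot> c"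
        using bspec[OF loc c(1)] unfolding dc by auto
      have "u \<cdot> l = h \<cdot> c"
        by (rule jointly_monicD[OF pq(3), of _ r'])
          (use Comp_in_hom[OF l(1) uR] Comp_in_hom[OF c(2) h(1)] rs_comp[OF l(1)] l(2,3) pz
            Comp_reassoc[OF h(2,1) pq(1) c(2)] Comp_reassoc[OF h(3,1) pq(2) c(2)] in auto)
      then show "sub_le C (h \<cdot> c) u" using l uR by (auto intro!: sub_leI[of l r'] simp: hom_def)
    qed
    then obtain l where l: "l \<in> hom C t R" "u \<cdot> l = h" using sub_leE[OF _ h(1)] R_def by metis
    then show "\<exists>h \<in> hom C t R. r \<cdot> h = \<alpha> \<and> s \<cdot> h = \<beta>" using rs_comp[OF l(1)] h by auto
  qed
qed

context
  fixes J :: "('i, 'j) cat" and G :: "('i, 'j, 'o, 'm) ftor"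
  assumes G: "cat_functor J C G" and small_J: "|Mor J| <o \<kappa>"
begin

interpretation G: cat_functor J C G by (rule G)

lemma small_Obj: "|Obj J| <o \<kappa>"
  by (rule ordLeq_ordLess_trans[OF card_Obj_le_Mor small_J]) (rule G.A.category_axioms)

text \<open>
  Elements that the locally exact cocone identifies are locally identified in the diagram, so any other
  cocone identifies them locally, and hence globally.
\<close>

lemma cocone_agree:
  assumes lex: "locally_exact_cocone C J G x \<iota>" and \<sigma>: "is_cocone C J G y \<sigma>"
    and ij: "i \<in> Obj J" "j \<in> Obj J"
    and a: "a \<in> hom C t (OMap G i)" and b: "b \<in> hom C t (OMap G j)" and eq: "\<iota> i \<cdot> a = \<iota> j \<cdot> b"
  shows "\<sigma> i \<cdot> a = \<sigma> j \<cdot> b"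
proof (rule eq_local[OF locally_exact_coconeD(3)[OF lex ij a b eq]])
  note \<sigma>h = cocone_typing(2)[OF \<sigma>]
  show "\<sigma> i \<cdot> a \<in> hom C t y" "\<sigma> j \<cdot> b \<in> hom C t y"
    by (rule Comp_in_hom[OF a \<sigma>h[OF ij(1)]], rule Comp_in_hom[OF b \<sigma>h[OF ij(2)]])
  fix c r assume cr: "c \<in> hom C r t"
    and "c \<in> {c \<in> arrows_into C t. \<exists>k. \<exists>u \<in> hom J i k. \<exists>v \<in> hom J j k.
         MMap G u \<cdot> (a \<cdot> c) = MMap G v \<cdot> (b \<cdot> c)}"
  then obtain k u v where uv: "u \<in> hom J i k" "v \<in> hom J j k"
    "MMap G u \<cdot> (a \<cdot> c) = MMap G v \<cdot> (b \<cdot> c)" by blast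
  have k: "k \<in> Obj J" by (rule G.A.hom_Obj[OF uv(1)])
  note Gu = G.MMap_in_hom[OF uv(1)] and Gv = G.MMap_in_hom[OF uv(2)]
  have ac: "a \<cdot> c \<in> hom C r (OMap G i)" and bc: "b \<cdot> c \<in> hom C r (OMap G j)"
    using a b cr by (auto intro: Comp_in_hom)
  have "(\<sigma> i \<cdot> a) \<cdot> c = \<sigma> i \<cdot> (a \<cdot> c)" by (rule Comp_assoc[OF cr a \<sigma>h[OF ij(1)]])
  also have "\<dots> = \<sigma> k \<cdot> (MMap G u \<cdot> (a \<cdot> c))"
    using Comp_reassoc[OF cocone_typing(3)[OF \<sigma> uv(1)] Gu \<sigma>h[OF k] ac] by simp
  also have "\<dots> = \<sigma> k \<cdot> (MMap G v \<cdot> (b \<cdot> c))" using uv(3) by simp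
  also have "\<dots> = \<sigma> j \<cdot> (b \<cdot> c)"
    by (rule Comp_reassoc[OF cocone_typing(3)[OF \<sigma> uv(2)] Gv \<sigma>h[OF k] bc])
  also have "\<dots> = (\<sigma> j \<cdot> b) \<cdot> c" by (rule Comp_assoc[OF cr b \<sigma>h[OF ij(2)], symmetric])
  finally show "(\<sigma> i \<cdot> a) \<cdot> c = (\<sigma> j \<cdot> b) \<cdot> c" .
qed

lemma jointly_epic:
  assumes lex: "locally_exact_cocone C J G x \<iota>" and f: "f \<in> hom C x y" and g: "g \<in> hom C x y"
    and eq: "\<And>i. i \<in> Obj J \<Longrightarrow> f \<cdot> \<iota> i = g \<cdot> \<iota> i"
  shows "f = g"
proof -
  note \<iota> = cocone_typing[OF locally_exact_coconeD(1)[OF lex]]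
  show ?thesis
  proof (rule eq_local[OF locally_exact_coconeD(2)[OF lex Id_in_hom[OF \<iota>(1)]] f g])
    fix c r assume cr: "c \<in> hom C r x"
      and "c \<in> {c \<in> arrows_into C x. \<exists>i \<in> Obj J. sub_le C (Id C x \<cdot> c) (\<iota> i)}"
    then obtain i where i: "i \<in> Obj J" "sub_le C c (\<iota> i)" using Comp_Id_left[OF cr] by auto
    obtain d where d: "d \<in> hom C r (Dom C (\<iota> i))" "\<iota> i \<cdot> d = c" by (rule sub_leE[OF i(2) cr])
    have \<iota>i: "\<iota> i \<in> hom C (Dom C (\<iota> i)) x" using \<iota>(2)[OF i(1)] by (simp add: hom_def)
    show "f \<cdot> c = g \<cdot> c" using Comp_extend[OF eq[OF i(1)] \<iota>i f \<iota>i g d(1)] d(2) by simp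
  qed
qed

text \<open>
  The relation \<open>R\<close> from \<open>x\<close> to \<open>y\<close> generated by the spans \<open>(\<iota> i, \<sigma> i)\<close> is a graph: it is single-valued
  because \<open>\<sigma>\<close> respects all identifications made by \<open>\<iota>\<close>, and total because the \<open>\<iota> i\<close> cover \<open>x\<close>.
\<close>

lemma locally_exact_cocone_colimit:
  assumes lex: "locally_exact_cocone C J G x \<iota>"
  shows "is_colimit C J G x \<iota>"
proof -
  note cocone = locally_exact_coconeD(1)[OF lex]
  note \<iota> = cocone_typing[OF cocone]
  have "\<exists>!h. h \<in> hom C x y \<and> (\<forall>i \<in> Obj J. h \<cdot> \<iota> i = \<sigma> i)" if \<sigma>: "is_cocone C J G y \<sigma>" for y \<sigma>
  proof -
    note \<sigma>' = cocone_typing[OF \<sigma>]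
    obtain R r s where rs: "r \<in> hom C R x" "s \<in> hom C R y" "jointly_monic C r s"
      and gen: "\<And>i. i \<in> Obj J \<Longrightarrow> \<exists>g \<in> hom C (OMap G i) R. r \<cdot> g = \<iota> i \<and> s \<cdot> g = \<sigma> i"
      and cov: "\<And>t h. h \<in> hom C t R \<Longrightarrow> covers C t {c \<in> arrows_into C t. \<exists>i \<in> Obj J.
        \<exists>d \<in> hom C (Dom C c) (OMap G i). r \<cdot> (h \<cdot> c) = \<iota> i \<cdot> d \<and> s \<cdot> (h \<cdot> c) = \<sigma> i \<cdot> d}"
    proof (rule generated_relation[where a = \<iota> and b = \<sigma> and P = "OMap G",
          OF \<iota>(1) \<sigma>'(1) small_Obj \<iota>(2) \<sigma>'(2)], assumption, assumption)
    qed (rule that)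
    have rR: "Dom C r = R" using rs by (simp add: hom_def)
    \<comment> \<open>Locally \<open>f\<close> and \<open>g\<close> are given by elements of \<open>G i\<close> and \<open>G j\<close> with the same image in \<open>x\<close>, hence in \<open>y\<close>.\<close>
    have r_inj: "f = g" if f: "f \<in> hom C t R" and g: "g \<in> hom C t R" and eq: "r \<cdot> f = r \<cdot> g" for f g t
    proof (rule jointly_monicD[OF rs(3), of _ t])
      show "s \<cdot> f = s \<cdot> g"
      proof (rule eq_local[OF cov[OF f] Comp_in_hom[OF f rs(2)] Comp_in_hom[OF g rs(2)]])
        fix c w assume cw: "c \<in> hom C w t" and "c \<in> {c \<in> arrows_into C t. \<exists>i \<in> Obj J.
          \<exists>d \<in> hom C (Dom C c) (OMap G i). r \<cdot> (f \<cdot> c) = \<iota> i \<cdot> d \<and> s \<cdot> (f \<cdot> c) = \<sigma> i \<cdot> d}"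
        then obtain i d where i: "i \<in> Obj J" and d: "d \<in> hom C w (OMap G i)"
          "r \<cdot> (f \<cdot> c) = \<iota> i \<cdot> d" "s \<cdot> (f \<cdot> c) = \<sigma> i \<cdot> d" by (auto simp: hom_def)
        have fc: "f \<cdot> c \<in> hom C w R" and gc: "g \<cdot> c \<in> hom C w R"
          using Comp_in_hom[OF cw f] Comp_in_hom[OF cw g] by auto
        have req: "r \<cdot> (f \<cdot> c) = r \<cdot> (g \<cdot> c)" by (rule Comp_extend[OF eq f rs(1) g rs(1) cw])
        have "s \<cdot> (f \<cdot> c) = s \<cdot> (g \<cdot> c)"
        proof (rule eq_local[OF cov[OF gc] Comp_in_hom[OF fc rs(2)] Comp_in_hom[OF gc rs(2)]])
          fix c' w' assume cw': "c' \<in> hom C w' w" and "c' \<in> {c' \<in> arrows_into C w. \<exists>i \<in> Obj J.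
            \<exists>d \<in> hom C (Dom C c') (OMap G i).
              r \<cdot> (g \<cdot> c \<cdot> c') = \<iota> i \<cdot> d \<and> s \<cdot> (g \<cdot> c \<cdot> c') = \<sigma> i \<cdot> d}"
          then obtain j d' where j: "j \<in> Obj J" and d': "d' \<in> hom C w' (OMap G j)"
            "r \<cdot> (g \<cdot> c \<cdot> c') = \<iota> j \<cdot> d'" "s \<cdot> (g \<cdot> c \<cdot> c') = \<sigma> j \<cdot> d'"
            by (auto simp: hom_def)
          have dc: "d \<cdot> c' \<in> hom C w' (OMap G i)" by (rule Comp_in_hom[OF cw' d(1)])
          have "\<iota> i \<cdot> (d \<cdot> c') = \<iota> j \<cdot> d'"
            using Comp_extend[OF d(2) fc rs(1) d(1) \<iota>(2)[OF i] cw']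
              Comp_extend[OF req fc rs(1) gc rs(1) cw'] d'(2) by simp
          then have "\<sigma> i \<cdot> (d \<cdot> c') = \<sigma> j \<cdot> d'" by (rule cocone_agree[OF lex \<sigma> i j dc d'(1)])
          then have "s \<cdot> (f \<cdot> c \<cdot> c') = s \<cdot> (g \<cdot> c \<cdot> c')"
            using Comp_extend[OF d(3) fc rs(2) d(1) \<sigma>'(2)[OF i] cw'] d'(3) by simp
          then show "s \<cdot> (f \<cdot> c) \<cdot> c' = s \<cdot> (g \<cdot> c) \<cdot> c'"
            using Comp_assoc[OF cw' fc rs(2)] Comp_assoc[OF cw' gc rs(2)] by simp
        qed
        then show "s \<cdot> f \<cdot> c = s \<cdot> g \<cdot> c"
          using Comp_assoc[OF cw f rs(2)] Comp_assoc[OF cw g rs(2)] by simp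
      qed
    qed (use f g eq rR in auto)
    have r_sub: "r \<in> subobjects C x"
    proof -
      have "r \<in> Mor C" "Cod C r = x" using rs(1) by (simp_all add: hom_def)
      then show ?thesis using r_inj by (simp add: subobjects_def mono_mor_def rR)
    qed
    \<comment> \<open>The subobject \<open>r\<close> of \<open>x\<close> contains all \<open>\<iota> i\<close>, and these cover.\<close>
    have "sub_le C (Id C x) r"
    proof (rule sub_le_local[OF locally_exact_coconeD(2)[OF lex Id_in_hom] Id_in_hom r_sub])
      show "x \<in> Obj C" "x \<in> Obj C" by (rule \<iota>(1))+
      fix c w assume cw: "c \<in> hom C w x"
        and "c \<in> {c \<in> arrows_into C x. \<exists>i \<in> Obj J. sub_le C (Id C x \<cdot> c) (\<iota> i)}"
      then obtain i where i: "i \<in> Obj J" "sub_le C (Id C x \<cdot> c) (\<iota> i)" by auto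
      note \<iota>i = \<iota>(2)[OF i(1)]
      obtain g where g: "g \<in> hom C (OMap G i) R" "r \<cdot> g = \<iota> i" using gen[OF i(1)] by auto
      then have "sub_le C (\<iota> i) r"
        using rs(1) by (auto intro!: sub_leI[of g "OMap G i"] simp: hom_def)
      moreover have "Id C x \<cdot> c \<in> Mor C" using Comp_Id_left[OF cw] cw by (simp add: hom_def)
      ultimately show "sub_le C (Id C x \<cdot> c) r"
        using sub_le_trans[OF i(2)] \<iota>i rs(1) by (auto simp: hom_def)
    qed
    then obtain l where l: "l \<in> hom C x R" "r \<cdot> l = Id C x"
      using sub_leE[OF _ Id_in_hom[OF \<iota>(1)]] rR by metis
    have sl: "s \<cdot> l \<in> hom C x y" by (rule Comp_in_hom[OF l(1) rs(2)])
    have sl\<iota>: "s \<cdot> l \<cdot> \<iota> i = \<sigma> i" if i: "i \<in> Obj J" for i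
    proof -
      note \<iota>i = \<iota>(2)[OF i]
      obtain g where g: "g \<in> hom C (OMap G i) R" "r \<cdot> g = \<iota> i" "s \<cdot> g = \<sigma> i" using gen[OF i] by auto
      have "r \<cdot> (l \<cdot> \<iota> i) = \<iota> i"
        using Comp_reassoc[OF l(2,1) rs(1) \<iota>i] Comp_Id_left[OF \<iota>i] by simp
      then have "l \<cdot> \<iota> i = g" by (intro r_inj[OF Comp_in_hom[OF \<iota>i l(1)] g(1)]) (simp add: g)
      then show ?thesis using Comp_assoc[OF \<iota>i l(1) rs(2)] g by simp
    qed
    show ?thesis
    proof (rule ex1I[of _ "s \<cdot> l"])
      show "s \<cdot> l \<in> hom C x y \<and> (\<forall>i \<in> Obj J. s \<cdot> l \<cdot> \<iota> i = \<sigma> i)" using sl sl\<iota> by blast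
    next
      fix h assume h: "h \<in> hom C x y \<and> (\<forall>i \<in> Obj J. h \<cdot> \<iota> i = \<sigma> i)"
      show "h = s \<cdot> l" by (rule jointly_epic[OF lex]) (use h sl sl\<iota> in simp_all)
    qed
  qed
  then show ?thesis using cocone by (simp add: is_colimit_def)
qed

end

end

section \<open>Pullback, change of colimit cocone, and geometric functors\<close>

text \<open>
  An element of the pullback of \<open>\<iota> i\<close> along \<open>f\<close> is a pair consisting of an element of \<open>y\<close> and one of \<open>G i\<close>.
  Both conditions reduce to those for \<open>\<iota>\<close>, read off the second component, because transition
  morphisms do not change the first one.
\<close>

lemma locally_exact_cocone_pullback:
  assumes "category C" "category J" and G: "cat_functor J C G" and G': "cat_functor J C G'"
    and lex: "locally_exact_cocone C J G x \<iota>" and f: "f \<in> hom C y x"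
    and pb: "\<And>i. i \<in> Obj J \<Longrightarrow> Dom C (p i) = OMap G' i \<and> is_pullback C f (\<iota> i) (p i) (q i)"
    and compat: "\<And>u i k. u \<in> hom J i k \<Longrightarrow> p k \<cdot>\<^bsub>C\<^esub> MMap G' u = p i \<and>
      q k \<cdot>\<^bsub>C\<^esub> MMap G' u = MMap G u \<cdot>\<^bsub>C\<^esub> q i"
  shows "locally_exact_cocone C J G' y p"
  unfolding locally_exact_cocone_def
proof (intro conjI ballI allI impI)
  interpret category C by fact
  interpret J: category J by fact
  interpret G': cat_functor J C G' by fact
  interpret G: cat_functor J C G by fact
  note \<iota> = cocone_typing[OF locally_exact_coconeD(1)[OF lex]]
  have domf: "Dom C f = y" using f by (simp add: hom_def)
  have pb': "is_pullback C f (\<iota> i) (p i) (q i)" if "i \<in> Obj J" for i using pb[OF that] by blast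
  have ph: "p i \<in> hom C (OMap G' i) y" and qh: "q i \<in> hom C (OMap G' i) (OMap G i)"
    and sq: "f \<cdot>\<^bsub>C\<^esub> p i = \<iota> i \<cdot>\<^bsub>C\<^esub> q i" if i: "i \<in> Obj J" for i
    using pullback_typing[OF pb'[OF i]] pb[OF i] \<iota>(2)[OF i] domf by (auto simp: hom_def)
  show "is_cocone C J G' y p"
    by (rule is_cocone_intro[OF J.category_axioms hom_Obj(1)[OF f] ph]) (use compat in auto)
  {
    fix t a assume a: "a \<in> hom C t y"
    let ?S = "{c \<in> arrows_into C t. \<exists>i \<in> Obj J. sub_le C (f \<cdot>\<^bsub>C\<^esub> a \<cdot>\<^bsub>C\<^esub> c) (\<iota> i)}"
    have fa: "f \<cdot>\<^bsub>C\<^esub> a \<in> hom C t x" by (rule Comp_in_hom[OF a f])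
    show "covers C t {c \<in> arrows_into C t. \<exists>i \<in> Obj J. sub_le C (a \<cdot>\<^bsub>C\<^esub> c) (p i)}"
    proof (rule covers_mono[OF locally_exact_coconeD(2)[OF lex fa]])
      show "?S \<subseteq> {c \<in> arrows_into C t. \<exists>i \<in> Obj J. sub_le C (a \<cdot>\<^bsub>C\<^esub> c) (p i)}"
      proof
        fix c assume "c \<in> ?S"
        then obtain i where c: "c \<in> arrows_into C t" and i: "i \<in> Obj J"
          and le: "sub_le C (f \<cdot>\<^bsub>C\<^esub> a \<cdot>\<^bsub>C\<^esub> c) (\<iota> i)" by blast
        have ch: "c \<in> hom C (Dom C c) t" using c by (simp add: arrows_into_def hom_def)
        obtain b where b: "b \<in> hom C (Dom C c) (Dom C (\<iota> i))" "\<iota> i \<cdot>\<^bsub>C\<^esub> b = f \<cdot>\<^bsub>C\<^esub> a \<cdot>\<^bsub>C\<^esub> c"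
          by (rule sub_leE[OF le Comp_in_hom[OF ch fa]])
        have ac: "a \<cdot>\<^bsub>C\<^esub> c \<in> hom C (Dom C c) (Dom C f)"
          using Comp_in_hom[OF ch a] domf by simp
        obtain h where h: "h \<in> hom C (Dom C c) (Dom C (p i))" "p i \<cdot>\<^bsub>C\<^esub> h = a \<cdot>\<^bsub>C\<^esub> c"
          by (rule pullback_lift[OF pb'[OF i] ac b(1)]) (use b(2) Comp_assoc[OF ch a f] in simp)
        have "p i \<in> Mor C" using ph[OF i] by (simp add: hom_def)
        then have "sub_le C (a \<cdot>\<^bsub>C\<^esub> c) (p i)" by (rule sub_leI[OF h])
        then show "c \<in> {c \<in> arrows_into C t. \<exists>i \<in> Obj J. sub_le C (a \<cdot>\<^bsub>C\<^esub> c) (p i)}"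
          using c i by blast
      qed
    qed auto
  next
    fix i j t a b assume i: "i \<in> Obj J" and j: "j \<in> Obj J"
      and a: "a \<in> hom C t (OMap G' i)" and b: "b \<in> hom C t (OMap G' j)"
      and eq: "p i \<cdot>\<^bsub>C\<^esub> a = p j \<cdot>\<^bsub>C\<^esub> b"
    have qa: "q i \<cdot>\<^bsub>C\<^esub> a \<in> hom C t (OMap G i)" and qb: "q j \<cdot>\<^bsub>C\<^esub> b \<in> hom C t (OMap G j)"
      using Comp_in_hom[OF a qh[OF i]] Comp_in_hom[OF b qh[OF j]] by auto
    have eq': "\<iota> i \<cdot>\<^bsub>C\<^esub> (q i \<cdot>\<^bsub>C\<^esub> a) = \<iota> j \<cdot>\<^bsub>C\<^esub> (q j \<cdot>\<^bsub>C\<^esub> b)"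
      using Comp_extend[OF sq[OF i] ph[OF i] f qh[OF i] \<iota>(2)[OF i] a]
        Comp_extend[OF sq[OF j] ph[OF j] f qh[OF j] \<iota>(2)[OF j] b] eq by simp
    let ?S = "{c \<in> arrows_into C t. \<exists>k. \<exists>u \<in> hom J i k. \<exists>v \<in> hom J j k.
      MMap G u \<cdot>\<^bsub>C\<^esub> (q i \<cdot>\<^bsub>C\<^esub> a \<cdot>\<^bsub>C\<^esub> c) = MMap G v \<cdot>\<^bsub>C\<^esub> (q j \<cdot>\<^bsub>C\<^esub> b \<cdot>\<^bsub>C\<^esub> c)}"
    show "covers C t {c \<in> arrows_into C t. \<exists>k. \<exists>u \<in> hom J i k. \<exists>v \<in> hom J j k.
      MMap G' u \<cdot>\<^bsub>C\<^esub> (a \<cdot>\<^bsub>C\<^esub> c) = MMap G' v \<cdot>\<^bsub>C\<^esub> (b \<cdot>\<^bsub>C\<^esub> c)}" (is "covers C t ?T")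
    proof (rule covers_mono[OF locally_exact_coconeD(3)[OF lex i j qa qb eq']])
      show "?S \<subseteq> ?T"
      proof
        fix c assume "c \<in> ?S"
        then obtain k u v where c: "c \<in> arrows_into C t" and u: "u \<in> hom J i k" and v: "v \<in> hom J j k"
          and uv: "MMap G u \<cdot>\<^bsub>C\<^esub> (q i \<cdot>\<^bsub>C\<^esub> a \<cdot>\<^bsub>C\<^esub> c) = MMap G v \<cdot>\<^bsub>C\<^esub> (q j \<cdot>\<^bsub>C\<^esub> b \<cdot>\<^bsub>C\<^esub> c)"
          by blast
        have ch: "c \<in> hom C (Dom C c) t" using c by (simp add: arrows_into_def hom_def)
        have k: "k \<in> Obj J" by (rule J.hom_Obj[OF u])
        have ac: "a \<cdot>\<^bsub>C\<^esub> c \<in> hom C (Dom C c) (OMap G' i)"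
          and bc: "b \<cdot>\<^bsub>C\<^esub> c \<in> hom C (Dom C c) (OMap G' j)"
          using Comp_in_hom[OF ch a] Comp_in_hom[OF ch b] by auto
        note Gu = G'.MMap_in_hom[OF u] and Gv = G'.MMap_in_hom[OF v]
        have "MMap G' u \<cdot>\<^bsub>C\<^esub> (a \<cdot>\<^bsub>C\<^esub> c) = MMap G' v \<cdot>\<^bsub>C\<^esub> (b \<cdot>\<^bsub>C\<^esub> c)"
        proof (rule pullback_unique[OF pb'[OF k]])
          show "MMap G' u \<cdot>\<^bsub>C\<^esub> (a \<cdot>\<^bsub>C\<^esub> c) \<in> hom C (Dom C c) (Dom C (p k))"
            "MMap G' v \<cdot>\<^bsub>C\<^esub> (b \<cdot>\<^bsub>C\<^esub> c) \<in> hom C (Dom C c) (Dom C (p k))"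
            using Comp_in_hom[OF ac Gu] Comp_in_hom[OF bc Gv] pb[OF k] by auto
          have "p k \<cdot>\<^bsub>C\<^esub> (MMap G' u \<cdot>\<^bsub>C\<^esub> (a \<cdot>\<^bsub>C\<^esub> c)) = p i \<cdot>\<^bsub>C\<^esub> (a \<cdot>\<^bsub>C\<^esub> c)"
            using compat[OF u] by (intro Comp_reassoc[OF _ Gu ph[OF k] ac]) simp
          also have "\<dots> = p j \<cdot>\<^bsub>C\<^esub> (b \<cdot>\<^bsub>C\<^esub> c)"
            by (rule Comp_extend[OF eq a ph[OF i] b ph[OF j] ch])
          also have "\<dots> = p k \<cdot>\<^bsub>C\<^esub> (MMap G' v \<cdot>\<^bsub>C\<^esub> (b \<cdot>\<^bsub>C\<^esub> c))"
            using compat[OF v] by (intro Comp_reassoc[OF _ Gv ph[OF k] bc, symmetric]) simp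
          finally show "p k \<cdot>\<^bsub>C\<^esub> (MMap G' u \<cdot>\<^bsub>C\<^esub> (a \<cdot>\<^bsub>C\<^esub> c)) =
            p k \<cdot>\<^bsub>C\<^esub> (MMap G' v \<cdot>\<^bsub>C\<^esub> (b \<cdot>\<^bsub>C\<^esub> c))" .
          have "q k \<cdot>\<^bsub>C\<^esub> (MMap G' u \<cdot>\<^bsub>C\<^esub> (a \<cdot>\<^bsub>C\<^esub> c)) = MMap G u \<cdot>\<^bsub>C\<^esub> (q i \<cdot>\<^bsub>C\<^esub> (a \<cdot>\<^bsub>C\<^esub> c))"
            using compat[OF u]
            by (intro Comp_extend[OF _ Gu qh[OF k] qh[OF i] G.MMap_in_hom[OF u] ac]) simp
          also have "\<dots> = MMap G v \<cdot>\<^bsub>C\<^esub> (q j \<cdot>\<^bsub>C\<^esub> (b \<cdot>\<^bsub>C\<^esub> c))"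
            using uv Comp_assoc[OF ch a qh[OF i]] Comp_assoc[OF ch b qh[OF j]] by simp
          also have "\<dots> = q k \<cdot>\<^bsub>C\<^esub> (MMap G' v \<cdot>\<^bsub>C\<^esub> (b \<cdot>\<^bsub>C\<^esub> c))"
            using compat[OF v]
            by (intro Comp_extend[OF _ Gv qh[OF k] qh[OF j] G.MMap_in_hom[OF v] bc, symmetric]) simp
          finally show "q k \<cdot>\<^bsub>C\<^esub> (MMap G' u \<cdot>\<^bsub>C\<^esub> (a \<cdot>\<^bsub>C\<^esub> c)) =
            q k \<cdot>\<^bsub>C\<^esub> (MMap G' v \<cdot>\<^bsub>C\<^esub> (b \<cdot>\<^bsub>C\<^esub> c))" .
        qed
        then show "c \<in> ?T" using c u v by blast
      qed
    qed auto
  }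
qed

context geometric_cat
begin

context
  fixes J :: "('i, 'j) cat" and G :: "('i, 'j, 'o, 'm) ftor"
  assumes G: "cat_functor J C G" and small_J: "|Mor J| <o \<kappa>"
begin

interpretation G: cat_functor J C G by (rule G)

text \<open>
  Any colimit cocone is isomorphic to the given locally exact one, and local exactness is invariant
  under isomorphism.
\<close>

lemma colimit_locally_exact:
  assumes lex: "locally_exact_cocone C J G x \<iota>" and colim: "is_colimit C J G x' \<iota>'"
  shows "locally_exact_cocone C J G x' \<iota>'"
  unfolding locally_exact_cocone_def
proof (intro conjI ballI allI impI)
  have cc: "is_cocone C J G x \<iota>" by (rule locally_exact_coconeD(1)[OF lex])
  show cc': "is_cocone C J G x' \<iota>'" using colim by (simp add: is_colimit_def)
  note \<iota> = cocone_typing[OF cc] and \<iota>' = cocone_typing[OF cc']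
  obtain \<theta> where \<theta>: "\<theta> \<in> hom C x x'" "\<And>i. i \<in> Obj J \<Longrightarrow> \<theta> \<cdot> \<iota> i = \<iota>' i"
    using locally_exact_cocone_colimit[OF G small_J lex] cc' unfolding is_colimit_def by blast
  obtain \<psi> where \<psi>: "\<psi> \<in> hom C x' x" "\<And>i. i \<in> Obj J \<Longrightarrow> \<psi> \<cdot> \<iota>' i = \<iota> i"
    using colim cc unfolding is_colimit_def by blast
  have "\<exists>!h. h \<in> hom C x' x' \<and> (\<forall>i \<in> Obj J. h \<cdot> \<iota>' i = \<iota>' i)"
    using colim cc' unfolding is_colimit_def by blast
  moreover have "\<theta> \<cdot> \<psi> \<in> hom C x' x'" by (rule Comp_in_hom[OF \<psi>(1) \<theta>(1)])
  moreover have "\<theta> \<cdot> \<psi> \<cdot> \<iota>' i = \<iota>' i" if "i \<in> Obj J" for i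
    using Comp_assoc[OF \<iota>'(2)[OF that] \<psi>(1) \<theta>(1)] \<theta>(2)[OF that] \<psi>(2)[OF that] by simp
  moreover have "Id C x' \<in> hom C x' x'" by (rule Id_in_hom[OF \<iota>'(1)])
  moreover have "Id C x' \<cdot> \<iota>' i = \<iota>' i" if "i \<in> Obj J" for i
    by (rule Comp_Id_left[OF \<iota>'(2)[OF that]])
  ultimately have inv: "\<theta> \<cdot> \<psi> = Id C x'" by blast
  {
    fix t a assume a: "a \<in> hom C t x'"
    have \<psi>a: "\<psi> \<cdot> a \<in> hom C t x" by (rule Comp_in_hom[OF a \<psi>(1)])
    let ?S = "{c \<in> arrows_into C t. \<exists>i \<in> Obj J. sub_le C (\<psi> \<cdot> a \<cdot> c) (\<iota> i)}"
    show "covers C t {c \<in> arrows_into C t. \<exists>i \<in> Obj J. sub_le C (a \<cdot> c) (\<iota>' i)}" (is "covers C t ?T")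
    proof (rule covers_mono[OF locally_exact_coconeD(2)[OF lex \<psi>a]])
      show "?S \<subseteq> ?T"
      proof
        fix c assume "c \<in> ?S"
        then obtain i where c: "c \<in> arrows_into C t" and i: "i \<in> Obj J"
          and le: "sub_le C (\<psi> \<cdot> a \<cdot> c) (\<iota> i)" by blast
        have ch: "c \<in> hom C (Dom C c) t" using c by (simp add: arrows_into_def hom_def)
        have ac: "a \<cdot> c \<in> hom C (Dom C c) x'" by (rule Comp_in_hom[OF ch a])
        have "Dom C (\<iota> i) = OMap G i" using \<iota>(2)[OF i] by (simp add: hom_def)
        then obtain b where b: "b \<in> hom C (Dom C c) (OMap G i)" "\<iota> i \<cdot> b = \<psi> \<cdot> a \<cdot> c"
          using sub_leE[OF le Comp_in_hom[OF ch \<psi>a]] by metis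
        have "\<iota>' i \<cdot> b = \<theta> \<cdot> (\<iota> i \<cdot> b)"
          using Comp_reassoc[OF \<theta>(2)[OF i] \<iota>(2)[OF i] \<theta>(1) b(1)] by simp
        also have "\<dots> = \<theta> \<cdot> (\<psi> \<cdot> (a \<cdot> c))" using b(2) Comp_assoc[OF ch a \<psi>(1)] by simp
        also have "\<dots> = a \<cdot> c"
          using Comp_reassoc[OF inv \<psi>(1) \<theta>(1) ac] Comp_Id_left[OF ac] by simp
        finally have "\<iota>' i \<cdot> b = a \<cdot> c" .
        then have "sub_le C (a \<cdot> c) (\<iota>' i)"
          using b(1) \<iota>'(2)[OF i] by (auto intro!: sub_leI simp: hom_def)
        then show "c \<in> ?T" using c i by blast
      qed
    qed auto
  next
    fix i j t a b assume i: "i \<in> Obj J" and j: "j \<in> Obj J"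
      and a: "a \<in> hom C t (OMap G i)" and b: "b \<in> hom C t (OMap G j)" and eq: "\<iota>' i \<cdot> a = \<iota>' j \<cdot> b"
    have "\<iota> i \<cdot> a = \<iota> j \<cdot> b"
      using Comp_reassoc[OF \<psi>(2)[OF i] \<iota>'(2)[OF i] \<psi>(1) a]
        Comp_reassoc[OF \<psi>(2)[OF j] \<iota>'(2)[OF j] \<psi>(1) b] eq by simp
    from locally_exact_coconeD(3)[OF lex i j a b this]
    show "covers C t {c \<in> arrows_into C t. \<exists>k. \<exists>u \<in> hom J i k. \<exists>v \<in> hom J j k.
      MMap G u \<cdot> (a \<cdot> c) = MMap G v \<cdot> (b \<cdot> c)}" .
  }
qed

text \<open>
  Geometric functors preserve only small covering families, so the sieves in the definition have to be
  replaced by small sets of generators.  For the second condition these are the inclusions into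
  the pullback of \<open>\<iota> i\<close> and \<open>\<iota> j\<close> of the fibre products \<open>G i \<times> G j\<close> over the various \<open>G k\<close>, one for each pair
  of morphisms of \<open>J\<close> with common codomain.
\<close>

lemma locally_exact_cocone_small:
  assumes lex: "locally_exact_cocone C J G x \<iota>"
  shows "covers C x (\<iota> ` Obj J)"
    and "i \<in> Obj J \<Longrightarrow> j \<in> Obj J \<Longrightarrow> \<exists>p q S. is_pullback C (\<iota> i) (\<iota> j) p q \<and> |S| <o \<kappa> \<and>
      covers C (Dom C p) S \<and>
      (\<forall>e \<in> S. \<exists>k. \<exists>u \<in> hom J i k. \<exists>v \<in> hom J j k. MMap G u \<cdot> (p \<cdot> e) = MMap G v \<cdot> (q \<cdot> e))"
proof -
  note \<iota> = cocone_typing[OF locally_exact_coconeD(1)[OF lex]]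
  note I = Id_in_hom[OF \<iota>(1)]
  show "covers C x (\<iota> ` Obj J)"
  proof (rule covers_refine[OF category_axioms locally_exact_coconeD(2)[OF lex I]])
    show "\<iota> ` Obj J \<subseteq> arrows_into C x" using \<iota>(2) by (auto simp: arrows_into_def hom_def)
    fix c assume "c \<in> {c \<in> arrows_into C x. \<exists>i \<in> Obj J. sub_le C (Id C x \<cdot> c) (\<iota> i)}"
    then obtain i where i: "i \<in> Obj J" "sub_le C (Id C x \<cdot> c) (\<iota> i)" and c: "c \<in> arrows_into C x"
      by blast
    have "Id C x \<cdot> c = c" using c by (auto simp: arrows_into_def)
    then show "\<exists>f \<in> \<iota> ` Obj J. sub_le C c f" using i by auto
  qed
  assume i: "i \<in> Obj J" and j: "j \<in> Obj J"
  note \<iota>i = \<iota>(2)[OF i] and \<iota>j = \<iota>(2)[OF j]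
  have dom: "Dom C (\<iota> i) = OMap G i" "Dom C (\<iota> j) = OMap G j" using \<iota>i \<iota>j by (simp_all add: hom_def)
  obtain p q where pb: "is_pullback C (\<iota> i) (\<iota> j) p q" by (rule pullback_exists[OF \<iota>i \<iota>j])
  note ty = pullback_typing[OF pb, unfolded dom]
  let ?K = "{(u, v). \<exists>k. u \<in> hom J i k \<and> v \<in> hom J j k}"
  have "\<exists>e. e \<in> arrows_into C (Dom C p) \<and> MMap G u \<cdot> (p \<cdot> e) = MMap G v \<cdot> (q \<cdot> e) \<and>
      (\<forall>c \<in> arrows_into C (Dom C p). MMap G u \<cdot> (p \<cdot> c) = MMap G v \<cdot> (q \<cdot> c) \<longrightarrow> sub_le C c e)"
    if u: "u \<in> hom J i k" and v: "v \<in> hom J j k" for u v k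
  proof -
    note Gu = G.MMap_in_hom[OF u] and Gv = G.MMap_in_hom[OF v]
    note \<iota>k = \<iota>(2)[OF G.A.hom_Obj(2)[OF u]]
    have domG: "Dom C (MMap G u) = OMap G i" "Dom C (MMap G v) = OMap G j"
      using Gu Gv by (simp_all add: hom_def)
    obtain p' q' where pb': "is_pullback C (MMap G u) (MMap G v) p' q'" by (rule pullback_exists[OF Gu Gv])
    note ty' = pullback_typing[OF pb', unfolded domG]
    have "\<iota> i \<cdot> p' = \<iota> j \<cdot> q'"
      using Comp_reassoc[OF \<iota>(3)[OF u] Gu \<iota>k ty'(4)] Comp_reassoc[OF \<iota>(3)[OF v] Gv \<iota>k ty'(5)]
        ty'(6) by simp
    then obtain e where e: "e \<in> hom C (Dom C p') (Dom C p)" "p \<cdot> e = p'" "q \<cdot> e = q'"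
      using pullback_lift[OF pb, unfolded dom, OF ty'(4,5)] by metis
    have "sub_le C c e" if c: "c \<in> arrows_into C (Dom C p)"
      and eq: "MMap G u \<cdot> (p \<cdot> c) = MMap G v \<cdot> (q \<cdot> c)" for c
    proof -
      have ch: "c \<in> hom C (Dom C c) (Dom C p)" using c by (simp add: arrows_into_def hom_def)
      obtain d where d: "d \<in> hom C (Dom C c) (Dom C p')" "p' \<cdot> d = p \<cdot> c" "q' \<cdot> d = q \<cdot> c"
        using pullback_lift[OF pb', unfolded domG, OF Comp_in_hom[OF ch ty(4)]
            Comp_in_hom[OF ch ty(5)] eq] by metis
      have "e \<cdot> d = c"
      proof (rule pullback_unique[OF pb Comp_in_hom[OF d(1) e(1)] ch])
        show "p \<cdot> (e \<cdot> d) = p \<cdot> c" using Comp_reassoc[OF e(2,1) ty(4) d(1)] d(2) by simp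
        show "q \<cdot> (e \<cdot> d) = q \<cdot> c" using Comp_reassoc[OF e(3,1) ty(5) d(1)] d(3) by simp
      qed
      then show ?thesis using d(1) e(1) by (auto intro!: sub_leI simp: hom_def)
    qed
    moreover have "e \<in> arrows_into C (Dom C p)" using e(1) by (simp add: arrows_into_def hom_def)
    ultimately show ?thesis using e(2,3) ty'(6) by (intro exI[of _ e]) simp
  qed
  then have "\<forall>uv \<in> ?K. \<exists>e. e \<in> arrows_into C (Dom C p) \<and>
      MMap G (fst uv) \<cdot> (p \<cdot> e) = MMap G (snd uv) \<cdot> (q \<cdot> e) \<and>
      (\<forall>c \<in> arrows_into C (Dom C p). MMap G (fst uv) \<cdot> (p \<cdot> c) = MMap G (snd uv) \<cdot> (q \<cdot> c) \<longrightarrow>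
        sub_le C c e)" (is "\<forall>uv \<in> ?K. \<exists>e. ?Q uv e")
    by auto
  then obtain e where e': "\<forall>uv \<in> ?K. ?Q uv (e uv)" by (rule exE[OF bchoice])
  have e: "e uv \<in> arrows_into C (Dom C p)"
    "MMap G (fst uv) \<cdot> (p \<cdot> e uv) = MMap G (snd uv) \<cdot> (q \<cdot> e uv)"
    "\<And>c. c \<in> arrows_into C (Dom C p) \<Longrightarrow> MMap G (fst uv) \<cdot> (p \<cdot> c) = MMap G (snd uv) \<cdot> (q \<cdot> c) \<Longrightarrow>
       sub_le C c (e uv)" if "uv \<in> ?K" for uv
    using bspec[OF e' that] by blast+
  have smallK: "|?K| <o \<kappa>"
  proof (rule ordLeq_ordLess_trans[OF card_of_mono1])
    show "?K \<subseteq> Mor J \<times> Mor J" by (auto simp: hom_def)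
    show "|Mor J \<times> Mor J| <o \<kappa>"
      by (rule card_Times_self_less[OF Cinfinite_\<kappa> small_J])
  qed
  have "covers C (Dom C p) (e ` ?K)"
  proof (rule covers_refine[OF category_axioms locally_exact_coconeD(3)[OF lex i j ty(4,5,6)]])
    show "e ` ?K \<subseteq> arrows_into C (Dom C p)" using e(1) by blast
    fix c assume "c \<in> {c \<in> arrows_into C (Dom C p). \<exists>k. \<exists>u \<in> hom J i k. \<exists>v \<in> hom J j k.
         MMap G u \<cdot> (p \<cdot> c) = MMap G v \<cdot> (q \<cdot> c)}"
    then obtain k u v where "c \<in> arrows_into C (Dom C p)" "u \<in> hom J i k" "v \<in> hom J j k"
      "MMap G u \<cdot> (p \<cdot> c) = MMap G v \<cdot> (q \<cdot> c)" by blast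
    then have "(u, v) \<in> ?K" "sub_le C c (e (u, v))" using e(3)[of "(u, v)" c] by auto
    then show "\<exists>f \<in> e ` ?K. sub_le C c f" by blast
  qed
  moreover have "\<exists>k. \<exists>u \<in> hom J i k. \<exists>v \<in> hom J j k. MMap G u \<cdot> (p \<cdot> d) = MMap G v \<cdot> (q \<cdot> d)"
    if d: "d \<in> e ` ?K" for d
  proof -
    obtain u v k where "u \<in> hom J i k" "v \<in> hom J j k" "d = e (u, v)" using d by blast
    then show ?thesis using e(2)[of "(u, v)"] by auto
  qed
  ultimately show "\<exists>p q S. is_pullback C (\<iota> i) (\<iota> j) p q \<and> |S| <o \<kappa> \<and> covers C (Dom C p) S \<and>
      (\<forall>e \<in> S. \<exists>k. \<exists>u \<in> hom J i k. \<exists>v \<in> hom J j k. MMap G u \<cdot> (p \<cdot> e) = MMap G v \<cdot> (q \<cdot> e))"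
    using pb small_image[OF smallK, of e] by blast
qed

text \<open>
  Conversely, small covering families generate pullback-stable conditions; one fixed pullback of \<open>\<iota> i\<close>
  and \<open>\<iota> j\<close> is enough, since it is the universal pair of identified elements.
\<close>

lemma locally_exact_cocone_of_small:
  assumes cocone: "is_cocone C J G x \<iota>" and cov: "covers C x (\<iota> ` Obj J)"
    and ker: "\<And>i j. i \<in> Obj J \<Longrightarrow> j \<in> Obj J \<Longrightarrow> \<exists>p q S. is_pullback C (\<iota> i) (\<iota> j) p q \<and> |S| <o \<kappa> \<and>
      covers C (Dom C p) S \<and>
      (\<forall>e \<in> S. \<exists>k. \<exists>u \<in> hom J i k. \<exists>v \<in> hom J j k. MMap G u \<cdot> (p \<cdot> e) = MMap G v \<cdot> (q \<cdot> e))"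
  shows "locally_exact_cocone C J G x \<iota>"
  unfolding locally_exact_cocone_def
proof (intro conjI ballI allI impI cocone)
  note \<iota> = cocone_typing[OF cocone]
  {
    fix t a assume a: "a \<in> hom C t x"
    show "covers C t {c \<in> arrows_into C t. \<exists>i \<in> Obj J. sub_le C (a \<cdot> c) (\<iota> i)}"
      by (rule covers_mono[OF covers_stable[OF cov small_image[OF small_Obj[OF G small_J]] a]]) auto
  next
    fix i j t a b assume i: "i \<in> Obj J" and j: "j \<in> Obj J"
      and a: "a \<in> hom C t (OMap G i)" and b: "b \<in> hom C t (OMap G j)" and eq: "\<iota> i \<cdot> a = \<iota> j \<cdot> b"
    have dom: "Dom C (\<iota> i) = OMap G i" "Dom C (\<iota> j) = OMap G j"
      using \<iota>(2)[OF i] \<iota>(2)[OF j] by (simp_all add: hom_def)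
    obtain p q S where pb: "is_pullback C (\<iota> i) (\<iota> j) p q" and S: "|S| <o \<kappa>" "covers C (Dom C p) S"
      and loc: "\<And>e. e \<in> S \<Longrightarrow> \<exists>k. \<exists>u \<in> hom J i k. \<exists>v \<in> hom J j k.
        MMap G u \<cdot> (p \<cdot> e) = MMap G v \<cdot> (q \<cdot> e)"
      using ker[OF i j] by blast
    note ty = pullback_typing[OF pb, unfolded dom]
    obtain h where h: "h \<in> hom C t (Dom C p)" "p \<cdot> h = a" "q \<cdot> h = b"
      by (rule pullback_lift[OF pb, unfolded dom, OF a b eq])
    show "covers C t {c \<in> arrows_into C t. \<exists>k. \<exists>u \<in> hom J i k. \<exists>v \<in> hom J j k.
      MMap G u \<cdot> (a \<cdot> c) = MMap G v \<cdot> (b \<cdot> c)}" (is "covers C t ?T")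
    proof (rule covers_mono[OF covers_stable[OF S(2,1) h(1)]])
      show "{c \<in> arrows_into C t. \<exists>f \<in> S. sub_le C (h \<cdot> c) f} \<subseteq> ?T"
      proof
        fix c assume "c \<in> {c \<in> arrows_into C t. \<exists>f \<in> S. sub_le C (h \<cdot> c) f}"
        then obtain f where c: "c \<in> arrows_into C t" and f: "f \<in> S" and le: "sub_le C (h \<cdot> c) f" by blast
        have ch: "c \<in> hom C (Dom C c) t" using c by (simp add: arrows_into_def hom_def)
        obtain d where d: "d \<in> hom C (Dom C c) (Dom C f)" "f \<cdot> d = h \<cdot> c"
          by (rule sub_leE[OF le Comp_in_hom[OF ch h(1)]])
        have fh: "f \<in> hom C (Dom C f) (Dom C p)" by (rule covers_into[OF S(2) f])
        obtain k u v where u: "u \<in> hom J i k" and v: "v \<in> hom J j k"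
          and uv: "MMap G u \<cdot> (p \<cdot> f) = MMap G v \<cdot> (q \<cdot> f)" using loc[OF f] by blast
        note Gu = G.MMap_in_hom[OF u] and Gv = G.MMap_in_hom[OF v]
        note pf = Comp_in_hom[OF fh ty(4)] and qf = Comp_in_hom[OF fh ty(5)]
        have "a \<cdot> c = p \<cdot> (f \<cdot> d)" "b \<cdot> c = q \<cdot> (f \<cdot> d)"
          using Comp_reassoc[OF h(2,1) ty(4) ch] Comp_reassoc[OF h(3,1) ty(5) ch] d(2) by simp_all
        then have "a \<cdot> c = p \<cdot> f \<cdot> d" "b \<cdot> c = q \<cdot> f \<cdot> d"
          using Comp_assoc[OF d(1) fh ty(4)] Comp_assoc[OF d(1) fh ty(5)] by simp_all
        then have "MMap G u \<cdot> (a \<cdot> c) = MMap G v \<cdot> (b \<cdot> c)"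
          using Comp_extend[OF uv pf Gu qf Gv d(1)] by simp
        then show "c \<in> ?T" using c u v by blast
      qed
    qed auto
  }
qed

end

end

text \<open>
  A small family covers if and only if its images have union the whole object, and geometric functors
  preserve the effective epimorphisms and the unions involved.
\<close>

lemma geometric_functor_covers:
  assumes A: "geometric_cat A \<kappa>" and B: "geometric_cat B \<kappa>" and F: "geometric_functor \<kappa> A B F"
    and cov: "covers A t S" and small: "|S| <o \<kappa>"
  shows "covers B (OMap F t) (MMap F ` S)"
proof -
  interpret A: geometric_cat A \<kappa> by fact
  interpret B: geometric_cat B \<kappa> by fact
  interpret F: cat_functor A B F using F by (simp add: geometric_functor_def)
  have t: "t \<in> Obj A" and S: "S \<subseteq> arrows_into A t" using cov by (auto simp: covers_def)
  have "\<forall>f \<in> S. \<exists>e m. effective_epi A e \<and> mono_mor A m \<and> Cod A e = Dom A m \<and> m \<cdot>\<^bsub>A\<^esub> e = f"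
    using S A.image_exists unfolding arrows_into_def by blast
  then obtain e m where im: "\<And>f. f \<in> S \<Longrightarrow> effective_epi A (e f) \<and> mono_mor A (m f) \<and>
      Cod A (e f) = Dom A (m f) \<and> m f \<cdot>\<^bsub>A\<^esub> e f = f" by metis
  have U: "is_union A t (m ` S) (Id A t) \<longleftrightarrow> covers A t S" "m ` S \<subseteq> subobjects A t"
    by (rule A.union_images_iff_covers[where e = e, OF t S], erule im)+
  have "is_union B (OMap F t) (MMap F ` m ` S) (MMap F (Id A t))"
  proof -
    have "|m ` S| <o \<kappa>" by (rule A.small_image[OF small])
    then show ?thesis using F t U cov unfolding geometric_functor_def by blast
  qed
  then have union: "is_union B (OMap F t) (MMap F ` m ` S) (Id B (OMap F t))"
    using F.MMap_Id[OF t] by simp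
  show ?thesis unfolding covers_def
  proof (intro conjI ballI impI)
    show "OMap F t \<in> Obj B" by (rule F.OMap_in_Obj[OF t])
    show "MMap F ` S \<subseteq> arrows_into B (OMap F t)"
      using S F.MMap_in_hom[of _ _ t] by (auto simp: arrows_into_def hom_def)
    fix n assume n: "n \<in> subobjects B (OMap F t)" and all: "\<forall>c \<in> MMap F ` S. sub_le B c n"
    have "sub_le B (MMap F (m f)) n" if f: "f \<in> S" for f
    proof -
      have e: "effective_epi A (e f)" using im[OF f] by blast
      have eh: "e f \<in> hom A (Dom A (e f)) (Dom A (m f))"
        using im[OF f] by (auto simp: effective_epi_def is_pullback_def hom_def)
      have mh: "m f \<in> hom A (Dom A (m f)) t" by (rule subobjects_hom) (use U(2) f in blast)
      have Fe: "effective_epi B (MMap F (e f))" using F e by (simp add: geometric_functor_def)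
      have "Cod B (MMap F (e f)) = OMap F (Dom A (m f))"
        using F.MMap_in_hom[OF eh] by (simp add: hom_def)
      then have Fm: "MMap F (m f) \<in> hom B (Cod B (MMap F (e f))) (OMap F t)"
        using F.MMap_in_hom[OF mh] by simp
      have "MMap F (m f) \<cdot>\<^bsub>B\<^esub> MMap F (e f) = MMap F f"
        using F.MMap_Comp[OF eh mh] im[OF f] by simp
      then show ?thesis using B.image_sub_le_iff[OF Fe Fm n] all f by simp
    qed
    then show "sub_le B (Id B (OMap F t)) n" using union n by (auto simp: is_union_def)
  qed
qed

lemma geometric_functor_locally_exact:
  assumes A: "geometric_cat A \<kappa>" and B: "geometric_cat B \<kappa>" and F: "geometric_functor \<kappa> A B F"
    and G: "cat_functor J A G" and small_J: "|Mor J| <o \<kappa>" and lex: "locally_exact_cocone A J G x \<iota>"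
  shows "locally_exact_cocone B J (ftor_comp F G) (OMap F x) (\<lambda>i. MMap F (\<iota> i))"
proof -
  interpret A: geometric_cat A \<kappa> by fact
  interpret B: geometric_cat B \<kappa> by fact
  have Ff: "cat_functor A B F" and Fl: "preserves_finite_limits A B F"
    using F by (auto simp: geometric_functor_def)
  interpret F: cat_functor A B F by fact
  interpret G: cat_functor J A G by fact
  note \<iota> = cocone_typing[OF locally_exact_coconeD(1)[OF lex]]
  note covers_F = geometric_functor_covers[OF A B F]
  show ?thesis
  proof (rule B.locally_exact_cocone_of_small[OF ftor_comp_functor[OF Ff G] small_J])
    show "is_cocone B J (ftor_comp F G) (OMap F x) (\<lambda>i. MMap F (\<iota> i))"
    proof (rule is_cocone_intro[OF G.A.category_axioms F.OMap_in_Obj[OF \<iota>(1)]])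
      show "MMap F (\<iota> i) \<in> hom B (OMap (ftor_comp F G) i) (OMap F x)" if "i \<in> Obj J" for i
        using F.MMap_in_hom[OF \<iota>(2)[OF that]] by (simp add: ftor_comp_def)
      show "MMap F (\<iota> k) \<cdot>\<^bsub>B\<^esub> MMap (ftor_comp F G) u = MMap F (\<iota> i)" if u: "u \<in> hom J i k" for u i k
        using F.MMap_Comp[OF G.MMap_in_hom[OF u] \<iota>(2)[OF G.A.hom_Obj(2)[OF u]]] \<iota>(3)[OF u]
        by (simp add: ftor_comp_def)
    qed
    have "covers B (OMap F x) (MMap F ` \<iota> ` Obj J)"
      by (rule covers_F[OF A.locally_exact_cocone_small(1)[OF G small_J lex]
          A.small_image[OF A.small_Obj[OF G small_J]]])
    then show "covers B (OMap F x) ((\<lambda>i. MMap F (\<iota> i)) ` Obj J)" by (simp add: image_image)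
    fix i j assume i: "i \<in> Obj J" and j: "j \<in> Obj J"
    have dom: "Dom A (\<iota> i) = OMap G i" "Dom A (\<iota> j) = OMap G j"
      using \<iota>(2)[OF i] \<iota>(2)[OF j] by (simp_all add: hom_def)
    obtain p q S where pb: "is_pullback A (\<iota> i) (\<iota> j) p q" and S: "|S| <o \<kappa>" "covers A (Dom A p) S"
      and loc: "\<And>e. e \<in> S \<Longrightarrow> \<exists>k. \<exists>u \<in> hom J i k. \<exists>v \<in> hom J j k.
        MMap G u \<cdot>\<^bsub>A\<^esub> (p \<cdot>\<^bsub>A\<^esub> e) = MMap G v \<cdot>\<^bsub>A\<^esub> (q \<cdot>\<^bsub>A\<^esub> e)"
      using A.locally_exact_cocone_small(2)[OF G small_J lex i j] by blast
    note ty = A.pullback_typing[OF pb, unfolded dom]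
    have "is_pullback B (MMap F (\<iota> i)) (MMap F (\<iota> j)) (MMap F p) (MMap F q)"
      by (rule preserves_pullback[OF Ff Fl pb])
    moreover have "|MMap F ` S| <o \<kappa>" by (rule B.small_image[OF S(1)])
    moreover have "Dom B (MMap F p) = OMap F (Dom A p)"
      using F.MMap_in_hom[OF ty(4)] by (simp add: hom_def)
    then have "covers B (Dom B (MMap F p)) (MMap F ` S)" using covers_F[OF S(2,1)] by simp
    moreover have "\<exists>k. \<exists>u \<in> hom J i k. \<exists>v \<in> hom J j k.
        MMap (ftor_comp F G) u \<cdot>\<^bsub>B\<^esub> (MMap F p \<cdot>\<^bsub>B\<^esub> MMap F e) =
        MMap (ftor_comp F G) v \<cdot>\<^bsub>B\<^esub> (MMap F q \<cdot>\<^bsub>B\<^esub> MMap F e)" if e: "e \<in> S" for e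
    proof -
      have eh: "e \<in> hom A (Dom A e) (Dom A p)" by (rule covers_into[OF S(2) e])
      obtain k u v where u: "u \<in> hom J i k" and v: "v \<in> hom J j k"
        and uv: "MMap G u \<cdot>\<^bsub>A\<^esub> (p \<cdot>\<^bsub>A\<^esub> e) = MMap G v \<cdot>\<^bsub>A\<^esub> (q \<cdot>\<^bsub>A\<^esub> e)" using loc[OF e] by blast
      have "MMap F (MMap G u) \<cdot>\<^bsub>B\<^esub> (MMap F p \<cdot>\<^bsub>B\<^esub> MMap F e) =
          MMap F (MMap G v) \<cdot>\<^bsub>B\<^esub> (MMap F q \<cdot>\<^bsub>B\<^esub> MMap F e)"
        using F.MMap_Comp[OF eh ty(4)] F.MMap_Comp[OF eh ty(5)]
          F.MMap_Comp[OF A.Comp_in_hom[OF eh ty(4)] G.MMap_in_hom[OF u]]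
          F.MMap_Comp[OF A.Comp_in_hom[OF eh ty(5)] G.MMap_in_hom[OF v]] uv by simp
      then show ?thesis using u v by (auto simp: ftor_comp_def)
    qed
    ultimately show "\<exists>p q S. is_pullback B (MMap F (\<iota> i)) (MMap F (\<iota> j)) p q \<and> |S| <o \<kappa> \<and>
      covers B (Dom B p) S \<and> (\<forall>e \<in> S. \<exists>k. \<exists>u \<in> hom J i k. \<exists>v \<in> hom J j k.
        MMap (ftor_comp F G) u \<cdot>\<^bsub>B\<^esub> (p \<cdot>\<^bsub>B\<^esub> e) = MMap (ftor_comp F G) v \<cdot>\<^bsub>B\<^esub> (q \<cdot>\<^bsub>B\<^esub> e))"
      by blast
  qed
qed

section \<open>Construction of filtered colimits in a pretopos\<close>

locale pretopos_cat = geometric_cat C \<kappa> for C :: "('o, 'm) cat" (structure) and \<kappa> :: "'l rel" +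
  assumes pretopos: "pretopos \<kappa> C"
begin

lemma pretopos_coproduct:
  assumes "|I :: 'l set| <o \<kappa>" "\<And>i. i \<in> I \<Longrightarrow> A i \<in> Obj C"
  shows "\<exists>x \<iota>. is_coproduct C I A x \<iota>"
    "is_coproduct C I A x \<iota> \<Longrightarrow> disjoint_coproduct C I \<iota> \<and> pullback_stable_coproduct C I x \<iota>"
  using pretopos assms unfolding pretopos_def by blast+

text \<open>
  Initial objects are empty coproducts, so this is pullback-stability of the empty coproduct.
\<close>

lemma initial_strict:
  assumes z: "initial_object C z" and f: "f \<in> hom C t z"
  shows "initial_object C t"
proof -
  have empty: "|{} :: 'l set| <o \<kappa>"
    by (rule card_finite_less[OF Cinfinite_\<kappa>]) simp
  have iff: "is_coproduct C {} A x \<iota> \<longleftrightarrow> initial_object C x" for A :: "'l \<Rightarrow> 'o" and x \<iota>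
    by (auto simp: is_coproduct_def initial_object_def)
  \<comment> \<open>The index set is empty, so any family of morphisms serves as injections.\<close>
  have "is_coproduct C {} (\<lambda>_ :: 'l. z) z (\<lambda>_. f)" using z iff by blast
  then have stable: "pullback_stable_coproduct C ({} :: 'l set) z (\<lambda>_. f)"
    using pretopos_coproduct(2)[OF empty, of "\<lambda>_. z"] by blast
  have "f \<in> Mor C" "Cod C f = z" "Dom C f = t" using f by (simp_all add: hom_def)
  then have "is_coproduct C {} (\<lambda>i :: 'l. Dom C f) t (\<lambda>_. f)"
    using stable[unfolded pullback_stable_coproduct_def, THEN spec[of _ f],
        THEN spec[of _ "\<lambda>_. f"], THEN spec[of _ "\<lambda>_. f"]] by simp
  then show ?thesis using iff by blast
qed

lemma covers_empty_initial:
  assumes "initial_object C t"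
  shows "covers C t {}"
  unfolding covers_def
proof (intro conjI ballI impI)
  show t: "t \<in> Obj C" using assms by (simp add: initial_object_def)
  have unique: "\<exists>!f. f \<in> hom C t b" if "b \<in> Obj C" for b
    using assms that by (simp add: initial_object_def)
  fix n assume n: "n \<in> subobjects C t"
  note nh = subobjects_hom[OF n]
  obtain h where h: "h \<in> hom C t (Dom C n)" using unique[OF hom_Obj(1)[OF nh]] by blast
  have "n \<cdot> h = Id C t" using unique[OF t] Comp_in_hom[OF h nh] Id_in_hom[OF t] by blast
  then show "sub_le C (Id C t) n" using h nh by (auto intro!: sub_leI simp: hom_def)
qed simp

text \<open>
  The alternative \<open>covers C t {}\<close> at the end says that \<open>t\<close> is empty.  In that case every local statement
  about \<open>t\<close> holds, which makes it the convenient form of disjointness.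
\<close>

lemma small_coproduct:
  assumes small: "|I| <o \<kappa>" and A: "\<And>i. i \<in> I \<Longrightarrow> A i \<in> Obj C"
  obtains x \<iota> where "x \<in> Obj C" "\<And>i. i \<in> I \<Longrightarrow> \<iota> i \<in> hom C (A i) x" "covers C x (\<iota> ` I)"
    "\<And>i j t a b. i \<in> I \<Longrightarrow> j \<in> I \<Longrightarrow> a \<in> hom C t (A i) \<Longrightarrow> b \<in> hom C t (A j) \<Longrightarrow>
       \<iota> i \<cdot> a = \<iota> j \<cdot> b \<Longrightarrow> (i = j \<and> a = b) \<or> covers C t {}"
proof -
  \<comment> \<open>The coproduct axiom is about index sets in the type of \<open>\<kappa>\<close>, so \<open>I\<close> is embedded there by \<open>f\<close>.\<close>
  have "|I| \<le>o |Field \<kappa>|"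
    using Cinfinite_\<kappa> ordLeq_ordIso_trans[OF ordLess_imp_ordLeq[OF small]
        ordIso_symmetric[OF card_of_Field_ordIso]] by blast
  then obtain f where f: "inj_on f I" "f ` I \<subseteq> Field \<kappa>" by (auto simp: card_of_ordLeq[symmetric])
  let ?g = "inv_into I f"
  have gf: "?g (f i) = i" if "i \<in> I" for i using f(1) that by simp
  have fI: "|f ` I| <o \<kappa>" by (rule small_image[OF small])
  have Ag: "A (?g l) \<in> Obj C" if "l \<in> f ` I" for l using A gf that by auto
  obtain x \<iota> where co: "is_coproduct C (f ` I) (\<lambda>l. A (?g l)) x \<iota>"
    using pretopos_coproduct(1)[OF fI, of "\<lambda>l. A (?g l)"] Ag by blast
  have dj: "disjoint_coproduct C (f ` I) \<iota>" using pretopos_coproduct(2)[OF fI Ag co] by blast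
  define \<eta> where "\<eta> i = \<iota> (f i)" for i
  have x: "x \<in> Obj C" using co by (simp add: is_coproduct_def)
  have \<eta>: "\<eta> i \<in> hom C (A i) x" if "i \<in> I" for i
    using co that gf unfolding is_coproduct_def \<eta>_def by force
  have desc: "\<exists>!h. h \<in> hom C x y \<and> (\<forall>i \<in> I. h \<cdot> \<eta> i = \<sigma> i)"
    if y: "y \<in> Obj C" and \<sigma>: "\<And>i. i \<in> I \<Longrightarrow> \<sigma> i \<in> hom C (A i) y" for y \<sigma>
  proof -
    have "\<forall>l \<in> f ` I. \<sigma> (?g l) \<in> hom C (A (?g l)) y" using \<sigma> gf by auto
    then have "\<exists>!h. h \<in> hom C x y \<and> (\<forall>l \<in> f ` I. h \<cdot> \<iota> l = \<sigma> (?g l))"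
      by (rule co[unfolded is_coproduct_def, THEN conjunct2, THEN conjunct2, THEN bspec, OF y,
            THEN spec[of _ "\<lambda>l. \<sigma> (?g l)"], THEN mp])
    then show ?thesis unfolding \<eta>_def using gf by simp
  qed
  show ?thesis
  proof
    show "x \<in> Obj C" by fact
    show "\<eta> i \<in> hom C (A i) x" if "i \<in> I" for i by (rule \<eta>[OF that])
    show "covers C x (\<eta> ` I)" unfolding covers_def
    proof (intro conjI ballI impI)
      show "x \<in> Obj C" by fact
      show "\<eta> ` I \<subseteq> arrows_into C x" using \<eta> by (auto simp: arrows_into_def hom_def)
      fix n assume n: "n \<in> subobjects C x" and all: "\<forall>c \<in> \<eta> ` I. sub_le C c n"
      note nh = subobjects_hom[OF n]
      have "\<forall>i \<in> I. \<exists>k. k \<in> hom C (A i) (Dom C n) \<and> n \<cdot> k = \<eta> i"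
        using all \<eta> by (meson imageI sub_leE)
      then obtain k where k: "\<And>i. i \<in> I \<Longrightarrow> k i \<in> hom C (A i) (Dom C n)"
        "\<And>i. i \<in> I \<Longrightarrow> n \<cdot> k i = \<eta> i" by metis
      obtain h where h: "h \<in> hom C x (Dom C n)" "\<And>i. i \<in> I \<Longrightarrow> h \<cdot> \<eta> i = k i"
        using desc[OF hom_Obj(1)[OF nh] k(1)] by blast
      have "n \<cdot> h \<cdot> \<eta> i = \<eta> i" if "i \<in> I" for i
        using Comp_assoc[OF \<eta>[OF that] h(1) nh] h(2)[OF that] k(2)[OF that] by simp
      moreover have "Id C x \<cdot> \<eta> i = \<eta> i" if "i \<in> I" for i by (rule Comp_Id_left[OF \<eta>[OF that]])
      ultimately have "n \<cdot> h = Id C x"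
        using desc[OF x \<eta>] Comp_in_hom[OF h(1) nh] Id_in_hom[OF x] by blast
      then show "sub_le C (Id C x) n" using h(1) nh by (auto intro!: sub_leI simp: hom_def)
    qed
    fix i j t a b assume i: "i \<in> I" and j: "j \<in> I" and a: "a \<in> hom C t (A i)"
      and b: "b \<in> hom C t (A j)" and eq: "\<eta> i \<cdot> a = \<eta> j \<cdot> b"
    have dom: "Dom C (\<eta> i) = A i" "Dom C (\<eta> j) = A j"
      using \<eta>[OF i] \<eta>[OF j] by (simp_all add: hom_def)
    show "(i = j \<and> a = b) \<or> covers C t {}"
    proof (cases "i = j")
      case True
      have "mono_mor C (\<eta> i)" using dj i unfolding disjoint_coproduct_def \<eta>_def by blast
      then have "a = b" using mono_cancel[of "\<eta> i" a t b] a b eq True dom by simp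
      then show ?thesis using True by simp
    next
      case False
      then have ne: "f i \<noteq> f j" using f(1) i j by (auto simp: inj_on_def)
      obtain p q where pb: "is_pullback C (\<eta> i) (\<eta> j) p q"
        by (rule pullback_exists[OF \<eta>[OF i] \<eta>[OF j]])
      have "initial_object C (Dom C p)"
        using dj i j ne pb unfolding disjoint_coproduct_def \<eta>_def by blast
      moreover obtain h where "h \<in> hom C t (Dom C p)"
        using pullback_lift[OF pb, unfolded dom, OF a b eq] by metis
      ultimately show ?thesis using covers_empty_initial[OF initial_strict] by blast
    qed
  qed
qed

lemma equivalence_quotient:
  assumes "x \<in> Obj C" "internal_equivalence_relation C x r s"
  obtains e where "is_coequalizer C r s e" "is_pullback C e e r s"
  using pretopos assms unfolding pretopos_def barr_exact_def by blast

context
  fixes J :: "('i, 'j) cat" and G :: "('i, 'j, 'o, 'm) ftor"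
  assumes G: "cat_functor J C G" and small_J: "|Mor J| <o \<kappa>"
begin

interpretation G: cat_functor J C G by (rule G)

text \<open>
  In the application \<open>x\<close> is the coproduct of the diagram and the \<open>\<eta> i\<close> are its injections.  The relation
  \<open>R\<close> identifies an element of \<open>G i\<close> with an element of \<open>G j\<close> if they locally have the same image in some
  \<open>G k\<close>; it is generated by the fibre products of \<open>G u\<close> and \<open>G v\<close> for all pairs of morphisms \<open>u\<close>, \<open>v\<close> of
  \<open>J\<close> with common codomain, of which there are fewer than \<open>\<kappa>\<close>.
\<close>

lemma identification_relation:
  assumes x: "x \<in> Obj C" and \<eta>: "\<And>i. i \<in> Obj J \<Longrightarrow> \<eta> i \<in> hom C (OMap G i) x"
  obtains R r s where "r \<in> hom C R x" "s \<in> hom C R x" "jointly_monic C r s"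
    "\<And>i j k u v t a b. u \<in> hom J i k \<Longrightarrow> v \<in> hom J j k \<Longrightarrow> a \<in> hom C t (OMap G i) \<Longrightarrow>
       b \<in> hom C t (OMap G j) \<Longrightarrow> MMap G u \<cdot> a = MMap G v \<cdot> b \<Longrightarrow>
       \<exists>h \<in> hom C t R. r \<cdot> h = \<eta> i \<cdot> a \<and> s \<cdot> h = \<eta> j \<cdot> b"
    "\<And>t h. h \<in> hom C t R \<Longrightarrow> covers C t {c \<in> arrows_into C t.
       \<exists>i j k. \<exists>u \<in> hom J i k. \<exists>v \<in> hom J j k. \<exists>a \<in> hom C (Dom C c) (OMap G i).
         \<exists>b \<in> hom C (Dom C c) (OMap G j). MMap G u \<cdot> a = MMap G v \<cdot> b \<and>
           r \<cdot> (h \<cdot> c) = \<eta> i \<cdot> a \<and> s \<cdot> (h \<cdot> c) = \<eta> j \<cdot> b}"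
    "\<And>t \<alpha> \<beta> S. \<alpha> \<in> hom C t x \<Longrightarrow> \<beta> \<in> hom C t x \<Longrightarrow> covers C t S \<Longrightarrow>
       \<forall>c \<in> S. \<exists>h \<in> hom C (Dom C c) R. r \<cdot> h = \<alpha> \<cdot> c \<and> s \<cdot> h = \<beta> \<cdot> c \<Longrightarrow>
       \<exists>h \<in> hom C t R. r \<cdot> h = \<alpha> \<and> s \<cdot> h = \<beta>"
proof -
  define K where "K = {w \<in> Mor J \<times> Mor J. Cod J (fst w) = Cod J (snd w)}"
  have smallK: "|K| <o \<kappa>"
    by (rule ordLeq_ordLess_trans[OF card_of_mono1 card_Times_self_less[OF Cinfinite_\<kappa> small_J]])
      (auto simp: K_def)
  have K: "fst w \<in> hom J (Dom J (fst w)) (Cod J (fst w))" "snd w \<in> hom J (Dom J (snd w)) (Cod J (fst w))"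
    if "w \<in> K" for w using that by (auto simp: K_def hom_def)
  have KI: "(u, v) \<in> K" if "u \<in> hom J i k" "v \<in> hom J j k" for u v i j k
    using that by (auto simp: K_def hom_def)
  have "\<exists>pq. is_pullback C (MMap G (fst w)) (MMap G (snd w)) (fst pq) (snd pq)" if "w \<in> K" for w
    using pullback_exists[OF G.MMap_in_hom[OF K(1)[OF that]] G.MMap_in_hom[OF K(2)[OF that]]]
    by (metis fst_conv snd_conv)
  then have "\<forall>w \<in> K. \<exists>pq. is_pullback C (MMap G (fst w)) (MMap G (snd w)) (fst pq) (snd pq)" by blast
  then obtain pq where
    pq: "\<forall>w \<in> K. is_pullback C (MMap G (fst w)) (MMap G (snd w)) (fst (pq w)) (snd (pq w))"
    by (rule exE[OF bchoice])
  define p q where "p w = fst (pq w)" and "q w = snd (pq w)" for w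
  have pb: "is_pullback C (MMap G (fst w)) (MMap G (snd w)) (p w) (q w)" if "w \<in> K" for w
    using bspec[OF pq that] by (simp add: p_def q_def)
  have domG: "Dom C (MMap G (fst w)) = OMap G (Dom J (fst w))"
    "Dom C (MMap G (snd w)) = OMap G (Dom J (snd w))" if "w \<in> K" for w
    using G.MMap_in_hom[OF K(1)[OF that]] G.MMap_in_hom[OF K(2)[OF that]] by (simp_all add: hom_def)
  have ty: "p w \<in> hom C (Dom C (p w)) (OMap G (Dom J (fst w)))"
    "q w \<in> hom C (Dom C (p w)) (OMap G (Dom J (snd w)))"
    "MMap G (fst w) \<cdot> p w = MMap G (snd w) \<cdot> q w" if "w \<in> K" for w
    using pullback_typing[OF pb[OF that]] domG[OF that] by simp_all
  have \<eta>w: "\<eta> (Dom J (fst w)) \<in> hom C (OMap G (Dom J (fst w))) x"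
    "\<eta> (Dom J (snd w)) \<in> hom C (OMap G (Dom J (snd w))) x" if "w \<in> K" for w
    using \<eta>[OF G.A.hom_Obj(1)[OF K(1)[OF that]]] \<eta>[OF G.A.hom_Obj(1)[OF K(2)[OF that]]] .
  let ?a = "\<lambda>w. \<eta> (Dom J (fst w)) \<cdot> p w" and ?b = "\<lambda>w. \<eta> (Dom J (snd w)) \<cdot> q w"
  have ab: "?a w \<in> hom C (Dom C (p w)) x" "?b w \<in> hom C (Dom C (p w)) x" if "w \<in> K" for w
    using Comp_in_hom[OF ty(1) \<eta>w(1)] Comp_in_hom[OF ty(2) \<eta>w(2)] that by auto
  obtain R r s where rs: "r \<in> hom C R x" "s \<in> hom C R x" "jointly_monic C r s"
    and gen: "\<And>w. w \<in> K \<Longrightarrow> \<exists>g \<in> hom C (Dom C (p w)) R. r \<cdot> g = ?a w \<and> s \<cdot> g = ?b w"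
    and cov: "\<And>t h. h \<in> hom C t R \<Longrightarrow> covers C t {c \<in> arrows_into C t. \<exists>w \<in> K.
       \<exists>d \<in> hom C (Dom C c) (Dom C (p w)). r \<cdot> (h \<cdot> c) = ?a w \<cdot> d \<and> s \<cdot> (h \<cdot> c) = ?b w \<cdot> d}"
    and loc: "\<And>t \<alpha> \<beta> S. \<alpha> \<in> hom C t x \<Longrightarrow> \<beta> \<in> hom C t x \<Longrightarrow> covers C t S \<Longrightarrow>
       \<forall>c \<in> S. \<exists>h \<in> hom C (Dom C c) R. r \<cdot> h = \<alpha> \<cdot> c \<and> s \<cdot> h = \<beta> \<cdot> c \<Longrightarrow>
       \<exists>h \<in> hom C t R. r \<cdot> h = \<alpha> \<and> s \<cdot> h = \<beta>"
  proof (rule generated_relation[where a = ?a and b = ?b and P = "\<lambda>w. Dom C (p w)",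
        OF x x smallK ab], assumption, assumption)
  qed (erule (2) that)
  show ?thesis
  proof (rule that[OF rs _ _ loc])
    fix i j k u v t a b assume u: "u \<in> hom J i k" and v: "v \<in> hom J j k"
      and a: "a \<in> hom C t (OMap G i)" and b: "b \<in> hom C t (OMap G j)"
      and eq: "MMap G u \<cdot> a = MMap G v \<cdot> b"
    note w = KI[OF u v]
    have dJ: "Dom J u = i" "Dom J v = j" using u v by (simp_all add: hom_def)
    note T = ty[OF w, simplified dJ fst_conv snd_conv] and D = domG[OF w, simplified dJ fst_conv snd_conv]
      and E = \<eta>w[OF w, simplified dJ fst_conv snd_conv]
    obtain d where d: "d \<in> hom C t (Dom C (p (u, v)))" "p (u, v) \<cdot> d = a" "q (u, v) \<cdot> d = b"
      using pullback_lift[OF pb[OF w, simplified fst_conv snd_conv], unfolded D, OF a b eq] by metis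
    obtain g where g: "g \<in> hom C (Dom C (p (u, v))) R" "r \<cdot> g = \<eta> i \<cdot> p (u, v)" "s \<cdot> g = \<eta> j \<cdot> q (u, v)"
      using gen[OF w] dJ by auto
    have "r \<cdot> (g \<cdot> d) = \<eta> i \<cdot> a" using Comp_extend[OF g(2,1) rs(1) T(1) E(1) d(1)] d(2) by simp
    moreover have "s \<cdot> (g \<cdot> d) = \<eta> j \<cdot> b"
      using Comp_extend[OF g(3,1) rs(2) T(2) E(2) d(1)] d(3) by simp
    ultimately show "\<exists>h \<in> hom C t R. r \<cdot> h = \<eta> i \<cdot> a \<and> s \<cdot> h = \<eta> j \<cdot> b"
      using Comp_in_hom[OF d(1) g(1)] by blast
  next
    fix t h assume h: "h \<in> hom C t R"
    show "covers C t {c \<in> arrows_into C t.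
       \<exists>i j k. \<exists>u \<in> hom J i k. \<exists>v \<in> hom J j k. \<exists>a \<in> hom C (Dom C c) (OMap G i).
         \<exists>b \<in> hom C (Dom C c) (OMap G j). MMap G u \<cdot> a = MMap G v \<cdot> b \<and>
           r \<cdot> (h \<cdot> c) = \<eta> i \<cdot> a \<and> s \<cdot> (h \<cdot> c) = \<eta> j \<cdot> b}" (is "covers C t ?T")
    proof (rule covers_mono[OF cov[OF h]])
      show "{c \<in> arrows_into C t. \<exists>w \<in> K. \<exists>d \<in> hom C (Dom C c) (Dom C (p w)).
        r \<cdot> (h \<cdot> c) = ?a w \<cdot> d \<and> s \<cdot> (h \<cdot> c) = ?b w \<cdot> d} \<subseteq> ?T"
      proof
        fix c assume "c \<in> {c \<in> arrows_into C t. \<exists>w \<in> K. \<exists>d \<in> hom C (Dom C c) (Dom C (p w)).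
          r \<cdot> (h \<cdot> c) = ?a w \<cdot> d \<and> s \<cdot> (h \<cdot> c) = ?b w \<cdot> d}"
        then obtain w d where c: "c \<in> arrows_into C t" and w: "w \<in> K"
          and d: "d \<in> hom C (Dom C c) (Dom C (p w))"
          "r \<cdot> (h \<cdot> c) = ?a w \<cdot> d" "s \<cdot> (h \<cdot> c) = ?b w \<cdot> d" by blast
        have "r \<cdot> (h \<cdot> c) = \<eta> (Dom J (fst w)) \<cdot> (p w \<cdot> d)" "s \<cdot> (h \<cdot> c) = \<eta> (Dom J (snd w)) \<cdot> (q w \<cdot> d)"
          using d Comp_assoc[OF d(1) ty(1)[OF w] \<eta>w(1)[OF w]] Comp_assoc[OF d(1) ty(2)[OF w] \<eta>w(2)[OF w]]
          by simp_all
        moreover have "MMap G (fst w) \<cdot> (p w \<cdot> d) = MMap G (snd w) \<cdot> (q w \<cdot> d)"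
          by (rule Comp_extend[OF ty(3)[OF w] ty(1)[OF w] G.MMap_in_hom[OF K(1)[OF w]] ty(2)[OF w]
                G.MMap_in_hom[OF K(2)[OF w]] d(1)])
        moreover note Comp_in_hom[OF d(1) ty(1)[OF w]] Comp_in_hom[OF d(1) ty(2)[OF w]] K[OF w]
        ultimately show "c \<in> ?T" using c by blast
      qed
    qed auto
  qed
qed

text \<open>
  The vertex is the quotient of the coproduct of the diagram by \<open>identification_relation\<close>.  Local
  exactness is then immediate: the coproduct injections followed by the quotient map cover, and
  elements with the same image in the quotient are related since the quotient is effective.
\<close>

lemma locally_exact_cocone_exists:
  assumes filtered: "filtered_category J"
  shows "\<exists>x \<iota>. locally_exact_cocone C J G x \<iota>"
proof -
  obtain x \<eta> where x: "x \<in> Obj C" and \<eta>: "\<And>i. i \<in> Obj J \<Longrightarrow> \<eta> i \<in> hom C (OMap G i) x"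
    and cov\<eta>: "covers C x (\<eta> ` Obj J)"
    and disj: "\<And>i j t a b. i \<in> Obj J \<Longrightarrow> j \<in> Obj J \<Longrightarrow> a \<in> hom C t (OMap G i) \<Longrightarrow>
       b \<in> hom C t (OMap G j) \<Longrightarrow> \<eta> i \<cdot> a = \<eta> j \<cdot> b \<Longrightarrow> (i = j \<and> a = b) \<or> covers C t {}"
  proof (rule small_coproduct[where A = "OMap G", OF small_Obj[OF G small_J] G.OMap_in_Obj], assumption)
  qed (rule that)
  obtain R r s where rs: "r \<in> hom C R x" "s \<in> hom C R x" "jointly_monic C r s"
    and gen: "\<And>i j k u v t a b. u \<in> hom J i k \<Longrightarrow> v \<in> hom J j k \<Longrightarrow> a \<in> hom C t (OMap G i) \<Longrightarrow>
       b \<in> hom C t (OMap G j) \<Longrightarrow> MMap G u \<cdot> a = MMap G v \<cdot> b \<Longrightarrow>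
       \<exists>h \<in> hom C t R. r \<cdot> h = \<eta> i \<cdot> a \<and> s \<cdot> h = \<eta> j \<cdot> b"
    and cov: "\<And>t h. h \<in> hom C t R \<Longrightarrow> covers C t {c \<in> arrows_into C t.
       \<exists>i j k. \<exists>u \<in> hom J i k. \<exists>v \<in> hom J j k. \<exists>a \<in> hom C (Dom C c) (OMap G i).
         \<exists>b \<in> hom C (Dom C c) (OMap G j). MMap G u \<cdot> a = MMap G v \<cdot> b \<and>
           r \<cdot> (h \<cdot> c) = \<eta> i \<cdot> a \<and> s \<cdot> (h \<cdot> c) = \<eta> j \<cdot> b}"
    and loc: "\<And>t \<alpha> \<beta> S. \<alpha> \<in> hom C t x \<Longrightarrow> \<beta> \<in> hom C t x \<Longrightarrow> covers C t S \<Longrightarrow>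
       \<forall>c \<in> S. \<exists>h \<in> hom C (Dom C c) R. r \<cdot> h = \<alpha> \<cdot> c \<and> s \<cdot> h = \<beta> \<cdot> c \<Longrightarrow>
       \<exists>h \<in> hom C t R. r \<cdot> h = \<alpha> \<and> s \<cdot> h = \<beta>"
  proof (rule identification_relation[of x \<eta>, OF x \<eta>], assumption)
  qed (erule (2) that)
  have dom: "Dom C r = R" "Dom C s = R" using rs by (simp_all add: hom_def)
  note RO = hom_Obj(1)[OF rs(1)]
  have GId: "MMap G (Id J i) \<in> hom C (OMap G i) (OMap G i)" "Id J i \<in> hom J i i"
    "a \<in> hom C t (OMap G i) \<Longrightarrow> MMap G (Id J i) \<cdot> a = a" if "i \<in> Obj J" for i a t
    using G.A.Id_in_hom[OF that] G.MMap_in_hom[OF G.A.Id_in_hom[OF that]] G.MMap_Id[OF that]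
      Comp_Id_left by auto

  have reflexive: "\<exists>d \<in> hom C x R. r \<cdot> d = Id C x \<and> s \<cdot> d = Id C x"
  proof (rule loc[OF Id_in_hom[OF x] Id_in_hom[OF x] cov\<eta>, OF ballI])
    fix c assume "c \<in> \<eta> ` Obj J"
    then obtain i where i: "i \<in> Obj J" "c = \<eta> i" by blast
    note \<eta>i = \<eta>[OF i(1)]
    have "OMap G i \<in> Obj C" by (rule G.OMap_in_Obj[OF i(1)])
    then have I: "Id C (OMap G i) \<in> hom C (OMap G i) (OMap G i)" by (rule Id_in_hom)
    have "Dom C c = OMap G i" "Id C x \<cdot> c = c" "\<eta> i \<cdot> Id C (OMap G i) = c"
      using \<eta>i i(2) Comp_Id_left[OF \<eta>i] Comp_Id_right[OF \<eta>i] by (simp_all add: hom_def)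
    then show "\<exists>h \<in> hom C (Dom C c) R. r \<cdot> h = Id C x \<cdot> c \<and> s \<cdot> h = Id C x \<cdot> c"
      using gen[OF GId(2)[OF i(1)] GId(2)[OF i(1)] I I refl] by simp
  qed

  have symmetric: "\<exists>\<sigma> \<in> hom C R R. r \<cdot> \<sigma> = s \<and> s \<cdot> \<sigma> = r"
  proof (rule loc[OF rs(2,1) cov[OF Id_in_hom[OF RO]], OF ballI])
    fix c assume "c \<in> {c \<in> arrows_into C R.
       \<exists>i j k. \<exists>u \<in> hom J i k. \<exists>v \<in> hom J j k. \<exists>a \<in> hom C (Dom C c) (OMap G i).
         \<exists>b \<in> hom C (Dom C c) (OMap G j). MMap G u \<cdot> a = MMap G v \<cdot> b \<and>
           r \<cdot> (Id C R \<cdot> c) = \<eta> i \<cdot> a \<and> s \<cdot> (Id C R \<cdot> c) = \<eta> j \<cdot> b}"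
    then obtain i j k u v a b where c: "c \<in> arrows_into C R" and u: "u \<in> hom J i k"
      and v: "v \<in> hom J j k" and a: "a \<in> hom C (Dom C c) (OMap G i)"
      and b: "b \<in> hom C (Dom C c) (OMap G j)" and uv: "MMap G u \<cdot> a = MMap G v \<cdot> b"
      and eq: "r \<cdot> (Id C R \<cdot> c) = \<eta> i \<cdot> a" "s \<cdot> (Id C R \<cdot> c) = \<eta> j \<cdot> b" by blast
    have "Id C R \<cdot> c = c" using c by (auto simp: arrows_into_def)
    then show "\<exists>h \<in> hom C (Dom C c) R. r \<cdot> h = s \<cdot> c \<and> s \<cdot> h = r \<cdot> c"
      using gen[OF v u b a uv[symmetric]] eq by simp
  qed

  \<comment> \<open>Filteredness: two ways of moving on from stage \<open>j\<close> can be made to agree later.\<close>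
  have amalgamate: "\<exists>m w w'. w \<in> hom J k m \<and> w' \<in> hom J k' m \<and> w \<cdot>\<^bsub>J\<^esub> v = w' \<cdot>\<^bsub>J\<^esub> u"
    if v: "v \<in> hom J j k" and u: "u \<in> hom J j k'" for j k k' u v
  proof -
    obtain l f g where fg: "f \<in> hom J k l" "g \<in> hom J k' l"
      using filtered G.A.hom_Obj[OF v] G.A.hom_Obj[OF u] unfolding filtered_category_def by meson
    obtain m h where h: "h \<in> hom J l m" "h \<cdot>\<^bsub>J\<^esub> (f \<cdot>\<^bsub>J\<^esub> v) = h \<cdot>\<^bsub>J\<^esub> (g \<cdot>\<^bsub>J\<^esub> u)"
      using filtered G.A.Comp_in_hom[OF v fg(1)] G.A.Comp_in_hom[OF u fg(2)]
      unfolding filtered_category_def by meson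
    have "(h \<cdot>\<^bsub>J\<^esub> f) \<cdot>\<^bsub>J\<^esub> v = (h \<cdot>\<^bsub>J\<^esub> g) \<cdot>\<^bsub>J\<^esub> u"
      using h(2) G.A.Comp_assoc[OF v fg(1) h(1)] G.A.Comp_assoc[OF u fg(2) h(1)] by simp
    then show ?thesis using G.A.Comp_in_hom[OF fg(1) h(1)] G.A.Comp_in_hom[OF fg(2) h(1)] by blast
  qed

  obtain p q where pb: "is_pullback C s r p q" by (rule pullback_exists[OF rs(2,1)])
  note ty = pullback_typing[OF pb, unfolded dom]
  have transitive: "\<exists>\<tau> \<in> hom C (Dom C p) R. r \<cdot> \<tau> = r \<cdot> p \<and> s \<cdot> \<tau> = s \<cdot> q"
  proof (rule loc[OF Comp_in_hom[OF ty(4) rs(1)] Comp_in_hom[OF ty(5) rs(2)] cov[OF ty(4)], OF ballI])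
    fix c assume "c \<in> {c \<in> arrows_into C (Dom C p).
       \<exists>i j k. \<exists>u \<in> hom J i k. \<exists>v \<in> hom J j k. \<exists>a \<in> hom C (Dom C c) (OMap G i).
         \<exists>b \<in> hom C (Dom C c) (OMap G j). MMap G u \<cdot> a = MMap G v \<cdot> b \<and>
           r \<cdot> (p \<cdot> c) = \<eta> i \<cdot> a \<and> s \<cdot> (p \<cdot> c) = \<eta> j \<cdot> b}"
    then obtain i j k u v a b where c: "c \<in> arrows_into C (Dom C p)" and u: "u \<in> hom J i k"
      and v: "v \<in> hom J j k" and a: "a \<in> hom C (Dom C c) (OMap G i)"
      and b: "b \<in> hom C (Dom C c) (OMap G j)" and uv: "MMap G u \<cdot> a = MMap G v \<cdot> b"
      and eq: "r \<cdot> (p \<cdot> c) = \<eta> i \<cdot> a" "s \<cdot> (p \<cdot> c) = \<eta> j \<cdot> b" by blast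
    define t where "t = Dom C c"
    note a = a[folded t_def] and b = b[folded t_def]
    have ch: "c \<in> hom C t (Dom C p)" using c by (simp add: arrows_into_def hom_def t_def)
    note pc = Comp_in_hom[OF ch ty(4)] and qc = Comp_in_hom[OF ch ty(5)]
    note i = G.A.hom_Obj(1)[OF u] and j = G.A.hom_Obj(1)[OF v]
    have "\<exists>h \<in> hom C t R. r \<cdot> h = r \<cdot> (p \<cdot> c) \<and> s \<cdot> h = s \<cdot> (q \<cdot> c)"
    proof (rule loc[OF Comp_in_hom[OF pc rs(1)] Comp_in_hom[OF qc rs(2)] cov[OF qc], OF ballI])
      fix c' assume "c' \<in> {c' \<in> arrows_into C t.
       \<exists>i j k. \<exists>u \<in> hom J i k. \<exists>v \<in> hom J j k. \<exists>a \<in> hom C (Dom C c') (OMap G i).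
         \<exists>b \<in> hom C (Dom C c') (OMap G j). MMap G u \<cdot> a = MMap G v \<cdot> b \<and>
           r \<cdot> (q \<cdot> c \<cdot> c') = \<eta> i \<cdot> a \<and> s \<cdot> (q \<cdot> c \<cdot> c') = \<eta> j \<cdot> b}"
      then obtain j' l k' u' v' a' b' where c': "c' \<in> arrows_into C t" and u': "u' \<in> hom J j' k'"
        and v': "v' \<in> hom J l k'" and a': "a' \<in> hom C (Dom C c') (OMap G j')"
        and b': "b' \<in> hom C (Dom C c') (OMap G l)" and uv': "MMap G u' \<cdot> a' = MMap G v' \<cdot> b'"
        and eq': "r \<cdot> (q \<cdot> c \<cdot> c') = \<eta> j' \<cdot> a'" "s \<cdot> (q \<cdot> c \<cdot> c') = \<eta> l \<cdot> b'" by blast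
      define t' where "t' = Dom C c'"
      note a' = a'[folded t'_def] and b' = b'[folded t'_def]
      have ch': "c' \<in> hom C t' t" using c' by (simp add: arrows_into_def hom_def t'_def)
      note j' = G.A.hom_Obj(1)[OF u'] and l = G.A.hom_Obj(1)[OF v']
      note ac = Comp_in_hom[OF ch' a] and bc = Comp_in_hom[OF ch' b]
      note rpc = Comp_in_hom[OF pc rs(1)] and sqc = Comp_in_hom[OF qc rs(2)]
      have left: "r \<cdot> (p \<cdot> c) \<cdot> c' = \<eta> i \<cdot> (a \<cdot> c')"
        using eq(1) Comp_assoc[OF ch' a \<eta>[OF i]] by simp
      have right: "s \<cdot> (q \<cdot> c) \<cdot> c' = \<eta> l \<cdot> b'" using eq'(2) Comp_assoc[OF ch' qc rs(2)] by simp
      have "s \<cdot> (p \<cdot> c) = r \<cdot> (q \<cdot> c)" by (rule Comp_extend[OF ty(6,4) rs(2) ty(5) rs(1) ch])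
      then have "\<eta> j \<cdot> (b \<cdot> c') = \<eta> j' \<cdot> a'"
        using Comp_extend[OF _ pc rs(2) qc rs(1) ch'] Comp_extend[OF eq(2) pc rs(2) b \<eta>[OF j] ch'] eq'(1)
        by simp
      then consider (same) "j = j'" "b \<cdot> c' = a'" | (empty) "covers C t' {}"
        using disj[OF j j' bc a'] by blast
      then have "\<exists>h \<in> hom C t' R. r \<cdot> h = r \<cdot> (p \<cdot> c) \<cdot> c' \<and> s \<cdot> h = s \<cdot> (q \<cdot> c) \<cdot> c'"
      proof cases
        \<comment> \<open>The two middle elements lie in different summands.\<close>
        case empty
        show ?thesis by (rule loc[OF Comp_in_hom[OF ch' rpc] Comp_in_hom[OF ch' sqc] empty]) simp
      next
        \<comment> \<open>Both middle elements lie in \<open>G j\<close> and are equal there, so a stage \<open>m\<close> past \<open>k\<close> and \<open>k'\<close> identifies the outer ones.\<close>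
        case same
        obtain m w w' where w: "w \<in> hom J k m" and w': "w' \<in> hom J k' m"
          and ww: "w \<cdot>\<^bsub>J\<^esub> v = w' \<cdot>\<^bsub>J\<^esub> u'"
          using amalgamate[OF v] u' same(1) by blast
        note Gw = G.MMap_in_hom[OF w] and Gw' = G.MMap_in_hom[OF w']
        note Gu = G.MMap_in_hom[OF u] and Gv = G.MMap_in_hom[OF v]
          and Gu' = G.MMap_in_hom[OF u'] and Gv' = G.MMap_in_hom[OF v']
        have "MMap G (w \<cdot>\<^bsub>J\<^esub> u) \<cdot> (a \<cdot> c') = MMap G w \<cdot> (MMap G u \<cdot> (a \<cdot> c'))"
          using G.MMap_Comp[OF u w] Comp_assoc[OF ac Gu Gw] by simp
        also have "\<dots> = MMap G w \<cdot> (MMap G v \<cdot> (b \<cdot> c'))"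
          using Comp_extend[OF uv a Gu b Gv ch'] by simp
        also have "\<dots> = MMap G (w \<cdot>\<^bsub>J\<^esub> v) \<cdot> (b \<cdot> c')"
          using G.MMap_Comp[OF v w] Comp_assoc[OF bc Gv Gw] by simp
        also have "\<dots> = MMap G (w' \<cdot>\<^bsub>J\<^esub> u') \<cdot> a'" using ww same(2) by simp
        also have "\<dots> = MMap G w' \<cdot> (MMap G u' \<cdot> a')"
          using G.MMap_Comp[OF u' w'] Comp_assoc[OF a' Gu' Gw'] by simp
        also have "\<dots> = MMap G w' \<cdot> (MMap G v' \<cdot> b')" using uv' by simp
        also have "\<dots> = MMap G (w' \<cdot>\<^bsub>J\<^esub> v') \<cdot> b'"
          using G.MMap_Comp[OF v' w'] Comp_assoc[OF b' Gv' Gw'] by simp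
        finally have "\<exists>h \<in> hom C t' R. r \<cdot> h = \<eta> i \<cdot> (a \<cdot> c') \<and> s \<cdot> h = \<eta> l \<cdot> b'"
          by (rule gen[OF G.A.Comp_in_hom[OF u w] G.A.Comp_in_hom[OF v' w'] ac b'])
        then show ?thesis unfolding left right .
      qed
      then show "\<exists>h \<in> hom C (Dom C c') R. r \<cdot> h = r \<cdot> (p \<cdot> c) \<cdot> c' \<and> s \<cdot> h = s \<cdot> (q \<cdot> c) \<cdot> c'"
        by (simp only: t'_def)
    qed
    then show "\<exists>h \<in> hom C (Dom C c) R. r \<cdot> h = r \<cdot> p \<cdot> c \<and> s \<cdot> h = s \<cdot> q \<cdot> c"
      using Comp_assoc[OF ch ty(4) rs(1)] Comp_assoc[OF ch ty(5) rs(2)] by (simp add: t_def)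
  qed

  have "internal_equivalence_relation C x r s"
    unfolding internal_equivalence_relation_def dom
    using rs reflexive symmetric transitive pb jointly_monicD[OF rs(3), unfolded dom] by blast
  then obtain e where co: "is_coequalizer C r s e" and ker: "is_pullback C e e r s"
    by (rule equivalence_quotient[OF x])
  note ety = coequalizer_typing[OF co]
  define Q where "Q = Cod C e"
  have "Cod C r = x" using rs by (simp add: hom_def)
  then have e: "e \<in> hom C x Q" using ety(3) by (simp add: Q_def)
  then have dome: "Dom C e = x" by (simp add: hom_def)
  have eff: "effective_epi C e" using co ker by (auto simp: effective_epi_def)
  have cove: "covers C Q {e}" using effective_epi_covers[OF eff] by (simp add: Q_def)
  define \<iota> where "\<iota> i = e \<cdot> \<eta> i" for i
  have \<iota>h: "\<iota> i \<in> hom C (OMap G i) Q" if "i \<in> Obj J" for i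
    unfolding \<iota>_def by (rule Comp_in_hom[OF \<eta>[OF that] e])
  have \<iota>_comp: "\<iota> i \<cdot> a = e \<cdot> (\<eta> i \<cdot> a)" if "i \<in> Obj J" "a \<in> hom C t (OMap G i)" for i a t
    unfolding \<iota>_def by (rule Comp_assoc[OF that(2) \<eta>[OF that(1)] e])
  have "locally_exact_cocone C J G Q \<iota>"
    unfolding locally_exact_cocone_def
  proof (intro conjI ballI allI impI)
    show "is_cocone C J G Q \<iota>"
    proof (rule is_cocone_intro[OF G.A.category_axioms hom_Obj(2)[OF e] \<iota>h])
      fix u i k assume u: "u \<in> hom J i k"
      note i = G.A.hom_Obj(1)[OF u] and k = G.A.hom_Obj(2)[OF u] and Gu = G.MMap_in_hom[OF u]
      have I: "Id C (OMap G i) \<in> hom C (OMap G i) (OMap G i)"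
        by (rule Id_in_hom[OF G.OMap_in_Obj[OF i]])
      have "MMap G (Id J k) \<cdot> MMap G u = MMap G u \<cdot> Id C (OMap G i)"
        using GId(3)[OF k Gu] Comp_Id_right[OF Gu] by simp
      from gen[OF GId(2)[OF k] u Gu I this]
      obtain h where h: "h \<in> hom C (OMap G i) R" "r \<cdot> h = \<eta> k \<cdot> MMap G u" "s \<cdot> h = \<eta> i"
        using Comp_Id_right[OF \<eta>[OF i]] by auto
      have "e \<cdot> (r \<cdot> h) = e \<cdot> (s \<cdot> h)" by (rule Comp_extend[OF ety(4) rs(1) e rs(2) e h(1)])
      then have "e \<cdot> (\<eta> k \<cdot> MMap G u) = \<iota> i" using h by (simp add: \<iota>_def)
      then show "\<iota> k \<cdot> MMap G u = \<iota> i" using \<iota>_comp[OF k Gu] by simp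
    qed
    {
      fix t a assume a: "a \<in> hom C t Q"
      show "covers C t {c \<in> arrows_into C t. \<exists>i \<in> Obj J. sub_le C (a \<cdot> c) (\<iota> i)}"
        (is "covers C t ?T")
        unfolding covers_def
      proof (intro conjI ballI impI)
        show t: "t \<in> Obj C" by (rule hom_Obj[OF a])
        fix n assume n: "n \<in> subobjects C t" and all: "\<forall>c \<in> ?T. sub_le C c n"
        have one: "|{e}| <o \<kappa>"
          by (rule card_finite_less[OF Cinfinite_\<kappa>]) simp
        show "sub_le C (Id C t) n"
        proof (rule sub_le_local[OF covers_stable[OF cove one a] Id_in_hom[OF t] n])
          fix c w assume ch: "c \<in> hom C w t"
            and "c \<in> {c \<in> arrows_into C t. \<exists>f \<in> {e}. sub_le C (a \<cdot> c) f}"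
          then have "sub_le C (a \<cdot> c) e" by blast
          then obtain b where b: "b \<in> hom C w x" "e \<cdot> b = a \<cdot> c"
            using sub_leE[OF _ Comp_in_hom[OF ch a]] dome by metis
          have "sub_le C c n"
          proof (rule sub_le_local[OF covers_stable[OF cov\<eta> small_image[OF small_Obj[OF G small_J]] b(1)] ch n])
            fix c' w' assume ch': "c' \<in> hom C w' w"
              and "c' \<in> {c \<in> arrows_into C w. \<exists>f \<in> \<eta> ` Obj J. sub_le C (b \<cdot> c) f}"
            then obtain i where i: "i \<in> Obj J" and le: "sub_le C (b \<cdot> c') (\<eta> i)" by blast
            have "Dom C (\<eta> i) = OMap G i" using \<eta>[OF i] by (simp add: hom_def)
            then obtain d where d: "d \<in> hom C w' (OMap G i)" "\<eta> i \<cdot> d = b \<cdot> c'"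
              using sub_leE[OF le Comp_in_hom[OF ch' b(1)]] by metis
            have "\<iota> i \<cdot> d = e \<cdot> (b \<cdot> c')" using \<iota>_comp[OF i d(1)] d(2) by simp
            also have "\<dots> = a \<cdot> (c \<cdot> c')" by (rule Comp_extend[OF b(2,1) e ch a ch'])
            finally have "sub_le C (a \<cdot> (c \<cdot> c')) (\<iota> i)"
              using d(1) \<iota>h[OF i] by (auto intro!: sub_leI simp: hom_def)
            moreover have "c \<cdot> c' \<in> arrows_into C t"
              using Comp_in_hom[OF ch' ch] by (simp add: arrows_into_def hom_def)
            ultimately show "sub_le C (c \<cdot> c') n" using all i by blast
          qed
          then show "sub_le C (Id C t \<cdot> c) n" using Comp_Id_left[OF ch] by simp
        qed
      qed auto
    next
      fix i j t a b assume i: "i \<in> Obj J" and j: "j \<in> Obj J"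
        and a: "a \<in> hom C t (OMap G i)" and b: "b \<in> hom C t (OMap G j)" and eq: "\<iota> i \<cdot> a = \<iota> j \<cdot> b"
      note \<eta>a = Comp_in_hom[OF a \<eta>[OF i]] and \<eta>b = Comp_in_hom[OF b \<eta>[OF j]]
      have "e \<cdot> (\<eta> i \<cdot> a) = e \<cdot> (\<eta> j \<cdot> b)" using eq \<iota>_comp[OF i a] \<iota>_comp[OF j b] by simp
      then obtain h where h: "h \<in> hom C t R" "r \<cdot> h = \<eta> i \<cdot> a" "s \<cdot> h = \<eta> j \<cdot> b"
        using pullback_lift[OF ker, unfolded dome dom, OF \<eta>a \<eta>b] by metis
      show "covers C t {c \<in> arrows_into C t. \<exists>k. \<exists>u \<in> hom J i k. \<exists>v \<in> hom J j k.
        MMap G u \<cdot> (a \<cdot> c) = MMap G v \<cdot> (b \<cdot> c)}" (is "covers C t ?T")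
        unfolding covers_def
      proof (intro conjI ballI impI)
        show t: "t \<in> Obj C" by (rule hom_Obj[OF a])
        fix n assume n: "n \<in> subobjects C t" and all: "\<forall>c \<in> ?T. sub_le C c n"
        show "sub_le C (Id C t) n"
        proof (rule sub_le_local[OF cov[OF h(1)] Id_in_hom[OF t] n])
          fix c w assume ch: "c \<in> hom C w t" and "c \<in> {c \<in> arrows_into C t.
            \<exists>i j k. \<exists>u \<in> hom J i k. \<exists>v \<in> hom J j k. \<exists>a \<in> hom C (Dom C c) (OMap G i).
             \<exists>b \<in> hom C (Dom C c) (OMap G j). MMap G u \<cdot> a = MMap G v \<cdot> b \<and>
               r \<cdot> (h \<cdot> c) = \<eta> i \<cdot> a \<and> s \<cdot> (h \<cdot> c) = \<eta> j \<cdot> b}"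
          then obtain i' j' k u v a' b' where u: "u \<in> hom J i' k" and v: "v \<in> hom J j' k"
            and a': "a' \<in> hom C (Dom C c) (OMap G i')" and b': "b' \<in> hom C (Dom C c) (OMap G j')"
            and uv: "MMap G u \<cdot> a' = MMap G v \<cdot> b'"
            and eq': "r \<cdot> (h \<cdot> c) = \<eta> i' \<cdot> a'" "s \<cdot> (h \<cdot> c) = \<eta> j' \<cdot> b'" by blast
          have dc: "Dom C c = w" using ch by (simp add: hom_def)
          note a' = a'[unfolded dc] and b' = b'[unfolded dc]
          note i' = G.A.hom_Obj(1)[OF u] and j' = G.A.hom_Obj(1)[OF v]
          have "\<eta> i \<cdot> (a \<cdot> c) = \<eta> i' \<cdot> a'" "\<eta> j \<cdot> (b \<cdot> c) = \<eta> j' \<cdot> b'"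
            using Comp_extend[OF h(2,1) rs(1) a \<eta>[OF i] ch] Comp_extend[OF h(3,1) rs(2) b \<eta>[OF j] ch]
              eq' by simp_all
          then consider (empty) "covers C w {}" | (same) "i = i'" "j = j'" "a \<cdot> c = a'" "b \<cdot> c = b'"
            using disj[OF i i' Comp_in_hom[OF ch a] a'] disj[OF j j' Comp_in_hom[OF ch b] b'] by blast
          then have "sub_le C c n"
          proof cases
            case empty
            show ?thesis by (rule sub_le_local[OF empty ch n]) simp
          next
            case same
            have "c \<in> arrows_into C t" using ch by (simp add: arrows_into_def hom_def)
            then show ?thesis using all u v uv same by blast
          qed
          then show "sub_le C (Id C t \<cdot> c) n" using Comp_Id_left[OF ch] by simp
        qed
      qed auto
    }
  qed
  then show ?thesis by blast
qed

end

end

section \<open>Filtered colimits in pretoposes\<close>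

lemma pretopos_catI:
  assumes "Cinfinite \<kappa>" "pretopos \<kappa> C"
  shows "pretopos_cat C \<kappa>"
proof -
  have geometric: "geometric_category \<kappa> C" using assms(2) by (simp add: pretopos_def)
  then interpret category C
    by (simp add: geometric_category_def coherent_category_def regular_category_def)
  show ?thesis by unfold_locales (use geometric assms in auto)
qed

theorem theorem5p8:
  fixes \<kappa> :: "'l rel" and D :: "('o, 'm) cat"
  assumes "Cinfinite \<kappa>" and "regularCard \<kappa>" and "pretopos \<kappa> D"
  shows
    "(\<forall>(J :: ('i, 'j) cat) G.
        filtered_category J \<and> |Mor J| <o \<kappa> \<and> cat_functor J D G \<longrightarrow>
        (\<exists>x \<iota>. is_colimit D J G x \<iota>) \<and>
        (\<forall>x \<iota>. is_colimit D J G x \<iota> \<longrightarrow> pullback_stable_colimit D J G x \<iota>)) \<and>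
     (\<forall>(E :: ('p, 'n) cat) F. pretopos \<kappa> E \<and> geometric_functor \<kappa> D E F \<longrightarrow>
        (\<forall>(J :: ('i, 'j) cat) G x \<iota>.
           filtered_category J \<and> |Mor J| <o \<kappa> \<and> cat_functor J D G \<and> is_colimit D J G x \<iota> \<longrightarrow>
           is_colimit E J (ftor_comp F G) (OMap F x) (\<lambda>i. MMap F (\<iota> i))))"
proof -
  interpret D: pretopos_cat D \<kappa> by (rule pretopos_catI[OF assms(1) assms(3)])
  have exact: "locally_exact_cocone D J G x \<iota>"
    if "filtered_category J" "|Mor J| <o \<kappa>" "cat_functor J D G" "is_colimit D J G x \<iota>"
    for J :: "('i, 'j) cat" and G x \<iota>
    using D.locally_exact_cocone_exists[OF that(3,2,1)] D.colimit_locally_exact[OF that(3,2) _ that(4)]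
    by blast
  show ?thesis
  proof (intro conjI allI impI; elim conjE)
    fix J :: "('i, 'j) cat" and G
    assume J: "filtered_category J" "|Mor J| <o \<kappa>" and G: "cat_functor J D G"
    show "\<exists>x \<iota>. is_colimit D J G x \<iota>"
      using D.locally_exact_cocone_exists[OF G J(2,1)] D.locally_exact_cocone_colimit[OF G J(2)]
      by blast
    fix x \<iota> assume colim: "is_colimit D J G x \<iota>"
    have lex: "locally_exact_cocone D J G x \<iota>" by (rule exact[OF J G colim])
    have catJ: "category J" using J(1) by (simp add: filtered_category_def)
    show "pullback_stable_colimit D J G x \<iota>"
      unfolding pullback_stable_colimit_def
    proof (intro allI impI; elim conjE)
      fix f G' p q
      assume f: "f \<in> Mor D" "Cod D f = x" and G': "cat_functor J D G'"
        and pb: "\<forall>i \<in> Obj J. Dom D (p i) = OMap G' i \<and> is_pullback D f (\<iota> i) (p i) (q i)"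
        and compat: "\<forall>u \<in> Mor J. p (Cod J u) \<cdot>\<^bsub>D\<^esub> MMap G' u = p (Dom J u) \<and>
          q (Cod J u) \<cdot>\<^bsub>D\<^esub> MMap G' u = MMap G u \<cdot>\<^bsub>D\<^esub> q (Dom J u)"
      have "locally_exact_cocone D J G' (Dom D f) p"
        by (rule locally_exact_cocone_pullback[OF D.category_axioms catJ G G' lex])
          (use f pb compat in \<open>auto simp: hom_def\<close>)
      then show "is_colimit D J G' (Dom D f) p" by (rule D.locally_exact_cocone_colimit[OF G' J(2)])
    qed
  next
    fix E :: "('p, 'n) cat" and F and J :: "('i, 'j) cat" and G x \<iota>
    assume E: "pretopos \<kappa> E" and F: "geometric_functor \<kappa> D E F"
      and J: "filtered_category J" "|Mor J| <o \<kappa>" and G: "cat_functor J D G"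
      and colim: "is_colimit D J G x \<iota>"
    interpret E: pretopos_cat E \<kappa> by (rule pretopos_catI[OF assms(1) E])
    have Ff: "cat_functor D E F" using F by (simp add: geometric_functor_def)
    have "locally_exact_cocone E J (ftor_comp F G) (OMap F x) (\<lambda>i. MMap F (\<iota> i))"
      by (rule geometric_functor_locally_exact[OF D.geometric_cat_axioms E.geometric_cat_axioms F G
            J(2) exact[OF J G colim]])
    then show "is_colimit E J (ftor_comp F G) (OMap F x) (\<lambda>i. MMap F (\<iota> i))"
      by (rule E.locally_exact_cocone_colimit[OF ftor_comp_functor[OF Ff G] J(2)])
  qed
qed

end
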